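(* Let $M = \mathrm{Inv}\langle X \mid r_i(u_1, u_2, \ldots, u_k) = 1\ (i \in I)\rangle$ be a finitely presented special inverse monoid, where $u_1,\dots,u_k$ are words over $X \cup X^{-1}$, and let $G = \mathrm{Gp}\langle X \mid r_i(u_1, u_2, \ldots, u_k) = 1\ (i \in I)\rangle$ be its maximal group image. Suppose that the words $u_1, \ldots, u_k$ are uniquely marked and form a conservative factorisation in $G$ (in particular, the latter holds if the factorisation is unital in $M$), and that $G$ has decidable word problem. Then $G$ (with the given presentation) has decidable prefix membership problem and $M_{EU}$ has decidable word problem (in particular, $M$ has decidable word problem if it is E-unitary).
   Context: $\mathrm{Inv}\langle X \mid R\rangle$ and $\mathrm{Gp}\langle X \mid R\rangle$ denote the inverse monoid, respectively group, with generators $X$ and defining relations $R$ between words over $X \cup X^{-1}$. Words are not assumed reduced. The notation $r_i(u_1,\ldots,u_k)$ means that the word $r_i$ is given as a concatenation (in the free monoid, without cancellation) of the words $u_j$ and their formal inverses; by convention no proper subset of $\{u_1,\dots,u_k\}$ suffices to write all the $r_i$, so each $u_j$ occurs as $u_j$ or $u_j^{-1}$ in at least one $r_i$. The words are uniquely marked if for each $j$ there is a letter $x_j \in X$ appearing precisely once in $u_j$ (counting both $x_j$ and $x_j^{-1}$) and not appearing (as $x_j$ or $x_j^{-1}$) in any $u_{j'}$, $j'\neq j$. The factorisation is unital in $M$ if each $u_j$ represents a unit of $M$. $\mathrm{pref}(w)$ is the set of prefixes of $w$, $\mathrm{Mon}\langle S\rangle\le G$ is the submonoid generated by the elements represented by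 $S$. Let $V \subseteq \{u_1^{\pm1},\dots,u_k^{\pm1}\}$ be minimal such that $r_i \in V^\ast$ for all $i\in I$; the factorisation is conservative in $G$ if $\mathrm{Mon}\langle \bigcup_{i}\mathrm{pref}(r_i)\rangle = \mathrm{Mon}\langle \bigcup_{v \in V} \mathrm{pref}(v)\rangle \le G$. The prefix monoid of $G$ (for this presentation) is $\mathrm{Mon}\langle \bigcup_{i}\mathrm{pref}(r_i)\rangle\le G$, and the prefix membership problem asks, given a word $w$ over $X\cup X^{-1}$, whether $w$ represents an element of the prefix monoid. The word problem asks, given two words over $X\cup X^{-1}$, whether they represent the same element. $M$ is E-unitary if only idempotents of $M$ map to $1$ in its maximal group image; $M_{EU}$ is the maximal E-unitary image of $M$, i.e. the largest homomorphic image (quotient) of $M$ that is E-unitary, generated by (the image of) $X$. *)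

theory Defs
  imports "HOL-Algebra.Group" "HOL-Library.Nat_Bijection" "HOL-Library.Countable_Set"
    "HOL-Library.Sublist"
begin

section \<open>Words over a set of generators and their inverses\<close>

text \<open>The pair \<open>(x, True)\<close> stands for the letter \<open>x\<close>, and \<open>(x, False)\<close> for its formal
  inverse. Words are not reduced.\<close>

type_synonym 'a word = "('a \<times> bool) list"

definition words :: "'a set \<Rightarrow> 'a word set" where
  "words X = lists (X \<times> UNIV)"

definition inv_word :: "'a word \<Rightarrow> 'a word" where
  "inv_word w = rev (map (apsnd Not) w)"

definition word_monoid :: "'a set \<Rightarrow> 'a word monoid" where
  "word_monoid X = \<lparr>carrier = words X, mult = (@), one = []\<rparr>"

definition pref :: "'a word \<Rightarrow> 'a word set" where
  "pref w = {p. prefix p w}"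

section \<open>Congruences, quotients, submonoids\<close>

definition mon_cong :: "('a, 'b) monoid_scheme \<Rightarrow> ('a \<times> 'a) set \<Rightarrow> bool" where
  "mon_cong M \<rho> \<longleftrightarrow> equiv (carrier M) \<rho> \<and>
     (\<forall>a b c d. (a, b) \<in> \<rho> \<longrightarrow> (c, d) \<in> \<rho> \<longrightarrow> (a \<otimes>\<^bsub>M\<^esub> c, b \<otimes>\<^bsub>M\<^esub> d) \<in> \<rho>)"

definition gen_cong :: "('a, 'b) monoid_scheme \<Rightarrow> ('a \<times> 'a) set \<Rightarrow> ('a \<times> 'a) set" where
  "gen_cong M S = \<Inter>{\<rho>. mon_cong M \<rho> \<and> S \<subseteq> \<rho>}"

definition quot_mon :: "('a, 'b) monoid_scheme \<Rightarrow> ('a \<times> 'a) set \<Rightarrow> 'a set monoid" where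
  "quot_mon M \<rho> = \<lparr>carrier = carrier M // \<rho>,
     mult = (\<lambda>A B. \<Union>a\<in>A. \<Union>b\<in>B. \<rho> `` {a \<otimes>\<^bsub>M\<^esub> b}),
     one = \<rho> `` {\<one>\<^bsub>M\<^esub>}\<rparr>"

definition mon_gen :: "('a, 'b) monoid_scheme \<Rightarrow> 'a set \<Rightarrow> 'a set" where
  "mon_gen M A = \<Inter>{H. submonoid H M \<and> A \<subseteq> H}"

section \<open>Group and inverse monoid presentations\<close>

definition gp_cong :: "'a set \<Rightarrow> ('a word \<times> 'a word) set \<Rightarrow> ('a word \<times> 'a word) set" where
  "gp_cong X R = gen_cong (word_monoid X) (R \<union> {(w @ inv_word w, []) | w. w \<in> words X})"

text \<open>The free inverse monoid is the quotient of the word monoid by the Wagner congruence, which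
  is generated by the pairs below; an inverse monoid presentation adds its relations to them.\<close>

definition inv_cong :: "'a set \<Rightarrow> ('a word \<times> 'a word) set \<Rightarrow> ('a word \<times> 'a word) set" where
  "inv_cong X R = gen_cong (word_monoid X)
     (R \<union> {(w @ inv_word w @ w, w) | w. w \<in> words X}
        \<union> {(v @ inv_word v @ w @ inv_word w, w @ inv_word w @ v @ inv_word v) | v w.
             v \<in> words X \<and> w \<in> words X})"

definition Gp :: "'a set \<Rightarrow> ('a word \<times> 'a word) set \<Rightarrow> 'a word set monoid" where
  "Gp X R = quot_mon (word_monoid X) (gp_cong X R)"

definition Inv :: "'a set \<Rightarrow> ('a word \<times> 'a word) set \<Rightarrow> 'a word set monoid" where
  "Inv X R = quot_mon (word_monoid X) (inv_cong X R)"

definition gp_elem :: "'a set \<Rightarrow> ('a word \<times> 'a word) set \<Rightarrow> 'a word \<Rightarrow> 'a word set" where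
  "gp_elem X R w = gp_cong X R `` {w}"

definition inv_elem :: "'a set \<Rightarrow> ('a word \<times> 'a word) set \<Rightarrow> 'a word \<Rightarrow> 'a word set" where
  "inv_elem X R w = inv_cong X R `` {w}"

definition special :: "'a word set \<Rightarrow> ('a word \<times> 'a word) set" where
  "special rs = {(r, []) | r. r \<in> rs}"

section \<open>E-unitary inverse monoids\<close>

definition max_group_cong :: "('a, 'b) monoid_scheme \<Rightarrow> ('a \<times> 'a) set" where
  "max_group_cong M = \<Inter>{\<rho>. mon_cong M \<rho> \<and> group (quot_mon M \<rho>)}"

definition E_unitary :: "('a, 'b) monoid_scheme \<Rightarrow> bool" where
  "E_unitary M \<longleftrightarrow>
     (\<forall>s\<in>carrier M. (s, \<one>\<^bsub>M\<^esub>) \<in> max_group_cong M \<longrightarrow> s \<otimes>\<^bsub>M\<^esub> s = s)"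

text \<open>The largest E-unitary quotient is the quotient by the least congruence whose quotient is
  E-unitary. The lemmas \<open>mon_cong_EU_cong\<close> and \<open>E_unitary_max_EU\<close> below show that the
  intersection of all such congruences is again one of them.\<close>

definition EU_cong :: "('a, 'b) monoid_scheme \<Rightarrow> ('a \<times> 'a) set" where
  "EU_cong M = \<Inter>{\<rho>. mon_cong M \<rho> \<and> E_unitary (quot_mon M \<rho>)}"

definition max_EU :: "('a, 'b) monoid_scheme \<Rightarrow> 'a set monoid" where
  "max_EU M = quot_mon M (EU_cong M)"

text \<open>The element of \<open>max_EU (Inv X R)\<close> represented by a word.\<close>

definition EU_elem :: "'a set \<Rightarrow> ('a word \<times> 'a word) set \<Rightarrow> 'a word \<Rightarrow> 'a word set set" where
  "EU_elem X R w = EU_cong (Inv X R) `` {inv_elem X R w}"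

section \<open>Factorisations of the relators\<close>

text \<open>Below, \<open>rs\<close> is the set of relators and \<open>us\<close> the set of factors.\<close>

definition signed :: "'a word set \<Rightarrow> 'a word set" where
  "signed us = us \<union> inv_word ` us"

definition free_star :: "'a word set \<Rightarrow> 'a word set" where
  "free_star V = concat ` lists V"

definition factorisation :: "'a word set \<Rightarrow> 'a word set \<Rightarrow> bool" where
  "factorisation rs us \<longleftrightarrow> rs \<subseteq> free_star (signed us) \<and>
     (\<forall>us'. us' \<subset> us \<longrightarrow> \<not> rs \<subseteq> free_star (signed us'))"

definition uniquely_marked :: "'a set \<Rightarrow> nat \<Rightarrow> (nat \<Rightarrow> 'a word) \<Rightarrow> bool" where
  "uniquely_marked X k u \<longleftrightarrow>
     (\<forall>j\<in>{1..k}. \<exists>x\<in>X. count_list (map fst (u j)) x = 1 \<and>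
        (\<forall>j'\<in>{1..k} - {j}. x \<notin> fst ` set (u j')))"

definition unital :: "'a set \<Rightarrow> 'a word set \<Rightarrow> 'a word set \<Rightarrow> bool" where
  "unital X rs us \<longleftrightarrow>
     (\<forall>w\<in>us. inv_elem X (special rs) w \<in> Units (Inv X (special rs)))"

definition minimal_factors :: "'a word set \<Rightarrow> 'a word set \<Rightarrow> 'a word set \<Rightarrow> bool" where
  "minimal_factors rs us V \<longleftrightarrow> V \<subseteq> signed us \<and> rs \<subseteq> free_star V \<and>
     (\<forall>V'. V' \<subset> V \<longrightarrow> \<not> rs \<subseteq> free_star V')"

definition prefix_monoid :: "'a set \<Rightarrow> 'a word set \<Rightarrow> 'a word set set" where
  "prefix_monoid X rs =
     mon_gen (Gp X (special rs)) (gp_elem X (special rs) ` (\<Union>r\<in>rs. pref r))"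

text \<open>If the factors are uniquely marked, each relator factors in only one way over the signed
  factors, so there is exactly one \<open>V\<close> with \<open>minimal_factors rs us V\<close>.\<close>

definition conservative :: "'a set \<Rightarrow> 'a word set \<Rightarrow> 'a word set \<Rightarrow> bool" where
  "conservative X rs us \<longleftrightarrow> (\<forall>V. minimal_factors rs us V \<longrightarrow>
     prefix_monoid X rs =
     mon_gen (Gp X (special rs)) (gp_elem X (special rs) ` (\<Union>v\<in>V. pref v)))"

section \<open>Decidability\<close>

text \<open>The total recursive functions of \<open>n\<close> arguments, as functions of argument lists of length
  \<open>n\<close>; the values on lists of other lengths are irrelevant. Minimisation is restricted to regular
  functions, which yields precisely the total functions among the partial recursive ones.\<close>

inductive recursive_fun :: "nat \<Rightarrow> (nat list \<Rightarrow> nat) \<Rightarrow> bool" where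
  zero: "recursive_fun n (\<lambda>_. 0)"
| succ: "recursive_fun 1 (\<lambda>xs. Suc (xs ! 0))"
| proj: "i < n \<Longrightarrow> recursive_fun n (\<lambda>xs. xs ! i)"
| comp: "recursive_fun (length gs) f \<Longrightarrow> (\<And>g. g \<in> set gs \<Longrightarrow> recursive_fun n g) \<Longrightarrow>
    recursive_fun n (\<lambda>xs. f (map (\<lambda>g. g xs) gs))"
| prim_rec: "recursive_fun n f \<Longrightarrow> recursive_fun (Suc (Suc n)) g \<Longrightarrow>
    recursive_fun (Suc n) (\<lambda>xs. rec_nat (f (tl xs)) (\<lambda>m y. g (m # y # tl xs)) (hd xs))"
| mini: "recursive_fun (Suc n) f \<Longrightarrow> (\<And>xs. length xs = n \<Longrightarrow> \<exists>m. f (m # xs) = 0) \<Longrightarrow>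
    recursive_fun n (\<lambda>xs. LEAST m. f (m # xs) = 0)"

definition decidable :: "nat set \<Rightarrow> bool" where
  "decidable A \<longleftrightarrow> (\<exists>f. recursive_fun 1 f \<and> (\<forall>n. f [n] = (if n \<in> A then 1 else 0)))"

text \<open>For finite \<open>X\<close>, \<open>to_nat_on X\<close> is a bijection from \<open>X\<close> onto \<open>{..<card X}\<close>. Decidability
  does not depend on which such bijection is used, as any two differ by a permutation of a finite
  set.\<close>

definition word_code :: "'a set \<Rightarrow> 'a word \<Rightarrow> nat" where
  "word_code X w = list_encode (map (\<lambda>(x, b). 2 * to_nat_on X x + of_bool b) w)"

text \<open>\<open>ev\<close> maps each word to the element that it represents.\<close>

definition decidable_word_problem :: "'a set \<Rightarrow> ('a word \<Rightarrow> 'b) \<Rightarrow> bool" where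
  "decidable_word_problem X ev \<longleftrightarrow>
     decidable {prod_encode (word_code X v, word_code X w) | v w.
       v \<in> words X \<and> w \<in> words X \<and> ev v = ev w}"

definition decidable_prefix_membership :: "'a set \<Rightarrow> 'a word set \<Rightarrow> bool" where
  "decidable_prefix_membership X rs \<longleftrightarrow>
     decidable {word_code X w | w. w \<in> words X \<and> gp_elem X (special rs) w \<in> prefix_monoid X rs}"

section \<open>The maximal E-unitary quotient is E-unitary\<close>

lemma mon_cong_Inter:
  assumes "\<And>\<rho>. \<rho> \<in> C \<Longrightarrow> mon_cong M \<rho>" "C \<noteq> {}"
  shows "mon_cong M (\<Inter>C)"
proof -
  have "equiv (carrier M) (\<Inter>C)"
  proof (rule equivI)
    show "\<Inter>C \<subseteq> carrier M \<times> carrier M"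
      using assms unfolding mon_cong_def equiv_def by blast
    show "refl_on (carrier M) (\<Inter>C)"
      using assms unfolding mon_cong_def equiv_def refl_on_def by blast
    show "sym (\<Inter>C)" using assms unfolding mon_cong_def equiv_def sym_def by blast
    show "trans (\<Inter>C)" using assms unfolding mon_cong_def equiv_def trans_def by blast
  qed
  then show ?thesis using assms unfolding mon_cong_def by blast
qed

lemma quot_mult:
  assumes "mon_cong M \<rho>" "monoid M" "a \<in> carrier M" "b \<in> carrier M"
  shows "\<rho> `` {a} \<otimes>\<^bsub>quot_mon M \<rho>\<^esub> \<rho> `` {b} = \<rho> `` {a \<otimes>\<^bsub>M\<^esub> b}"
proof -
  have eq: "equiv (carrier M) \<rho>" using assms by (simp add: mon_cong_def)
  have class_eq: "\<rho> `` {c \<otimes>\<^bsub>M\<^esub> d} = \<rho> `` {a \<otimes>\<^bsub>M\<^esub> b}" if "(a, c) \<in> \<rho>" "(b, d) \<in> \<rho>" for c d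
    using assms(1) that equiv_class_eq[OF eq, of "a \<otimes>\<^bsub>M\<^esub> b" "c \<otimes>\<^bsub>M\<^esub> d"]
    unfolding mon_cong_def by blast
  have "(\<Union>c\<in>\<rho> `` {a}. \<Union>d\<in>\<rho> `` {b}. \<rho> `` {c \<otimes>\<^bsub>M\<^esub> d})
      = (\<Union>c\<in>\<rho> `` {a}. \<Union>d\<in>\<rho> `` {b}. \<rho> `` {a \<otimes>\<^bsub>M\<^esub> b})"
    by (intro SUP_cong refl class_eq) auto
  moreover have "a \<in> \<rho> `` {a}" "b \<in> \<rho> `` {b}"
    using equiv_class_self[OF eq] assms(3,4) by auto
  ultimately show ?thesis unfolding quot_mon_def by auto
qed

lemma quot_monoid:
  assumes "mon_cong M \<rho>" "monoid M"
  shows "monoid (quot_mon M \<rho>)"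
proof -
  interpret monoid M by fact
  have c: "carrier (quot_mon M \<rho>) = carrier M // \<rho>" "\<one>\<^bsub>quot_mon M \<rho>\<^esub> = \<rho> `` {\<one>\<^bsub>M\<^esub>}"
    by (simp_all add: quot_mon_def)
  note q = quot_mult[OF assms]
  show ?thesis
    by (rule monoidI) (auto simp: c q quotientI m_assoc elim!: quotientE)
qed

lemma quot_group_iff:
  assumes "mon_cong M \<rho>" "monoid M"
  shows "group (quot_mon M \<rho>) \<longleftrightarrow>
    (\<forall>a\<in>carrier M. \<exists>b\<in>carrier M. (b \<otimes>\<^bsub>M\<^esub> a, \<one>\<^bsub>M\<^esub>) \<in> \<rho>)"
proof -
  interpret monoid M by fact
  interpret Q: monoid "quot_mon M \<rho>" using quot_monoid[OF assms] .
  have eq: "equiv (carrier M) \<rho>" using assms by (simp add: mon_cong_def)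
  have c: "carrier (quot_mon M \<rho>) = carrier M // \<rho>" "\<one>\<^bsub>quot_mon M \<rho>\<^esub> = \<rho> `` {\<one>\<^bsub>M\<^esub>}"
    by (simp_all add: quot_mon_def)
  note q = quot_mult[OF assms]
  have "group (quot_mon M \<rho>) \<longleftrightarrow> (\<forall>A\<in>carrier (quot_mon M \<rho>). \<exists>B\<in>carrier (quot_mon M \<rho>).
      B \<otimes>\<^bsub>quot_mon M \<rho>\<^esub> A = \<one>\<^bsub>quot_mon M \<rho>\<^esub>)"
    (is "_ \<longleftrightarrow> ?L")
  proof
    assume "group (quot_mon M \<rho>)"
    then show ?L by (intro ballI group.l_inv_ex)
  next
    assume ?L
    then show "group (quot_mon M \<rho>)" by (intro Q.group_l_invI) simp
  qed
  also have "\<dots> \<longleftrightarrow> (\<forall>a\<in>carrier M. \<exists>b\<in>carrier M. \<rho> `` {b \<otimes>\<^bsub>M\<^esub> a} = \<rho> `` {\<one>\<^bsub>M\<^esub>})"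
  proof -
    have "carrier M // \<rho> = (\<lambda>a. \<rho> `` {a}) ` carrier M" by (auto simp: quotient_def)
    then show ?thesis by (simp add: c q)
  qed
  also have "\<dots> \<longleftrightarrow> (\<forall>a\<in>carrier M. \<exists>b\<in>carrier M. (b \<otimes>\<^bsub>M\<^esub> a, \<one>\<^bsub>M\<^esub>) \<in> \<rho>)"
    using eq_equiv_class_iff[OF eq] by simp
  finally show ?thesis .
qed

lemma mon_cong_EU_cong:
  assumes "monoid M"
  shows "mon_cong M (EU_cong M)"
proof -
  interpret monoid M by fact
  let ?U = "carrier M \<times> carrier M"
  have U: "mon_cong M ?U"
    unfolding mon_cong_def equiv_def refl_on_def sym_def trans_def by auto
  have "s \<otimes>\<^bsub>quot_mon M ?U\<^esub> s = s" if "s \<in> carrier (quot_mon M ?U)" for s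
  proof -
    have "s \<in> carrier M // ?U" using that by (simp add: quot_mon_def)
    then obtain a where a: "a \<in> carrier M" "s = ?U `` {a}" by (rule quotientE)
    show ?thesis unfolding a(2) quot_mult[OF U assms a(1) a(1)] using a(1) by auto
  qed
  then have "E_unitary (quot_mon M ?U)" unfolding E_unitary_def by blast
  with U show ?thesis
    unfolding EU_cong_def by (intro mon_cong_Inter) auto
qed

lemma E_unitary_max_EU:
  assumes M: "monoid M"
  shows "E_unitary (max_EU M)"
  unfolding E_unitary_def
proof (intro ballI impI)
  interpret monoid M by fact
  define E where "E = EU_cong M"
  define N where "N = quot_mon M E"
  have E: "mon_cong M E" using mon_cong_EU_cong[OF M] by (simp add: E_def)
  have Eeq: "equiv (carrier M) E" using E by (simp add: mon_cong_def)
  have N: "monoid N" unfolding N_def using quot_monoid[OF E M] .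
  have cN: "carrier N = carrier M // E" "\<one>\<^bsub>N\<^esub> = E `` {\<one>\<^bsub>M\<^esub>}"
    by (simp_all add: N_def quot_mon_def)
  fix s assume "s \<in> carrier (max_EU M)" "(s, \<one>\<^bsub>max_EU M\<^esub>) \<in> max_group_cong (max_EU M)"
  then have s: "s \<in> carrier N" "(s, \<one>\<^bsub>N\<^esub>) \<in> max_group_cong N"
    by (simp_all add: max_EU_def N_def E_def)
  then obtain a where a: "a \<in> carrier M" "s = E `` {a}" by (auto simp: cN elim: quotientE)
  have "(a \<otimes>\<^bsub>M\<^esub> a, a) \<in> \<rho>" if \<rho>: "mon_cong M \<rho>" and eu: "E_unitary (quot_mon M \<rho>)" for \<rho>
  proof -
    define Q where "Q = quot_mon M \<rho>"
    have Q: "monoid Q" unfolding Q_def using quot_monoid[OF \<rho> M] .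
    have cQ: "carrier Q = carrier M // \<rho>" "\<one>\<^bsub>Q\<^esub> = \<rho> `` {\<one>\<^bsub>M\<^esub>}"
      by (simp_all add: Q_def quot_mon_def)
    have req: "equiv (carrier M) \<rho>" using \<rho> by (simp add: mon_cong_def)
    have sub: "E \<subseteq> \<rho>" unfolding E_def EU_cong_def using \<rho> eu by blast
    define h where "h A = \<rho> `` A" for A
    have h: "h (E `` {b}) = \<rho> `` {b}" if "b \<in> carrier M" for b
    proof -
      have "(b, b) \<in> E" using Eeq that by (simp add: equiv_def refl_on_def)
      then show ?thesis unfolding h_def using sub req
        unfolding equiv_def trans_def by blast
    qed
    have hc: "h A \<in> carrier Q" if "A \<in> carrier N" for A
      using that by (auto simp: cN cQ h quotientI elim!: quotientE)
    have hm: "h (A \<otimes>\<^bsub>N\<^esub> B) = h A \<otimes>\<^bsub>Q\<^esub> h B" if "A \<in> carrier N" "B \<in> carrier N" for A B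
      using that quot_mult[OF E M] quot_mult[OF \<rho> M]
      by (auto simp: cN h N_def[symmetric] Q_def[symmetric] elim!: quotientE)
    have hs: "\<exists>A\<in>carrier N. h A = B" if "B \<in> carrier Q" for B
    proof -
      obtain b where "b \<in> carrier M" "B = \<rho> `` {b}"
        using \<open>B \<in> carrier Q\<close> by (auto simp: cQ elim: quotientE)
      then show ?thesis using h by (auto simp: cN intro!: bexI[of _ "E `` {b}"] quotientI)
    qed
    have h1: "h \<one>\<^bsub>N\<^esub> = \<one>\<^bsub>Q\<^esub>" by (simp add: cN cQ h)
    have "(h s, \<one>\<^bsub>Q\<^esub>) \<in> \<tau>" if \<tau>: "mon_cong Q \<tau>" and g: "group (quot_mon Q \<tau>)" for \<tau>
    proof -
      define \<sigma> where "\<sigma> = {(A, B). A \<in> carrier N \<and> B \<in> carrier N \<and> (h A, h B) \<in> \<tau>}"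
      have teq: "equiv (carrier Q) \<tau>" using \<tau> by (simp add: mon_cong_def)
      have "equiv (carrier N) \<sigma>"
      proof (rule equivI)
        show "\<sigma> \<subseteq> carrier N \<times> carrier N" unfolding \<sigma>_def by auto
        show "refl_on (carrier N) \<sigma>"
          using teq hc unfolding \<sigma>_def equiv_def refl_on_def by auto
        show "sym \<sigma>" using teq unfolding \<sigma>_def equiv_def sym_def by auto
        show "trans \<sigma>" using teq unfolding \<sigma>_def equiv_def trans_def by blast
      qed
      then have \<sigma>: "mon_cong N \<sigma>"
        using \<tau> hm monoid.m_closed[OF N] unfolding mon_cong_def by (auto simp: \<sigma>_def)
      have "\<exists>B\<in>carrier N. (B \<otimes>\<^bsub>N\<^esub> A, \<one>\<^bsub>N\<^esub>) \<in> \<sigma>" if A: "A \<in> carrier N" for A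
      proof -
        obtain B' where "B' \<in> carrier Q" "(B' \<otimes>\<^bsub>Q\<^esub> h A, \<one>\<^bsub>Q\<^esub>) \<in> \<tau>"
          using g hc[OF A] unfolding quot_group_iff[OF \<tau> Q] by blast
        then show ?thesis
          using hs A N by (force simp: \<sigma>_def hm h1 monoid.m_closed monoid.one_closed)
      qed
      then have "group (quot_mon N \<sigma>)" using quot_group_iff[OF \<sigma> N] by blast
      with \<sigma> s(2) have "(s, \<one>\<^bsub>N\<^esub>) \<in> \<sigma>" unfolding max_group_cong_def by blast
      then show ?thesis by (simp add: \<sigma>_def h1)
    qed
    then have "(h s, \<one>\<^bsub>Q\<^esub>) \<in> max_group_cong Q" unfolding max_group_cong_def by blast
    then have "h s \<otimes>\<^bsub>Q\<^esub> h s = h s"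
      using eu hc[OF s(1)] unfolding E_unitary_def Q_def by blast
    then have "\<rho> `` {a \<otimes>\<^bsub>M\<^esub> a} = \<rho> `` {a}"
      using quot_mult[OF \<rho> M a(1) a(1)] by (simp add: a h Q_def)
    then show ?thesis using eq_equiv_class_iff[OF req] a(1) by simp
  qed
  then have "(a \<otimes>\<^bsub>M\<^esub> a, a) \<in> E" unfolding E_def EU_cong_def by blast
  then have "s \<otimes>\<^bsub>N\<^esub> s = s"
    unfolding a(2) N_def quot_mult[OF E M a(1) a(1)] using equiv_class_eq[OF Eeq] by blast
  then show "s \<otimes>\<^bsub>max_EU M\<^esub> s = s" by (simp add: max_EU_def N_def E_def)
qed

end

theory Submission
  imports Defs
begin

text \<open>Write \<open>u j = a x b\<close> with \<open>x\<close> the marked letter. Replacing \<open>x\<close> by \<open>u j\<close> as a generator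
  shows that \<open>G\<close> is the free product of the free group on the unmarked letters and the subgroup \<open>H\<close>
  generated by the factors. By conservativity the prefix monoid is generated by \<open>H\<close> and the finitely
  many prefixes of the words \<open>a\<close> and \<open>b\<^sup>-\<^sup>1\<close>, so membership is decided on normal forms by
  a finite automaton saturated under free reduction, as in Benois' theorem. A normal form is found by
  searching for the word with the least code that represents the given element: deleting a nonempty
  subword decreases the code, so no nonempty subword of that word represents the identity.

  Two words are equal in the maximal E-unitary quotient if and only if they are equal in \<open>G\<close> and
  span the same subgraph of the Cayley graph after closing under the loops labelled by the relators.
  This is a finite condition on edges, decidable by means of prefix membership.\<close>

section \<open>Recursive functions\<close>

text \<open>No free product is constructed. Instead \<open>G\<close> acts on a set of normal forms,
  in the manner of van der Waerden, and only the defining relations have to be checked. The group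
  syllables may carry any element of \<open>G\<close>, so the subgroup \<open>H\<close> needs no
  description of its own.

  The value of a syllable does not matter for membership. Minimality of \<open>V\<close> puts each
  \<open>v \<in> V\<close> into a relator \<open>c v d\<close>, so that \<open>v^-1 = d c\<close> in
  \<open>G\<close> lies in the prefix monoid; hence all of \<open>H\<close> does, and the automaton
  only has to be at its root when it reads a factor. Thus no membership problem for \<open>H\<close>
  arises, and the word problem of \<open>G\<close> suffices for the search. The automaton is finite
  but need not be computed from the presentation: decidability only asks that a suitable table
  exists.

  For the E-unitary quotient, the subgraph of a word is infinite in general, as loops are attached
  at all points of \<open>q P\<close>. The comparison becomes finite because it is enough that the
  path of each word lies in the subgraph of the other.\<close>

definition recf :: "nat \<Rightarrow> (nat list \<Rightarrow> nat) \<Rightarrow> bool" where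
  "recf n f \<longleftrightarrow> (\<exists>f'. recursive_fun n f' \<and> (\<forall>xs. length xs = n \<longrightarrow> f' xs = f xs))"

text \<open>\<open>recursive_fun\<close> also depends on the irrelevant values at lists of other
  lengths; \<open>recf\<close> forgets these, so that functions may be rewritten freely on lists of
  length \<open>n\<close>.\<close>

lemma recf_cong:
  assumes "recf n f" "\<And>xs. length xs = n \<Longrightarrow> f xs = g xs"
  shows "recf n g"
  using assms unfolding recf_def by metis

lemma recf_comp:
  assumes f: "recf (length gs) f" and g: "\<And>g. g \<in> set gs \<Longrightarrow> recf n g"
  shows "recf n (\<lambda>xs. f (map (\<lambda>g. g xs) gs))"
proof -
  obtain f' where f': "recursive_fun (length gs) f'" "\<And>xs. length xs = length gs \<Longrightarrow> f' xs = f xs"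
    using f unfolding recf_def by blast
  have "\<forall>g\<in>set gs. \<exists>g'. recursive_fun n g' \<and> (\<forall>xs. length xs = n \<longrightarrow> g' xs = g xs)"
    using g unfolding recf_def by blast
  then obtain h where h: "\<And>g. g \<in> set gs \<Longrightarrow> recursive_fun n (h g)"
    "\<And>g xs. g \<in> set gs \<Longrightarrow> length xs = n \<Longrightarrow> h g xs = g xs" by metis
  have "recursive_fun n (\<lambda>xs. f' (map (\<lambda>g. g xs) (map h gs)))"
    by (rule recursive_fun.comp) (use f' h in auto)
  moreover have "f' (map (\<lambda>g. g xs) (map h gs)) = f (map (\<lambda>g. g xs) gs)" if "length xs = n" for xs
  proof -
    have "map (\<lambda>g. g xs) (map h gs) = map (\<lambda>g. g xs) gs" using h that by simp
    then show ?thesis using f'(2)[of "map (\<lambda>g. g xs) gs"] by (simp only: length_map)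
  qed
  ultimately show ?thesis unfolding recf_def by blast
qed

lemma recf_comp1:
  assumes "recf 1 f" "recf n a"
  shows "recf n (\<lambda>xs. f [a xs])"
  using recf_comp[of "[a]" f n] assms by simp

lemma recf_zero: "recf n (\<lambda>_. 0)"
  unfolding recf_def using recursive_fun.zero by blast

lemma recf_proj: "i < n \<Longrightarrow> recf n (\<lambda>xs. xs ! i)"
  unfolding recf_def using recursive_fun.proj by blast

lemma recf_Suc:
  assumes "recf n a"
  shows "recf n (\<lambda>xs. Suc (a xs))"
proof -
  have "recf 1 (\<lambda>xs. Suc (xs ! 0))" unfolding recf_def using recursive_fun.succ by blast
  from recf_comp1[OF this assms] show ?thesis by simp
qed

text \<open>\<open>prim_rec\<close> recurses on the head of its argument list. Composing it with
  \<open>c\<close> and all projections gives a recursion whose depth is computed and whose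
  parameters are the whole list.\<close>

lemma recf_rec_nat:
  assumes f: "recf n f" and g: "recf (Suc (Suc n)) g" and c: "recf n c"
  shows "recf n (\<lambda>xs. rec_nat (f xs) (\<lambda>m y. g (m # y # xs)) (c xs))"
proof -
  obtain f' where f': "recursive_fun n f'" "\<And>xs. length xs = n \<Longrightarrow> f' xs = f xs"
    using f unfolding recf_def by blast
  obtain g' where g': "recursive_fun (Suc (Suc n)) g'"
    "\<And>xs. length xs = Suc (Suc n) \<Longrightarrow> g' xs = g xs"
    using g unfolding recf_def by blast
  let ?F = "\<lambda>xs. rec_nat (f (tl xs)) (\<lambda>m y. g (m # y # tl xs)) (hd xs)"
  have "rec_nat (f' (tl xs)) (\<lambda>m y. g' (m # y # tl xs)) k = rec_nat (f (tl xs)) (\<lambda>m y. g (m # y # tl xs)) k"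
    if "length xs = Suc n" for xs k
    using that f' g' by (induction k) auto
  then have F: "recf (Suc n) ?F"
    unfolding recf_def using recursive_fun.prim_rec[OF f'(1) g'(1)] by blast
  let ?gs = "c # map (\<lambda>i xs. xs ! i) [0..<n]"
  have "recf n (\<lambda>xs. ?F (map (\<lambda>g. g xs) ?gs))"
    by (rule recf_comp) (use F c recf_proj in auto)
  then show ?thesis
  proof (rule recf_cong)
    fix xs :: "nat list" assume "length xs = n"
    then have "map (\<lambda>g. g xs) (map (\<lambda>i xs. xs ! i) [0..<n]) = xs"
      by (auto intro: nth_equalityI)
    then show "?F (map (\<lambda>g. g xs) ?gs) = rec_nat (f xs) (\<lambda>m y. g (m # y # xs)) (c xs)"
      by simp
  qed
qed

lemma recf_Least:
  assumes f: "recf (Suc n) f" and ex: "\<And>xs. length xs = n \<Longrightarrow> \<exists>m. f (m # xs) = 0"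
  shows "recf n (\<lambda>xs. LEAST m. f (m # xs) = 0)"
proof -
  obtain f' where f': "recursive_fun (Suc n) f'" "\<And>xs. length xs = Suc n \<Longrightarrow> f' xs = f xs"
    using f unfolding recf_def by blast
  have "recursive_fun n (\<lambda>xs. LEAST m. f' (m # xs) = 0)"
    by (rule recursive_fun.mini) (use f' ex in auto)
  then show ?thesis unfolding recf_def using f'(2) by (intro exI conjI) auto
qed

lemma recf_add:
  assumes "recf n a" "recf n b"
  shows "recf n (\<lambda>xs. a xs + b xs)"
proof -
  have "recf n (\<lambda>xs. rec_nat (a xs) (\<lambda>m y. Suc ((m # y # xs) ! 1)) (b xs))"
    by (rule recf_rec_nat[where g = "\<lambda>ys. Suc (ys ! 1)"]) (intro assms recf_Suc recf_proj; simp)+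
  moreover have "rec_nat x (\<lambda>m y. Suc ((m # y # xs) ! 1)) k = x + k" for x k and xs :: "nat list"
    by (induction k) auto
  ultimately show ?thesis by simp
qed

lemma recf_diff:
  assumes "recf n a" "recf n b"
  shows "recf n (\<lambda>xs. a xs - b xs)"
proof -
  \<comment> \<open>Predecessor: the recursion returns its counter and ignores the value computed so
    far.\<close>
  have p: "recf n (\<lambda>xs. c xs - 1)" if "recf n c" for c n
  proof -
    have "recf n (\<lambda>xs. rec_nat 0 (\<lambda>m y. (m # y # xs) ! 0) (c xs))"
      by (rule recf_rec_nat[where g = "\<lambda>ys. ys ! 0"]) (intro that recf_zero recf_proj; simp)+
    moreover have "rec_nat 0 (\<lambda>m y. (m # y # xs) ! 0) k = k - 1" for k and xs :: "nat list"
      by (cases k) auto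
    ultimately show ?thesis by simp
  qed
  have "recf n (\<lambda>xs. rec_nat (a xs) (\<lambda>m y. (m # y # xs) ! 1 - 1) (b xs))"
    by (rule recf_rec_nat[where g = "\<lambda>ys. ys ! 1 - 1"]) (intro assms p recf_proj; simp)+
  moreover have "rec_nat x (\<lambda>m y. (m # y # xs) ! 1 - 1) k = x - k" for x k and xs :: "nat list"
    by (induction k) auto
  ultimately show ?thesis by simp
qed

lemma recf_triangle:
  assumes "recf n a"
  shows "recf n (\<lambda>xs. triangle (a xs))"
proof -
  have "recf n (\<lambda>xs. rec_nat 0 (\<lambda>m y. (m # y # xs) ! 1 + Suc ((m # y # xs) ! 0)) (a xs))"
    by (rule recf_rec_nat[where g = "\<lambda>ys. ys ! 1 + Suc (ys ! 0)"])
      (intro assms recf_add recf_Suc recf_zero recf_proj; simp)+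
  moreover have "rec_nat 0 (\<lambda>m y. (m # y # xs) ! 1 + Suc ((m # y # xs) ! 0)) k = triangle k"
    for k and xs :: "nat list"
    by (induction k) auto
  ultimately show ?thesis by simp
qed

section \<open>Inverting the Cantor pairing by search\<close>

definition pfst :: "nat \<Rightarrow> nat" where "pfst p = fst (prod_decode p)"
definition psnd :: "nat \<Rightarrow> nat" where "psnd p = snd (prod_decode p)"

lemma pfst_prod_encode [simp]: "pfst (prod_encode (a, b)) = a"
  and psnd_prod_encode [simp]: "psnd (prod_encode (a, b)) = b"
  by (simp_all add: pfst_def psnd_def)

lemma prod_encode_pfst_psnd [simp]: "prod_encode (pfst p, psnd p) = p"
  by (simp add: pfst_def psnd_def)

lemma recf_pair:
  assumes "recf n a" "recf n b"
  shows "recf n (\<lambda>xs. prod_encode (a xs, b xs))"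
  unfolding prod_encode_def using assms by (auto intro!: recf_add recf_triangle)

lemma triangle_mono: "m \<le> n \<Longrightarrow> triangle m \<le> triangle n"
  unfolding triangle_def by (intro div_le_mono mult_le_mono) auto

text \<open>The pairing is \<open>triangle (a + b) + a\<close>, which lies between
  \<open>triangle (a + b)\<close> and \<open>triangle (Suc (a + b))\<close>. So the sum of the
  components is found by searching for the first triangular number above the code.\<close>

lemma Least_triangle:
  "(LEAST s. Suc (prod_encode (a, b)) - triangle (Suc s) = 0) = a + b"
proof (rule Least_equality)
  show "Suc (prod_encode (a, b)) - triangle (Suc (a + b)) = 0"
    by (simp add: prod_encode_def)
  show "a + b \<le> s" if "Suc (prod_encode (a, b)) - triangle (Suc s) = 0" for s
    using that triangle_mono[of "Suc s" "a + b"] by (force simp: prod_encode_def simp del: triangle_Suc)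
qed

lemma recf_pfst_psnd: "recf 1 (\<lambda>xs. pfst (xs ! 0))" "recf 1 (\<lambda>xs. psnd (xs ! 0))"
proof -
  define s where "s xs = (LEAST s. Suc ((s # xs) ! 1) - triangle (Suc ((s # xs) ! 0)) = 0)"
    for xs :: "nat list"
  have s: "s xs = pfst (xs ! 0) + psnd (xs ! 0)" for xs
    using Least_triangle[of "pfst (xs ! 0)" "psnd (xs ! 0)"] by (simp add: s_def del: triangle_Suc)
  have "recf 1 (\<lambda>xs. s xs)"
    unfolding s_def
  proof (rule recf_Least[where f = "\<lambda>ys. Suc (ys ! 1) - triangle (Suc (ys ! 0))"])
    show "recf (Suc 1) (\<lambda>ys. Suc (ys ! 1) - triangle (Suc (ys ! 0)))"
      by (intro recf_diff recf_Suc recf_triangle recf_proj) auto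
    show "\<exists>m. Suc ((m # xs) ! 1) - triangle (Suc ((m # xs) ! 0)) = 0" for xs :: "nat list"
      by (rule exI[of _ "xs ! 0"]) (auto simp: triangle_Suc)
  qed
  then have s1: "recf 1 (\<lambda>xs. pfst (xs ! 0) + psnd (xs ! 0))" unfolding s .
  have "recf 1 (\<lambda>xs. xs ! 0 - triangle (pfst (xs ! 0) + psnd (xs ! 0)))"
    by (intro recf_diff recf_triangle s1 recf_proj) auto
  moreover have e: "p - triangle (pfst p + psnd p) = pfst p" for p
    using prod_encode_pfst_psnd[of p] unfolding prod_encode_def by (metis add_diff_cancel_left' case_prod_conv)
  ultimately show f: "recf 1 (\<lambda>xs. pfst (xs ! 0))" by simp
  have "recf 1 (\<lambda>xs. pfst (xs ! 0) + psnd (xs ! 0) - pfst (xs ! 0))"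
    by (intro recf_diff s1 f)
  then show "recf 1 (\<lambda>xs. psnd (xs ! 0))" by simp
qed

text \<open>Functions of several arguments are reduced to unary ones by pairing: in the closure rules
  below, the variables bound by a recursor or a quantifier are paired with the environment.\<close>

definition computable :: "(nat \<Rightarrow> nat) \<Rightarrow> bool" where
  "computable f \<longleftrightarrow> recf 1 (\<lambda>xs. f (xs ! 0))"

definition decidable_pred :: "(nat \<Rightarrow> bool) \<Rightarrow> bool" where
  "decidable_pred Q \<longleftrightarrow> computable (\<lambda>e. of_bool (Q e))"

lemma decidable_iff: "decidable A \<longleftrightarrow> decidable_pred (\<lambda>n. n \<in> A)"
proof -
  have "(\<forall>xs. length xs = 1 \<longrightarrow> f xs = of_bool (xs ! 0 \<in> A)) \<longleftrightarrow> (\<forall>n. f [n] = (if n \<in> A then 1 else 0))"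
    for f :: "nat list \<Rightarrow> nat"
    by (auto simp: length_Suc_conv)
  then show ?thesis
    unfolding decidable_def decidable_pred_def computable_def recf_def by simp
qed

lemma computable_recf:
  assumes "computable f" "recf n a"
  shows "recf n (\<lambda>xs. f (a xs))"
  using recf_comp1[OF assms(1)[unfolded computable_def] assms(2)] by simp

lemma computable_comp:
  assumes "computable f" "computable a"
  shows "computable (\<lambda>e. f (a e))"
  using assms computable_recf unfolding computable_def by blast

lemma computable_id: "computable (\<lambda>e. e)"
  unfolding computable_def by (rule recf_proj) simp

lemma computable_pfst: "computable a \<Longrightarrow> computable (\<lambda>e. pfst (a e))"
  and computable_psnd: "computable a \<Longrightarrow> computable (\<lambda>e. psnd (a e))"
  by (rule computable_comp; use recf_pfst_psnd in \<open>simp add: computable_def\<close>)+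

lemma computable_pair:
  "computable a \<Longrightarrow> computable b \<Longrightarrow> computable (\<lambda>e. prod_encode (a e, b e))"
  unfolding computable_def by (rule recf_pair)

lemma computable_Suc: "computable a \<Longrightarrow> computable (\<lambda>e. Suc (a e))"
  unfolding computable_def by (rule recf_Suc)

lemma computable_diff: "computable a \<Longrightarrow> computable b \<Longrightarrow> computable (\<lambda>e. a e - b e)"
  unfolding computable_def by (rule recf_diff)

lemma computable_const: "computable (\<lambda>e. k)"
proof (induction k)
  case 0
  then show ?case unfolding computable_def by (rule recf_zero)
next
  case (Suc k)
  then show ?case by (rule computable_Suc)
qed

lemma computable_rec_nat:
  assumes f: "computable f" and c: "computable c"
    and g: "computable (\<lambda>p. g (pfst p) (pfst (psnd p)) (psnd (psnd p)))"
  shows "computable (\<lambda>e. rec_nat (f e) (\<lambda>m y. g m y e) (c e))"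
proof -
  let ?g = "\<lambda>ys. (\<lambda>p. g (pfst p) (pfst (psnd p)) (psnd (psnd p)))
    (prod_encode (ys ! 0, prod_encode (ys ! 1, ys ! 2)))"
  have "recf (Suc (Suc 1)) ?g"
    by (rule computable_recf[OF g]) (intro recf_pair recf_proj; simp)
  from recf_rec_nat[OF f[unfolded computable_def] this c[unfolded computable_def]]
  show ?thesis unfolding computable_def by simp
qed

lemma computable_if:
  assumes "decidable_pred q" "computable a" "computable b"
  shows "computable (\<lambda>e. if q e then a e else b e)"
proof -
  \<comment> \<open>The recursor runs for no step or for one step, so it acts as a case
    distinction.\<close>
  have "computable (\<lambda>e. rec_nat (b e) (\<lambda>m y. a e) (of_bool (q e)))"
    by (rule computable_rec_nat)
      (intro assms(1)[unfolded decidable_pred_def] assms computable_comp[OF assms(2)] computable_psnd computable_id)+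
  moreover have "rec_nat x (\<lambda>m y. z) (of_bool b) = (if b then z else x)" for x z :: nat and b
    by simp
  ultimately show ?thesis by simp
qed

lemma decidable_pred_subst:
  "decidable_pred q \<Longrightarrow> computable a \<Longrightarrow> decidable_pred (\<lambda>e. q (a e))"
  unfolding decidable_pred_def by (rule computable_comp)

lemma decidable_pred_const: "decidable_pred (\<lambda>e. b)"
  unfolding decidable_pred_def by (rule computable_const)

lemma decidable_pred_not:
  assumes "decidable_pred q"
  shows "decidable_pred (\<lambda>e. \<not> q e)"
proof -
  have "computable (\<lambda>e. if q e then 0 else 1)"
    by (intro computable_if assms computable_const)
  also have "(\<lambda>e. if q e then 0 else 1) = (\<lambda>e. of_bool (\<not> q e))" by auto
  finally show ?thesis unfolding decidable_pred_def .
qed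

lemma decidable_pred_conj:
  assumes "decidable_pred p" "decidable_pred q"
  shows "decidable_pred (\<lambda>e. p e \<and> q e)"
proof -
  have "computable (\<lambda>e. if p e then of_bool (q e) else 0)"
    by (intro computable_if assms computable_const assms(2)[unfolded decidable_pred_def])
  also have "(\<lambda>e. if p e then of_bool (q e) else 0) = (\<lambda>e. of_bool (p e \<and> q e))" by auto
  finally show ?thesis unfolding decidable_pred_def .
qed

lemma decidable_pred_disj:
  assumes "decidable_pred p" "decidable_pred q"
  shows "decidable_pred (\<lambda>e. p e \<or> q e)"
  using decidable_pred_not[OF decidable_pred_conj[OF assms[THEN decidable_pred_not]]] by simp

lemma decidable_pred_imp:
  assumes "decidable_pred p" "decidable_pred q"
  shows "decidable_pred (\<lambda>e. p e \<longrightarrow> q e)"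
  using decidable_pred_disj[OF assms(1)[THEN decidable_pred_not] assms(2)] by (simp only: imp_conv_disj)

lemma decidable_pred_le:
  assumes "computable a" "computable b"
  shows "decidable_pred (\<lambda>e. a e \<le> b e)"
proof -
  have "computable (\<lambda>e. rec_nat 1 (\<lambda>m y. 0) (a e - b e))"
    by (intro computable_rec_nat assms computable_diff computable_const)
  also have "(\<lambda>e. rec_nat (1::nat) (\<lambda>m y. 0) (a e - b e)) = (\<lambda>e. of_bool (a e \<le> b e))"
  proof
    fix e
    have "rec_nat (1::nat) (\<lambda>m y. 0) k = of_bool (k = 0)" for k by (cases k) auto
    then show "rec_nat (1::nat) (\<lambda>m y. 0) (a e - b e) = of_bool (a e \<le> b e)"
      by (simp only: diff_is_0_eq)
  qed
  finally show ?thesis unfolding decidable_pred_def .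
qed

lemma decidable_pred_eq:
  assumes "computable a" "computable b"
  shows "decidable_pred (\<lambda>e. a e = b e)"
proof -
  have "a e = b e \<longleftrightarrow> a e \<le> b e \<and> b e \<le> a e" for e by auto
  then show ?thesis
    using decidable_pred_conj[OF decidable_pred_le[OF assms] decidable_pred_le[OF assms(2,1)]]
    by (simp only:)
qed

lemma decidable_pred_bex:
  assumes q: "decidable_pred (\<lambda>p. q (pfst p) (psnd p))" and b: "computable b"
  shows "decidable_pred (\<lambda>e. \<exists>m\<le>b e. q m e)"
proof -
  have q': "decidable_pred (\<lambda>e. q (a e) (c e))" if "computable a" "computable c" for a c
    using decidable_pred_subst[OF q computable_pair[OF that]] by simp
  have "computable (\<lambda>e. rec_nat (of_bool (q 0 e)) (\<lambda>m y. if q (Suc m) e then 1 else y) (b e))"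
    by (intro computable_rec_nat b computable_if q'[unfolded decidable_pred_def] q' computable_const
        computable_id computable_Suc computable_pfst computable_psnd)
  moreover have "rec_nat (of_bool (q 0 e)) (\<lambda>m y. if q (Suc m) e then 1 else y) k =
      (of_bool :: bool \<Rightarrow> nat) (\<exists>m\<le>k. q m e)" for e k
    by (induction k) (auto simp: le_Suc_eq)
  ultimately show ?thesis unfolding decidable_pred_def by (simp only:)
qed

lemma decidable_pred_ball:
  assumes "decidable_pred (\<lambda>p. q (pfst p) (psnd p))" "computable b"
  shows "decidable_pred (\<lambda>e. \<forall>m\<le>b e. q m e)"
proof -
  have "decidable_pred (\<lambda>e. \<not> (\<exists>m\<le>b e. \<not> q m e))"
    by (intro decidable_pred_not decidable_pred_bex assms)
  then show ?thesis by simp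
qed

lemma decidable_pred_bex_finite:
  assumes "finite F" "\<And>x. x \<in> F \<Longrightarrow> decidable_pred (q x)"
  shows "decidable_pred (\<lambda>e. \<exists>x\<in>F. q x e)"
  using assms
proof (induction F)
  case empty
  then show ?case by (simp add: decidable_pred_const)
next
  case (insert x F)
  then show ?case using decidable_pred_disj[of "q x" "\<lambda>e. \<exists>x\<in>F. q x e"] by simp
qed

lemma computable_Least:
  assumes q: "decidable_pred (\<lambda>p. q (pfst p) (psnd p))" and ex: "\<And>e. \<exists>m. q m e"
  shows "computable (\<lambda>e. LEAST m. q m e)"
proof -
  let ?f = "\<lambda>ys. 1 - (of_bool (q (ys ! 0) (ys ! 1)) :: nat)"
  have "recf (Suc 1) (\<lambda>ys. (\<lambda>p. 1 - of_bool (q (pfst p) (psnd p))) (prod_encode (ys ! 0, ys ! 1)))"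
    by (rule computable_recf)
      (use q in \<open>auto intro!: computable_diff computable_const recf_pair recf_proj simp: decidable_pred_def\<close>)
  then have "recf (Suc 1) ?f" by simp
  then have "recf 1 (\<lambda>xs. LEAST m. ?f (m # xs) = 0)"
    by (rule recf_Least) (use ex in auto)
  moreover have "?f (m # xs) = 0 \<longleftrightarrow> q m (xs ! 0)" for m xs by simp
  ultimately show ?thesis unfolding computable_def by (simp only:)
qed

text \<open>\<open>f\<close> is arbitrary: a function with finite support is a nested case
  distinction with constant values. Hence the transition table of an automaton can be used without
  an algorithm that produces it.\<close>

lemma computable_table:
  assumes "finite D" "computable a"
  shows "computable (\<lambda>e. if a e \<in> D then f (a e) else 0)"
  using assms(1)
proof (induction D)
  case empty
  then show ?case by (simp add: computable_const)
next
  case (insert x D)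
  have "computable (\<lambda>e. if a e = x then f x else if a e \<in> D then f (a e) else 0)"
    by (intro computable_if decidable_pred_eq assms computable_const insert.IH)
  also have "(\<lambda>e. if a e = x then f x else if a e \<in> D then f (a e) else 0) =
      (\<lambda>e. if a e \<in> insert x D then f (a e) else 0)" by auto
  finally show ?case .
qed

lemma decidable_pred_mem_finite:
  assumes "finite D" "computable a"
  shows "decidable_pred (\<lambda>e. a e \<in> D)"
proof -
  have "decidable_pred (\<lambda>e. \<exists>x\<in>D. a e = x)"
    by (intro decidable_pred_bex_finite assms decidable_pred_eq computable_const)
  then show ?thesis by simp
qed

section \<open>Finite lists coded by numbers\<close>

lemma length_list_decode_le: "length (list_decode n) \<le> n"
proof (induction n rule: list_decode.induct)
  case (2 n)
  obtain a b where ab: "prod_decode n = (a, b)" by force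
  have "n = prod_encode (a, b)" using ab by (metis prod_decode_inverse)
  then have "b \<le> n" using le_prod_encode_2 by blast
  moreover have "length (list_decode b) \<le> b" using 2[of a b] ab by simp
  ultimately show ?case by (simp add: ab)
qed simp

text \<open>The fold is iterated on pairs of the code of the unread list and the accumulator. The
  pair is stationary once the list is exhausted, so any number of steps that is at least the length
  will do, and the code itself is such a number.\<close>

lemma computable_foldl:
  assumes g: "computable (\<lambda>p. g (pfst p) (pfst (psnd p)) (psnd (psnd p)))"
    and a: "computable a" and b: "computable b"
  shows "computable (\<lambda>e. foldl (\<lambda>y x. g y x e) (a e) (list_decode (b e)))"
proof -
  let ?step = "\<lambda>s e. if pfst s = 0 then s
    else prod_encode (psnd (pfst s - 1), g (psnd s) (pfst (pfst s - 1)) e)"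
  have g': "computable (\<lambda>e. g (s e) (t e) (r e))"
    if "computable s" "computable t" "computable r" for s t r
    using computable_comp[OF g computable_pair[OF that(1) computable_pair[OF that(2,3)]]] by simp
  have "computable (\<lambda>e. psnd (rec_nat (prod_encode (b e, a e)) (\<lambda>m s. ?step s e) (b e)))"
    by (intro computable_psnd computable_rec_nat computable_pair a b computable_if decidable_pred_eq
        computable_pfst g' computable_id computable_const computable_diff)
  moreover have "psnd (rec_nat (prod_encode (list_encode xs, y)) (\<lambda>m s. ?step s e) n)
      = foldl (\<lambda>y x. g y x e) y xs" if "length xs \<le> n" for n xs y e
  proof -
    \<comment> \<open>\<open>rec_nat\<close> applies the last step outermost. As the step ignores
      the counter, the first step can be split off instead, which matches the head of the
      list.\<close>
    have s: "rec_nat s0 (\<lambda>m s. ?step s e) (Suc n) = rec_nat (?step s0 e) (\<lambda>m s. ?step s e) n" for s0 n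
      by (induction n) simp_all
    show ?thesis using that
    proof (induction n arbitrary: xs y)
      case 0
      then show ?case by simp
    next
      case (Suc n)
      show ?case
      proof (cases xs)
        case Nil
        have "rec_nat (prod_encode (0, y)) (\<lambda>m s. ?step s e) k = prod_encode (0, y)" for k
          by (induction k) auto
        then show ?thesis using Nil by simp
      next
        case (Cons x xs')
        have "?step (prod_encode (list_encode (x # xs'), y)) e = prod_encode (list_encode xs', g y x e)"
          by simp
        then show ?thesis unfolding s Cons using Suc.IH[of xs' "g y x e"] Suc.prems Cons
          by (simp only: foldl_Cons length_Cons Suc_le_mono)
      qed
    qed
  qed
  from this[of "list_decode (b e)" "b e" "a e" e for e]
  have "(\<lambda>e. psnd (rec_nat (prod_encode (b e, a e)) (\<lambda>m s. ?step s e) (b e))) =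
      (\<lambda>e. foldl (\<lambda>y x. g y x e) (a e) (list_decode (b e)))"
    using length_list_decode_le by simp
  ultimately show ?thesis by simp
qed

lemma computable_Cons:
  assumes "computable a" "computable b"
  shows "computable (\<lambda>e. list_encode (a e # list_decode (b e)))"
  using computable_Suc[OF computable_pair[OF assms]] by simp

lemma computable_rev_append:
  assumes "computable a" "computable b"
  shows "computable (\<lambda>e. list_encode (rev (list_decode (a e)) @ list_decode (b e)))"
proof -
  have "computable (\<lambda>e. foldl (\<lambda>y x. list_encode (x # list_decode y)) (b e) (list_decode (a e)))"
    by (intro computable_foldl assms computable_Cons computable_pfst computable_psnd computable_id)
  moreover have "foldl (\<lambda>y x. list_encode (x # list_decode y)) n xs = list_encode (rev xs @ list_decode n)"
    for n xs
    by (induction xs arbitrary: n) auto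
  ultimately show ?thesis by simp
qed

definition app_code :: "nat \<Rightarrow> nat \<Rightarrow> nat" where
  "app_code m n = list_encode (list_decode m @ list_decode n)"

lemma computable_app_code:
  assumes "computable a" "computable b"
  shows "computable (\<lambda>e. app_code (a e) (b e))"
proof -
  have "computable (\<lambda>e. list_encode (rev (list_decode (list_encode
      (rev (list_decode (a e)) @ list_decode 0))) @ list_decode (b e)))"
    by (intro computable_rev_append assms computable_const)
  then show ?thesis by (simp add: app_code_def)
qed

definition concat_code :: "nat \<Rightarrow> nat" where
  "concat_code m = list_encode (concat (map list_decode (list_decode m)))"

lemma computable_concat_code:
  assumes "computable a"
  shows "computable (\<lambda>e. concat_code (a e))"
proof -
  have "computable (\<lambda>e. foldl (\<lambda>y x. app_code y x) 0 (list_decode (a e)))"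
    by (intro computable_foldl assms computable_app_code computable_const
        computable_pfst computable_psnd computable_id)
  moreover have "foldl (\<lambda>y x. app_code y x) n xs = list_encode (list_decode n @ concat (map list_decode xs))"
    for n xs
    by (induction xs arbitrary: n) (auto simp: app_code_def)
  ultimately show ?thesis by (simp add: concat_code_def)
qed

text \<open>The sign of a letter is the lowest bit of its code, so this is formal inversion of a
  letter.\<close>

definition flip_code :: "nat \<Rightarrow> nat" where
  "flip_code n = (if even n then Suc n else n - 1)"

lemma computable_flip_code:
  assumes "computable a"
  shows "computable (\<lambda>e. flip_code (a e))"
proof -
  have "computable (\<lambda>e. rec_nat 1 (\<lambda>m y. 1 - y) (a e))"
    by (intro computable_rec_nat assms computable_diff computable_const
        computable_pfst computable_psnd computable_id)
  moreover have "rec_nat 1 (\<lambda>m y. 1 - y) n = (of_bool (even n) :: nat)" for n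
    by (induction n) auto
  ultimately have "decidable_pred (\<lambda>e. even (a e))" unfolding decidable_pred_def by simp
  then show ?thesis unfolding flip_code_def
    by (intro computable_if computable_Suc computable_diff computable_const assms)
qed

definition inv_code :: "nat \<Rightarrow> nat" where
  "inv_code n = list_encode (rev (map flip_code (list_decode n)))"

lemma computable_inv_code:
  assumes "computable a"
  shows "computable (\<lambda>e. inv_code (a e))"
proof -
  have "computable (\<lambda>e. foldl (\<lambda>y x. list_encode (flip_code x # list_decode y)) 0 (list_decode (a e)))"
    by (intro computable_foldl assms computable_Cons computable_const computable_flip_code
        computable_pfst computable_psnd computable_id)
  moreover have "foldl (\<lambda>y x. list_encode (flip_code x # list_decode y)) n xs =
      list_encode (rev (map flip_code xs) @ list_decode n)" for n xs
    by (induction xs arbitrary: n) auto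
  ultimately show ?thesis by (simp add: inv_code_def)
qed

lemma decidable_pred_list_all:
  assumes q: "decidable_pred q" and a: "computable a"
  shows "decidable_pred (\<lambda>e. \<forall>x\<in>set (list_decode (a e)). q x)"
proof -
  have "computable (\<lambda>e. foldl (\<lambda>y x. if q x then y else 0) 1 (list_decode (a e)))"
    by (intro computable_foldl a computable_const computable_if computable_pfst computable_psnd
        computable_id decidable_pred_subst[OF q])
  moreover have "foldl (\<lambda>y x. if q x then y else 0) n xs = (if \<forall>x\<in>set xs. q x then n else 0)"
    for xs and n :: nat
    by (induction xs arbitrary: n) auto
  ultimately show ?thesis unfolding decidable_pred_def of_bool_def by (simp only:)
qed

text \<open>The code of a nonempty list is the successor of a pair, whence the \<open>n - 1\<close>;
  the value at \<open>0\<close>, the code of the empty list, has no meaning.\<close>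

definition hd_code :: "nat \<Rightarrow> nat" where
  "hd_code n = pfst (n - 1)"

lemma hd_code_list_encode [simp]: "hd_code (list_encode (x # xs)) = x"
  by (simp add: hd_code_def)

lemma computable_hd_code: "computable a \<Longrightarrow> computable (\<lambda>e. hd_code (a e))"
  unfolding hd_code_def by (intro computable_pfst computable_diff computable_const)

lemmas computable_intros =
  computable_id computable_const computable_pfst computable_psnd computable_pair computable_Suc
  computable_if computable_app_code computable_inv_code computable_concat_code
  computable_flip_code computable_hd_code decidable_pred_const decidable_pred_not
  decidable_pred_conj decidable_pred_disj decidable_pred_imp decidable_pred_le decidable_pred_eq
  decidable_pred_bex decidable_pred_ball

text \<open>States are numbered by any injection and the transitions stored in a finite table, so
  neither \<open>\<delta>\<close> nor \<open>F\<close> has to be effectively given. Injectivity of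
  \<open>c\<close> makes the run a function of the code.\<close>

lemma decidable_pred_automaton:
  fixes \<delta> :: "'s \<Rightarrow> 'b \<Rightarrow> 's" and c :: "'b \<Rightarrow> nat"
  assumes S: "finite S" "s0 \<in> S" "\<And>s b. s \<in> S \<Longrightarrow> b \<in> B \<Longrightarrow> \<delta> s b \<in> S"
    and B: "finite B" "inj_on c B"
  shows "decidable_pred (\<lambda>n. \<exists>bs. set bs \<subseteq> B \<and> list_decode n = map c bs \<and> foldl \<delta> s0 bs \<in> F)"
proof -
  obtain h :: "'s \<Rightarrow> nat" where h: "inj_on h S" using finite_imp_inj_to_nat_seg[OF S(1)] by blast
  define D where "D = prod_encode ` (h ` S \<times> c ` B)"
  define d where "d p = h (\<delta> (inv_into S h (pfst p)) (inv_into B c (psnd p)))" for p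
  have D: "finite D" unfolding D_def using S B by simp
  have step: "(if prod_encode (h s, c b) \<in> D then d (prod_encode (h s, c b)) else 0) = h (\<delta> s b)"
    if "s \<in> S" "b \<in> B" for s b
    using that h B by (auto simp: D_def d_def)
  have run: "foldl (\<lambda>y x. if prod_encode (y, x) \<in> D then d (prod_encode (y, x)) else 0) (h s) (map c bs)
      = h (foldl \<delta> s bs) \<and> foldl \<delta> s bs \<in> S" if "set bs \<subseteq> B" "s \<in> S" for bs s
    using that by (induction bs arbitrary: s) (auto simp: step S(3))
  let ?r = "\<lambda>n. foldl (\<lambda>y x. if prod_encode (y, x) \<in> D then d (prod_encode (y, x)) else 0) (h s0) (list_decode n)"
  \<comment> \<open>The table returns the default \<open>0\<close> outside \<open>D\<close>, and
    \<open>0\<close> may also number a state. The first conjunct excludes lists with foreign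
    letters, so this does no harm.\<close>
  have "decidable_pred (\<lambda>n. (\<forall>x\<in>set (list_decode n). x \<in> c ` B) \<and> ?r n \<in> h ` (F \<inter> S))"
    using S B by (intro decidable_pred_conj decidable_pred_list_all decidable_pred_mem_finite
        computable_foldl computable_table D computable_intros) auto
  moreover have "((\<forall>x\<in>set (list_decode n). x \<in> c ` B) \<and> ?r n \<in> h ` (F \<inter> S)) =
      (\<exists>bs. set bs \<subseteq> B \<and> list_decode n = map c bs \<and> foldl \<delta> s0 bs \<in> F)" for n
  proof (cases "\<exists>bs. set bs \<subseteq> B \<and> list_decode n = map c bs")
    case True
    then obtain bs where bs: "set bs \<subseteq> B" "list_decode n = map c bs" by blast
    have u: "bs' = bs" if "set bs' \<subseteq> B" "map c bs' = map c bs" for bs'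
      using that bs(1) inj_on_map_eq_map[of c bs' bs] inj_on_subset[OF B(2)] by (simp add: Un_subset_iff)
    have "?r n \<in> h ` (F \<inter> S) \<longleftrightarrow> foldl \<delta> s0 bs \<in> F"
      using run[OF bs(1) S(2)] h by (auto simp: bs(2) inj_on_def)
    moreover have "(\<exists>bs. set bs \<subseteq> B \<and> list_decode n = map c bs \<and> foldl \<delta> s0 bs \<in> F) \<longleftrightarrow> foldl \<delta> s0 bs \<in> F"
      using bs u by metis
    moreover have "\<forall>x\<in>set (list_decode n). x \<in> c ` B" using bs by auto
    ultimately show ?thesis by blast
  next
    case False
    have "\<exists>bs. set bs \<subseteq> B \<and> xs = map c bs" if "set xs \<subseteq> c ` B" for xs
      using that
    proof (induction xs)
      case Nil
      then show ?case by simp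
    next
      case (Cons x xs)
      then obtain b bs where "b \<in> B" "x = c b" "set bs \<subseteq> B" "xs = map c bs" by auto
      then show ?case by (intro exI[of _ "b # bs"]) simp
    qed
    from this[of "list_decode n"] False have "\<not> set (list_decode n) \<subseteq> c ` B" by blast
    then show ?thesis using False by blast
  qed
  ultimately show ?thesis by simp
qed

section \<open>Congruences on quotients\<close>

text \<open>\<open>pull\<close> and \<open>push\<close> are the correspondence between congruences
  on \<open>M\<close> modulo \<open>\<rho>\<close> and congruences on \<open>M\<close> above
  \<open>\<rho>\<close>. Since \<open>Inv\<close> is a quotient of the word monoid and
  \<open>EU_cong\<close> intersects congruences on it, the correspondence brings everything back to
  congruences on words.\<close>

definition pull :: "('a, 'b) monoid_scheme \<Rightarrow> ('a \<times> 'a) set \<Rightarrow> ('a set \<times> 'a set) set \<Rightarrow> ('a \<times> 'a) set" where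
  "pull M \<rho> \<kappa> = {(a, b). a \<in> carrier M \<and> b \<in> carrier M \<and> (\<rho> `` {a}, \<rho> `` {b}) \<in> \<kappa>}"

definition push :: "('a \<times> 'a) set \<Rightarrow> ('a \<times> 'a) set \<Rightarrow> ('a set \<times> 'a set) set" where
  "push \<rho> \<theta> = {(\<rho> `` {a}, \<rho> `` {b}) | a b. (a, b) \<in> \<theta>}"

lemma mon_congI:
  assumes "\<And>a b. (a, b) \<in> \<rho> \<Longrightarrow> a \<in> carrier M \<and> b \<in> carrier M"
    and "\<And>a. a \<in> carrier M \<Longrightarrow> (a, a) \<in> \<rho>"
    and "\<And>a b. (a, b) \<in> \<rho> \<Longrightarrow> (b, a) \<in> \<rho>"
    and "\<And>a b c. (a, b) \<in> \<rho> \<Longrightarrow> (b, c) \<in> \<rho> \<Longrightarrow> (a, c) \<in> \<rho>"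
    and "\<And>a b c d. (a, b) \<in> \<rho> \<Longrightarrow> (c, d) \<in> \<rho> \<Longrightarrow> (a \<otimes>\<^bsub>M\<^esub> c, b \<otimes>\<^bsub>M\<^esub> d) \<in> \<rho>"
  shows "mon_cong M \<rho>"
proof -
  have "equiv (carrier M) \<rho>"
  proof (rule equivI)
    show "\<rho> \<subseteq> carrier M \<times> carrier M" using assms(1) by auto
    show "refl_on (carrier M) \<rho>" using assms(2) by (auto simp: refl_on_def)
    show "sym \<rho>" using assms(3) by (auto simp: sym_def)
    show "trans \<rho>" using assms(4) unfolding trans_def by blast
  qed
  with assms(5) show ?thesis unfolding mon_cong_def by blast
qed

lemma mon_congD:
  assumes "mon_cong M \<rho>"
  shows "(a, b) \<in> \<rho> \<Longrightarrow> a \<in> carrier M \<and> b \<in> carrier M"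
    and "a \<in> carrier M \<Longrightarrow> (a, a) \<in> \<rho>"
    and "(a, b) \<in> \<rho> \<Longrightarrow> (b, a) \<in> \<rho>"
    and "(a, b) \<in> \<rho> \<Longrightarrow> (b, c) \<in> \<rho> \<Longrightarrow> (a, c) \<in> \<rho>"
    and "(a, b) \<in> \<rho> \<Longrightarrow> (c, d) \<in> \<rho> \<Longrightarrow> (a \<otimes>\<^bsub>M\<^esub> c, b \<otimes>\<^bsub>M\<^esub> d) \<in> \<rho>"
proof -
  have e: "equiv (carrier M) \<rho>" using assms by (simp add: mon_cong_def)
  show "(a, b) \<in> \<rho> \<Longrightarrow> a \<in> carrier M \<and> b \<in> carrier M" using e unfolding equiv_def by blast
  show "a \<in> carrier M \<Longrightarrow> (a, a) \<in> \<rho>" using e unfolding equiv_def refl_on_def by blast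
  show "(a, b) \<in> \<rho> \<Longrightarrow> (b, a) \<in> \<rho>" using e unfolding equiv_def sym_def by blast
  show "(a, b) \<in> \<rho> \<Longrightarrow> (b, c) \<in> \<rho> \<Longrightarrow> (a, c) \<in> \<rho>" using e unfolding equiv_def trans_def by blast
  show "(a, b) \<in> \<rho> \<Longrightarrow> (c, d) \<in> \<rho> \<Longrightarrow> (a \<otimes>\<^bsub>M\<^esub> c, b \<otimes>\<^bsub>M\<^esub> d) \<in> \<rho>"
    using assms unfolding mon_cong_def by blast
qed

lemma quot_simps:
  "carrier (quot_mon M \<rho>) = (\<lambda>a. \<rho> `` {a}) ` carrier M" "\<one>\<^bsub>quot_mon M \<rho>\<^esub> = \<rho> `` {\<one>\<^bsub>M\<^esub>}"
  by (auto simp: quot_mon_def quotient_def)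

lemma class_eq_iff:
  assumes "mon_cong M \<rho>" "a \<in> carrier M" "b \<in> carrier M"
  shows "\<rho> `` {a} = \<rho> `` {b} \<longleftrightarrow> (a, b) \<in> \<rho>"
  using eq_equiv_class_iff[of "carrier M" \<rho> a b] assms by (simp add: mon_cong_def)

lemma mon_cong_pull:
  assumes M: "monoid M" and \<rho>: "mon_cong M \<rho>" and \<kappa>: "mon_cong (quot_mon M \<rho>) \<kappa>"
  shows "mon_cong M (pull M \<rho> \<kappa>)"
proof (rule mon_congI)
  note k = mon_congD[OF \<kappa>, unfolded quot_simps]
  show "(a, a) \<in> pull M \<rho> \<kappa>" if "a \<in> carrier M" for a
    using that k(2) by (auto simp: pull_def)
  show "(b, a) \<in> pull M \<rho> \<kappa>" if "(a, b) \<in> pull M \<rho> \<kappa>" for a b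
    using that k(3) by (auto simp: pull_def)
  show "(a, c) \<in> pull M \<rho> \<kappa>" if "(a, b) \<in> pull M \<rho> \<kappa>" "(b, c) \<in> pull M \<rho> \<kappa>" for a b c
    using that k(4) unfolding pull_def by blast
  show "(a \<otimes>\<^bsub>M\<^esub> c, b \<otimes>\<^bsub>M\<^esub> d) \<in> pull M \<rho> \<kappa>"
    if "(a, b) \<in> pull M \<rho> \<kappa>" "(c, d) \<in> pull M \<rho> \<kappa>" for a b c d
    using that k(5)[of "\<rho> `` {a}" "\<rho> `` {b}" "\<rho> `` {c}" "\<rho> `` {d}"] monoid.m_closed[OF M]
    by (auto simp: pull_def quot_mult[OF \<rho> M])
qed (auto simp: pull_def)

lemma subset_pull:
  assumes \<rho>: "mon_cong M \<rho>" and \<kappa>: "mon_cong (quot_mon M \<rho>) \<kappa>"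
  shows "\<rho> \<subseteq> pull M \<rho> \<kappa>"
proof (rule subrelI)
  fix a b assume ab: "(a, b) \<in> \<rho>"
  then have c: "a \<in> carrier M" "b \<in> carrier M" using mon_congD(1)[OF \<rho>] by auto
  moreover have "\<rho> `` {a} = \<rho> `` {b}" using class_eq_iff[OF \<rho> c] ab by simp
  ultimately show "(a, b) \<in> pull M \<rho> \<kappa>"
    using mon_congD(2)[OF \<kappa>] by (auto simp: pull_def quot_simps)
qed

lemma pull_push:
  assumes \<rho>: "mon_cong M \<rho>" and \<theta>: "mon_cong M \<theta>" and sub: "\<rho> \<subseteq> \<theta>"
  shows "pull M \<rho> (push \<rho> \<theta>) = \<theta>"
proof (intro equalityI subsetI)
  fix p assume "p \<in> pull M \<rho> (push \<rho> \<theta>)"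
  then obtain a b c d where p: "p = (a, b)" "a \<in> carrier M" "b \<in> carrier M" "(c, d) \<in> \<theta>"
    "\<rho> `` {a} = \<rho> `` {c}" "\<rho> `` {b} = \<rho> `` {d}"
    by (auto simp: pull_def push_def)
  note t = mon_congD[OF \<theta>]
  have "(a, c) \<in> \<theta>" "(b, d) \<in> \<theta>"
    using class_eq_iff[OF \<rho>] p t(1)[OF p(4)] sub by auto
  from t(4)[OF t(4)[OF this(1) p(4)] t(3)[OF this(2)]] show "p \<in> \<theta>" using p(1) by simp
next
  fix p assume "p \<in> \<theta>"
  then show "p \<in> pull M \<rho> (push \<rho> \<theta>)"
    using mon_congD(1)[OF \<theta>] by (cases p) (auto simp: pull_def push_def)
qed

lemma push_iff:
  assumes "mon_cong M \<rho>" "mon_cong M \<theta>" "\<rho> \<subseteq> \<theta>" "a \<in> carrier M" "b \<in> carrier M"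
  shows "(\<rho> `` {a}, \<rho> `` {b}) \<in> push \<rho> \<theta> \<longleftrightarrow> (a, b) \<in> \<theta>"
  using pull_push[OF assms(1-3)] assms(4,5) by (auto simp: pull_def)

lemma mon_cong_push:
  assumes M: "monoid M" and \<rho>: "mon_cong M \<rho>" and \<theta>: "mon_cong M \<theta>" and sub: "\<rho> \<subseteq> \<theta>"
  shows "mon_cong (quot_mon M \<rho>) (push \<rho> \<theta>)"
proof (rule mon_congI, unfold quot_simps)
  note t = mon_congD[OF \<theta>]
  have ex: "\<exists>a b. A = \<rho> `` {a} \<and> B = \<rho> `` {b} \<and> a \<in> carrier M \<and> b \<in> carrier M \<and> (a, b) \<in> \<theta>"
    if "(A, B) \<in> push \<rho> \<theta>" for A B
    using that t(1) by (auto simp: push_def)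
  note p = push_iff[OF \<rho> \<theta> sub]
  show "A \<in> (\<lambda>a. \<rho> `` {a}) ` carrier M \<and> B \<in> (\<lambda>a. \<rho> `` {a}) ` carrier M"
    if "(A, B) \<in> push \<rho> \<theta>" for A B
    using ex[OF that] by auto
  show "(A, A) \<in> push \<rho> \<theta>" if "A \<in> (\<lambda>a. \<rho> `` {a}) ` carrier M" for A
    using that t(2) p by auto
  show "(B, A) \<in> push \<rho> \<theta>" if "(A, B) \<in> push \<rho> \<theta>" for A B
    using ex[OF that] t(3) p by auto
  show "(A, C) \<in> push \<rho> \<theta>" if AB: "(A, B) \<in> push \<rho> \<theta>" and BC: "(B, C) \<in> push \<rho> \<theta>" for A B C
  proof -
    obtain a b where ab: "A = \<rho> `` {a}" "B = \<rho> `` {b}" "a \<in> carrier M" "b \<in> carrier M" "(a, b) \<in> \<theta>"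
      using ex[OF AB] by blast
    obtain b' c where bc: "B = \<rho> `` {b'}" "C = \<rho> `` {c}" "b' \<in> carrier M" "c \<in> carrier M" "(b', c) \<in> \<theta>"
      using ex[OF BC] by blast
    have "(b, b') \<in> \<theta>" using ab bc class_eq_iff[OF \<rho>, of b b'] sub by auto
    then have "(a, c) \<in> \<theta>" using ab bc t(4) by blast
    then show ?thesis using ab bc p by auto
  qed
  show "(A \<otimes>\<^bsub>quot_mon M \<rho>\<^esub> C, B \<otimes>\<^bsub>quot_mon M \<rho>\<^esub> D) \<in> push \<rho> \<theta>"
    if "(A, B) \<in> push \<rho> \<theta>" "(C, D) \<in> push \<rho> \<theta>" for A B C D
    using ex[OF that(1)] ex[OF that(2)] t(5) p monoid.m_closed[OF M]
    by (auto simp: quot_mult[OF \<rho> M])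
qed

lemma group_quot_pull:
  assumes M: "monoid M" and \<rho>: "mon_cong M \<rho>" and \<kappa>: "mon_cong (quot_mon M \<rho>) \<kappa>"
  shows "group (quot_mon (quot_mon M \<rho>) \<kappa>) \<longleftrightarrow> group (quot_mon M (pull M \<rho> \<kappa>))"
  unfolding quot_group_iff[OF \<kappa> quot_monoid[OF \<rho> M]] quot_group_iff[OF mon_cong_pull[OF assms] M]
  using monoid.m_closed[OF M] monoid.one_closed[OF M]
  by (auto simp: quot_simps quot_mult[OF \<rho> M] pull_def)

lemma max_group_cong_quot_iff:
  assumes M: "monoid M" and \<rho>: "mon_cong M \<rho>" and a: "a \<in> carrier M"
  shows "(\<rho> `` {a}, \<one>\<^bsub>quot_mon M \<rho>\<^esub>) \<in> max_group_cong (quot_mon M \<rho>) \<longleftrightarrow>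
    (\<forall>\<theta>. mon_cong M \<theta> \<and> \<rho> \<subseteq> \<theta> \<and> group (quot_mon M \<theta>) \<longrightarrow> (a, \<one>\<^bsub>M\<^esub>) \<in> \<theta>)"
proof (intro iffI allI impI)
  fix \<theta> assume m: "(\<rho> `` {a}, \<one>\<^bsub>quot_mon M \<rho>\<^esub>) \<in> max_group_cong (quot_mon M \<rho>)"
    and "mon_cong M \<theta> \<and> \<rho> \<subseteq> \<theta> \<and> group (quot_mon M \<theta>)"
  then have \<theta>: "mon_cong M \<theta>" "\<rho> \<subseteq> \<theta>" "group (quot_mon M \<theta>)" by auto
  have c: "mon_cong (quot_mon M \<rho>) (push \<rho> \<theta>)" by (rule mon_cong_push[OF M \<rho> \<theta>(1,2)])
  have "group (quot_mon (quot_mon M \<rho>) (push \<rho> \<theta>))"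
    unfolding group_quot_pull[OF M \<rho> c] pull_push[OF \<rho> \<theta>(1,2)] by fact
  with m c have "(\<rho> `` {a}, \<rho> `` {\<one>\<^bsub>M\<^esub>}) \<in> push \<rho> \<theta>" unfolding max_group_cong_def quot_simps by blast
  then show "(a, \<one>\<^bsub>M\<^esub>) \<in> \<theta>" using push_iff[OF \<rho> \<theta>(1,2) a monoid.one_closed[OF M]] by simp
next
  assume h: "\<forall>\<theta>. mon_cong M \<theta> \<and> \<rho> \<subseteq> \<theta> \<and> group (quot_mon M \<theta>) \<longrightarrow> (a, \<one>\<^bsub>M\<^esub>) \<in> \<theta>"
  have "(\<rho> `` {a}, \<rho> `` {\<one>\<^bsub>M\<^esub>}) \<in> \<kappa>"
    if \<kappa>: "mon_cong (quot_mon M \<rho>) \<kappa>" and g: "group (quot_mon (quot_mon M \<rho>) \<kappa>)" for \<kappa>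
  proof -
    have "(a, \<one>\<^bsub>M\<^esub>) \<in> pull M \<rho> \<kappa>"
      using h mon_cong_pull[OF M \<rho> \<kappa>] subset_pull[OF \<rho> \<kappa>] g group_quot_pull[OF M \<rho> \<kappa>] by blast
    then show ?thesis by (simp add: pull_def)
  qed
  then show "(\<rho> `` {a}, \<one>\<^bsub>quot_mon M \<rho>\<^esub>) \<in> max_group_cong (quot_mon M \<rho>)"
    unfolding max_group_cong_def quot_simps by blast
qed

lemma E_unitary_quot_iff:
  assumes M: "monoid M" and \<rho>: "mon_cong M \<rho>"
  shows "E_unitary (quot_mon M \<rho>) \<longleftrightarrow> (\<forall>a\<in>carrier M.
    (\<forall>\<theta>. mon_cong M \<theta> \<and> \<rho> \<subseteq> \<theta> \<and> group (quot_mon M \<theta>) \<longrightarrow> (a, \<one>\<^bsub>M\<^esub>) \<in> \<theta>) \<longrightarrow> (a \<otimes>\<^bsub>M\<^esub> a, a) \<in> \<rho>)"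
proof -
  have "E_unitary (quot_mon M \<rho>) \<longleftrightarrow> (\<forall>a\<in>carrier M.
      (\<rho> `` {a}, \<one>\<^bsub>quot_mon M \<rho>\<^esub>) \<in> max_group_cong (quot_mon M \<rho>) \<longrightarrow> \<rho> `` {a \<otimes>\<^bsub>M\<^esub> a} = \<rho> `` {a})"
    unfolding E_unitary_def quot_simps(1) by (simp add: quot_mult[OF \<rho> M])
  then show ?thesis
    using max_group_cong_quot_iff[OF M \<rho>] class_eq_iff[OF \<rho>] monoid.m_closed[OF M] by simp
qed

text \<open>An instance of the third isomorphism theorem, proved without an isomorphism: both sides
  speak of the group congruences above a given one, and \<open>push\<close> and \<open>pull\<close>
  match these.\<close>

lemma E_unitary_quot_pull:
  assumes M: "monoid M" and \<rho>: "mon_cong M \<rho>" and \<kappa>: "mon_cong (quot_mon M \<rho>) \<kappa>"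
  shows "E_unitary (quot_mon (quot_mon M \<rho>) \<kappa>) \<longleftrightarrow> E_unitary (quot_mon M (pull M \<rho> \<kappa>))"
proof -
  let ?Q = "quot_mon M \<rho>"
  note pm = mon_cong_pull[OF M \<rho> \<kappa>]
  have *: "(\<forall>\<theta>'. mon_cong ?Q \<theta>' \<and> \<kappa> \<subseteq> \<theta>' \<and> group (quot_mon ?Q \<theta>') \<longrightarrow> (\<rho> `` {a}, \<rho> `` {\<one>\<^bsub>M\<^esub>}) \<in> \<theta>') \<longleftrightarrow>
      (\<forall>\<theta>. mon_cong M \<theta> \<and> pull M \<rho> \<kappa> \<subseteq> \<theta> \<and> group (quot_mon M \<theta>) \<longrightarrow> (a, \<one>\<^bsub>M\<^esub>) \<in> \<theta>)" (is "?l \<longleftrightarrow> ?r")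
    if a: "a \<in> carrier M" for a
  proof (intro iffI allI impI)
    fix \<theta> assume l: ?l and t: "mon_cong M \<theta> \<and> pull M \<rho> \<kappa> \<subseteq> \<theta> \<and> group (quot_mon M \<theta>)"
    then have \<theta>: "mon_cong M \<theta>" "\<rho> \<subseteq> \<theta>" using subset_pull[OF \<rho> \<kappa>] by auto
    have c: "mon_cong ?Q (push \<rho> \<theta>)" by (rule mon_cong_push[OF M \<rho> \<theta>])
    have "\<kappa> \<subseteq> push \<rho> \<theta>"
    proof (rule subrelI)
      fix A B assume AB: "(A, B) \<in> \<kappa>"
      then obtain b d where bd: "A = \<rho> `` {b}" "B = \<rho> `` {d}" "b \<in> carrier M" "d \<in> carrier M"
        using mon_congD(1)[OF \<kappa> AB] by (auto simp: quot_simps)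
      then have "(b, d) \<in> \<theta>" using AB t by (auto simp: pull_def)
      then show "(A, B) \<in> push \<rho> \<theta>" using bd by (auto simp: push_def)
    qed
    moreover have "group (quot_mon ?Q (push \<rho> \<theta>))"
      unfolding group_quot_pull[OF M \<rho> c] pull_push[OF \<rho> \<theta>] using t by simp
    ultimately have "(\<rho> `` {a}, \<rho> `` {\<one>\<^bsub>M\<^esub>}) \<in> push \<rho> \<theta>" using l c by blast
    then show "(a, \<one>\<^bsub>M\<^esub>) \<in> \<theta>" using push_iff[OF \<rho> \<theta> a monoid.one_closed[OF M]] by simp
  next
    fix \<theta>' assume r: ?r and t: "mon_cong ?Q \<theta>' \<and> \<kappa> \<subseteq> \<theta>' \<and> group (quot_mon ?Q \<theta>')"
    then have \<theta>': "mon_cong ?Q \<theta>'" by simp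
    have "pull M \<rho> \<kappa> \<subseteq> pull M \<rho> \<theta>'" using t by (auto simp: pull_def)
    then have "(a, \<one>\<^bsub>M\<^esub>) \<in> pull M \<rho> \<theta>'"
      using r mon_cong_pull[OF M \<rho> \<theta>'] group_quot_pull[OF M \<rho> \<theta>'] t by blast
    then show "(\<rho> `` {a}, \<rho> `` {\<one>\<^bsub>M\<^esub>}) \<in> \<theta>'" by (simp add: pull_def)
  qed
  have "E_unitary (quot_mon ?Q \<kappa>) \<longleftrightarrow> (\<forall>a\<in>carrier M.
      (\<forall>\<theta>'. mon_cong ?Q \<theta>' \<and> \<kappa> \<subseteq> \<theta>' \<and> group (quot_mon ?Q \<theta>') \<longrightarrow> (\<rho> `` {a}, \<rho> `` {\<one>\<^bsub>M\<^esub>}) \<in> \<theta>') \<longrightarrow>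
      (\<rho> `` {a \<otimes>\<^bsub>M\<^esub> a}, \<rho> `` {a}) \<in> \<kappa>)"
    unfolding E_unitary_quot_iff[OF quot_monoid[OF \<rho> M] \<kappa>] quot_simps by (simp add: quot_mult[OF \<rho> M])
  also have "\<dots> \<longleftrightarrow> E_unitary (quot_mon M (pull M \<rho> \<kappa>))"
    unfolding E_unitary_quot_iff[OF M pm] using * monoid.m_closed[OF M] by (simp add: pull_def)
  finally show ?thesis .
qed

lemma EU_cong_quot_iff:
  assumes M: "monoid M" and \<rho>: "mon_cong M \<rho>" and ab: "a \<in> carrier M" "b \<in> carrier M"
  shows "(\<rho> `` {a}, \<rho> `` {b}) \<in> EU_cong (quot_mon M \<rho>) \<longleftrightarrow>
    (\<forall>\<theta>. mon_cong M \<theta> \<and> \<rho> \<subseteq> \<theta> \<and> E_unitary (quot_mon M \<theta>) \<longrightarrow> (a, b) \<in> \<theta>)"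
proof (intro iffI allI impI)
  fix \<theta> assume m: "(\<rho> `` {a}, \<rho> `` {b}) \<in> EU_cong (quot_mon M \<rho>)"
    and t: "mon_cong M \<theta> \<and> \<rho> \<subseteq> \<theta> \<and> E_unitary (quot_mon M \<theta>)"
  then have \<theta>: "mon_cong M \<theta>" "\<rho> \<subseteq> \<theta>" by auto
  have c: "mon_cong (quot_mon M \<rho>) (push \<rho> \<theta>)" by (rule mon_cong_push[OF M \<rho> \<theta>])
  have "E_unitary (quot_mon (quot_mon M \<rho>) (push \<rho> \<theta>))"
    unfolding E_unitary_quot_pull[OF M \<rho> c] pull_push[OF \<rho> \<theta>] using t by simp
  with m c have "(\<rho> `` {a}, \<rho> `` {b}) \<in> push \<rho> \<theta>" unfolding EU_cong_def by blast
  then show "(a, b) \<in> \<theta>" using push_iff[OF \<rho> \<theta> ab] by simp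
next
  assume h: "\<forall>\<theta>. mon_cong M \<theta> \<and> \<rho> \<subseteq> \<theta> \<and> E_unitary (quot_mon M \<theta>) \<longrightarrow> (a, b) \<in> \<theta>"
  have "(\<rho> `` {a}, \<rho> `` {b}) \<in> \<kappa>"
    if \<kappa>: "mon_cong (quot_mon M \<rho>) \<kappa>" and g: "E_unitary (quot_mon (quot_mon M \<rho>) \<kappa>)" for \<kappa>
  proof -
    have "(a, b) \<in> pull M \<rho> \<kappa>"
      using h mon_cong_pull[OF M \<rho> \<kappa>] subset_pull[OF \<rho> \<kappa>] g E_unitary_quot_pull[OF M \<rho> \<kappa>] by blast
    then show ?thesis by (simp add: pull_def)
  qed
  then show "(\<rho> `` {a}, \<rho> `` {b}) \<in> EU_cong (quot_mon M \<rho>)" unfolding EU_cong_def by blast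
qed

lemma mon_cong_gen_cong:
  assumes "monoid M" "S \<subseteq> carrier M \<times> carrier M"
  shows "mon_cong M (gen_cong M S)"
  unfolding gen_cong_def
proof (rule mon_cong_Inter)
  interpret monoid M by fact
  have "mon_cong M (carrier M \<times> carrier M)" by (rule mon_congI) auto
  then show "{\<rho>. mon_cong M \<rho> \<and> S \<subseteq> \<rho>} \<noteq> {}" using assms by blast
qed auto

lemma subset_gen_cong: "S \<subseteq> gen_cong M S"
  unfolding gen_cong_def by blast

lemma gen_cong_least: "mon_cong M \<rho> \<Longrightarrow> S \<subseteq> \<rho> \<Longrightarrow> gen_cong M S \<subseteq> \<rho>"
  unfolding gen_cong_def by blast

section \<open>Words\<close>

lemma monoid_word_monoid: "monoid (word_monoid X)"
  by (rule monoidI) (auto simp: word_monoid_def words_def)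

lemma carrier_word_monoid [simp]: "carrier (word_monoid X) = words X"
  and mult_word_monoid [simp]: "a \<otimes>\<^bsub>word_monoid X\<^esub> b = a @ b"
  and one_word_monoid [simp]: "\<one>\<^bsub>word_monoid X\<^esub> = []"
  by (simp_all add: word_monoid_def)

lemma words_Nil [simp]: "[] \<in> words X"
  and words_append [simp]: "v @ w \<in> words X \<longleftrightarrow> v \<in> words X \<and> w \<in> words X"
  and words_Cons [simp]: "a # w \<in> words X \<longleftrightarrow> fst a \<in> X \<and> w \<in> words X"
  by (auto simp: words_def mem_Times_iff)

lemma inv_word_Nil [simp]: "inv_word [] = []"
  and inv_word_append [simp]: "inv_word (v @ w) = inv_word w @ inv_word v"
  and inv_word_Cons: "inv_word (a # w) = inv_word w @ [apsnd Not a]"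
  by (simp_all add: inv_word_def)

lemma inv_word_single [simp]: "inv_word [a] = [apsnd Not a]"
  by (simp add: inv_word_def)

lemma apsnd_Not_Not [simp]: "apsnd Not (apsnd Not a) = a"
  by (cases a) simp

lemma inv_word_inv_word [simp]: "inv_word (inv_word w) = w"
  by (induction w) (auto simp: inv_word_Cons)

lemma words_inv_word [simp]: "inv_word w \<in> words X \<longleftrightarrow> w \<in> words X"
  by (induction w) (auto simp: inv_word_Cons)

lemma words_concat: "concat ws \<in> words X \<longleftrightarrow> set ws \<subseteq> words X"
  by (induction ws) auto

lemma words_prefix: "prefix p w \<Longrightarrow> w \<in> words X \<Longrightarrow> p \<in> words X"
  by (auto simp: prefix_def)

lemma mem_words_iff: "w \<in> words X \<longleftrightarrow> fst ` set w \<subseteq> X"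
  by (induction w) auto

section \<open>Special presentations\<close>

locale special_presentation =
  fixes X :: "'a set" and rs :: "'a word set"
  assumes rs_words: "rs \<subseteq> words X"
begin

definition eqv :: "'a word \<Rightarrow> 'a word \<Rightarrow> bool" (infix "\<approx>" 50) where
  "v \<approx> w \<longleftrightarrow> (v, w) \<in> gp_cong X (special rs)"

lemma mon_cong_gp_cong: "mon_cong (word_monoid X) (gp_cong X (special rs))"
  unfolding gp_cong_def
  by (rule mon_cong_gen_cong[OF monoid_word_monoid]) (use rs_words in \<open>auto simp: special_def\<close>)

lemma mon_cong_inv_cong: "mon_cong (word_monoid X) (inv_cong X (special rs))"
  unfolding inv_cong_def
  by (rule mon_cong_gen_cong[OF monoid_word_monoid]) (use rs_words in \<open>auto simp: special_def\<close>)

lemma eqv_words: "v \<approx> w \<Longrightarrow> v \<in> words X" "v \<approx> w \<Longrightarrow> w \<in> words X"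
  using mon_congD(1)[OF mon_cong_gp_cong] by (auto simp: eqv_def)

lemma eqv_refl [simp]: "w \<in> words X \<Longrightarrow> w \<approx> w"
  using mon_congD(2)[OF mon_cong_gp_cong] by (auto simp: eqv_def)

lemma eqv_sym: "v \<approx> w \<Longrightarrow> w \<approx> v"
  using mon_congD(3)[OF mon_cong_gp_cong] by (auto simp: eqv_def)

lemma eqv_trans [trans]: "u \<approx> v \<Longrightarrow> v \<approx> w \<Longrightarrow> u \<approx> w"
  using mon_congD(4)[OF mon_cong_gp_cong] by (auto simp: eqv_def)

lemma eqv_cong_right: "v \<approx> w \<Longrightarrow> u \<approx> v \<longleftrightarrow> u \<approx> w"
  using eqv_trans[of u v w] eqv_trans[of u w v] eqv_sym[of v w] by blast

lemma eqv_append: "u \<approx> v \<Longrightarrow> u' \<approx> v' \<Longrightarrow> u @ u' \<approx> v @ v'"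
  using mon_congD(5)[OF mon_cong_gp_cong] by (auto simp: eqv_def)

lemma eqv_right_inv: "w \<in> words X \<Longrightarrow> w @ inv_word w \<approx> []"
  unfolding eqv_def gp_cong_def by (rule subsetD[OF subset_gen_cong]) blast

lemma eqv_left_inv: "w \<in> words X \<Longrightarrow> inv_word w @ w \<approx> []"
  using eqv_right_inv[of "inv_word w"] by simp

lemma eqv_relator: "r \<in> rs \<Longrightarrow> r \<approx> []"
  unfolding eqv_def gp_cong_def special_def by (rule subsetD[OF subset_gen_cong]) blast

lemma eqv_context: "s \<approx> t \<Longrightarrow> a \<in> words X \<Longrightarrow> b \<in> words X \<Longrightarrow> a @ s @ b \<approx> a @ t @ b"
  by (intro eqv_append eqv_refl)

lemma eqv_cancel:
  assumes "a \<in> words X" "w \<in> words X" "b \<in> words X"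
  shows "a @ w @ inv_word w @ b \<approx> a @ b" "a @ inv_word w @ w @ b \<approx> a @ b"
  using eqv_context[OF eqv_right_inv[OF assms(2)] assms(1,3)]
    eqv_context[OF eqv_left_inv[OF assms(2)] assms(1,3)] by simp_all

lemma eqv_cancel_left:
  assumes "w \<in> words X" "b \<in> words X"
  shows "w @ inv_word w @ b \<approx> b" "inv_word w @ w @ b \<approx> b"
  using eqv_cancel[of "[]" w b] assms by simp_all

lemma eqv_shift:
  assumes "v \<in> words X" "q \<in> words X" "g \<in> words X"
  shows "inv_word v @ g \<approx> q \<longleftrightarrow> g \<approx> v @ q"
proof
  assume "inv_word v @ g \<approx> q"
  then have "v @ inv_word v @ g \<approx> v @ q" using assms by (intro eqv_append eqv_refl)
  then show "g \<approx> v @ q" by (rule eqv_trans[OF eqv_sym[OF eqv_cancel_left(1)[OF assms(1,3)]]])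
next
  assume "g \<approx> v @ q"
  then have "inv_word v @ g \<approx> inv_word v @ v @ q" using assms by (intro eqv_append eqv_refl) auto
  then show "inv_word v @ g \<approx> q" by (rule eqv_trans[OF _ eqv_cancel_left(2)[OF assms(1,2)]])
qed

lemma eqv_inv_word:
  assumes "v \<approx> w"
  shows "inv_word v \<approx> inv_word w"
proof -
  note vw = eqv_words[OF assms]
  have "inv_word v \<approx> inv_word v @ w @ inv_word w"
    using eqv_cancel(1)[of "inv_word v" w "[]"] vw by (auto intro: eqv_sym)
  also have "\<dots> \<approx> inv_word v @ v @ inv_word w"
    using eqv_context[OF eqv_sym[OF assms], of "inv_word v" "inv_word w"] vw by simp
  also have "\<dots> \<approx> inv_word w"
    using eqv_cancel(2)[of "[]" v "inv_word w"] vw by simp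
  finally show ?thesis .
qed

lemma class_eq_iff_eqv: "v \<in> words X \<Longrightarrow> w \<in> words X \<Longrightarrow>
    gp_elem X (special rs) v = gp_elem X (special rs) w \<longleftrightarrow> v \<approx> w"
  unfolding gp_elem_def eqv_def by (rule class_eq_iff[OF mon_cong_gp_cong]) auto

text \<open>Every group quotient of the inverse monoid factors through \<open>G\<close>. With
  \<open>y\<close> a left inverse of \<open>w^-1\<close> in the quotient, \<open>w w^-1\<close> is
  congruent to \<open>y w^-1 w w^-1\<close>, hence to \<open>y w^-1\<close> and to 1.\<close>

lemma gp_cong_subset:
  assumes \<theta>: "mon_cong (word_monoid X) \<theta>" and sub: "inv_cong X (special rs) \<subseteq> \<theta>"
    and g: "group (quot_mon (word_monoid X) \<theta>)"
  shows "gp_cong X (special rs) \<subseteq> \<theta>"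
  unfolding gp_cong_def
proof (rule gen_cong_least[OF \<theta>], intro Un_least subsetI)
  fix p assume "p \<in> special rs"
  then have "p \<in> inv_cong X (special rs)" unfolding inv_cong_def by (intro subsetD[OF subset_gen_cong]) blast
  then show "p \<in> \<theta>" using sub by blast
next
  note t = mon_congD[OF \<theta>, simplified]
  fix p :: "'a word \<times> 'a word" assume "p \<in> {(w @ inv_word w, []) |w. w \<in> words X}"
  then obtain w where w: "p = (w @ inv_word w, [])" "w \<in> words X" by blast
  have "(inv_word w @ w @ inv_word w, inv_word w) \<in> inv_cong X (special rs)"
    unfolding inv_cong_def by (rule subsetD[OF subset_gen_cong]) (use w(2) in \<open>force intro: exI[of _ "inv_word w"]\<close>)
  then have 1: "(inv_word w @ w @ inv_word w, inv_word w) \<in> \<theta>" using sub by blast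
  obtain y where y: "y \<in> words X" "(y @ inv_word w, []) \<in> \<theta>"
    using g[unfolded quot_group_iff[OF \<theta> monoid_word_monoid], simplified] w(2) words_inv_word by blast
  have 2: "(w @ inv_word w, (y @ inv_word w) @ w @ inv_word w) \<in> \<theta>"
    using t(5)[OF t(3)[OF y(2)] t(2)[of "w @ inv_word w"]] w(2) by simp
  have 3: "((y @ inv_word w) @ w @ inv_word w, y @ inv_word w) \<in> \<theta>"
    using t(5)[OF t(2)[OF y(1)] 1] by simp
  show "p \<in> \<theta>" unfolding w(1) by (rule t(4)[OF t(4)[OF 2 3] y(2)])
qed

lemma group_Gp_quot: "group (quot_mon (word_monoid X) (gp_cong X (special rs)))"
  unfolding quot_group_iff[OF mon_cong_gp_cong monoid_word_monoid]
proof
  fix a assume "a \<in> carrier (word_monoid X)"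
  then show "\<exists>b\<in>carrier (word_monoid X).
      (b \<otimes>\<^bsub>word_monoid X\<^esub> a, \<one>\<^bsub>word_monoid X\<^esub>) \<in> gp_cong X (special rs)"
    using eqv_left_inv[of a] by (intro bexI[of _ "inv_word a"]) (auto simp: eqv_def)
qed

lemma inv_cong_subset:
  assumes \<theta>: "mon_cong (word_monoid X) \<theta>"
    and "\<And>r. r \<in> rs \<Longrightarrow> (r, []) \<in> \<theta>"
    and "\<And>w. w \<in> words X \<Longrightarrow> (w @ inv_word w @ w, w) \<in> \<theta>"
    and "\<And>v w. v \<in> words X \<Longrightarrow> w \<in> words X \<Longrightarrow>
      (v @ inv_word v @ w @ inv_word w, w @ inv_word w @ v @ inv_word v) \<in> \<theta>"
  shows "inv_cong X (special rs) \<subseteq> \<theta>"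
  unfolding inv_cong_def by (rule gen_cong_least[OF \<theta>]) (use assms in \<open>auto simp: special_def\<close>)

lemma EU_elem_eq_iff:
  assumes vw: "v \<in> words X" "w \<in> words X"
  shows "EU_elem X (special rs) v = EU_elem X (special rs) w \<longleftrightarrow>
    (\<forall>\<theta>. mon_cong (word_monoid X) \<theta> \<and> inv_cong X (special rs) \<subseteq> \<theta> \<and>
      E_unitary (quot_mon (word_monoid X) \<theta>) \<longrightarrow> (v, w) \<in> \<theta>)"
proof -
  have M: "monoid (Inv X (special rs))"
    unfolding Inv_def by (rule quot_monoid[OF mon_cong_inv_cong monoid_word_monoid])
  have c: "inv_elem X (special rs) v \<in> carrier (Inv X (special rs))" if "v \<in> words X" for v
    using that by (auto simp: Inv_def inv_elem_def quot_simps)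
  show ?thesis
    unfolding EU_elem_def class_eq_iff[OF mon_cong_EU_cong[OF M] c[OF vw(1)] c[OF vw(2)]]
    unfolding Inv_def inv_elem_def
    using EU_cong_quot_iff[OF monoid_word_monoid mon_cong_inv_cong] vw by simp
qed

lemma E_unitary_imp_EU_elem_eq_iff:
  assumes eu: "E_unitary (Inv X (special rs))" and vw: "v \<in> words X" "w \<in> words X"
  shows "EU_elem X (special rs) v = EU_elem X (special rs) w \<longleftrightarrow>
    inv_elem X (special rs) v = inv_elem X (special rs) w"
proof -
  have "inv_elem X (special rs) v = inv_elem X (special rs) w \<longleftrightarrow> (v, w) \<in> inv_cong X (special rs)"
    unfolding inv_elem_def by (rule class_eq_iff[OF mon_cong_inv_cong]) (use vw in auto)
  then show ?thesis
    unfolding EU_elem_eq_iff[OF vw] using eu[unfolded Inv_def] mon_cong_inv_cong by blast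
qed

text \<open>\<open>gp_cong\<close> is itself a group congruence above \<open>\<theta>\<close>, so an
  element that all of these identify with 1 is equal to 1 in \<open>G\<close>.\<close>

lemma E_unitary_quotI:
  assumes \<theta>: "mon_cong (word_monoid X) \<theta>" and sub: "\<theta> \<subseteq> gp_cong X (special rs)"
    and id: "\<And>e. e \<approx> [] \<Longrightarrow> (e @ e, e) \<in> \<theta>"
  shows "E_unitary (quot_mon (word_monoid X) \<theta>)"
  unfolding E_unitary_quot_iff[OF monoid_word_monoid \<theta>]
  using mon_cong_gp_cong group_Gp_quot sub id by (auto simp: eqv_def)

text \<open>By \<open>gp_cong_subset\<close> every group congruence above \<open>\<theta>\<close>
  contains \<open>gp_cong\<close>, so all of them identify \<open>e\<close> with 1.\<close>

lemma E_unitary_quotD: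
  assumes \<theta>: "mon_cong (word_monoid X) \<theta>" and sub: "inv_cong X (special rs) \<subseteq> \<theta>"
    and eu: "E_unitary (quot_mon (word_monoid X) \<theta>)" and e: "e \<approx> []"
  shows "(e @ e, e) \<in> \<theta>"
proof -
  have "(e, []) \<in> \<theta>'" if "mon_cong (word_monoid X) \<theta>'" "\<theta> \<subseteq> \<theta>'" "group (quot_mon (word_monoid X) \<theta>')" for \<theta>'
    using gp_cong_subset[OF that(1) _ that(3)] that(2) sub e unfolding eqv_def by blast
  then show ?thesis
    using eu[unfolded E_unitary_quot_iff[OF monoid_word_monoid \<theta>]] eqv_words(1)[OF e] by simp
qed

subsection \<open>Submonoids of the group\<close>

text \<open>The full preimage, in the word monoid, of the submonoid of \<open>G\<close> generated by
  \<open>S\<close>. It is related to \<open>mon_gen\<close> by \<open>gp_elem_mon_gen_iff\<close>,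
  so that later arguments need not handle classes.\<close>

definition sub :: "'a word set \<Rightarrow> 'a word set" where
  "sub S = {w \<in> words X. \<exists>ps. set ps \<subseteq> S \<and> w \<approx> concat ps}"

lemma sub_words: "w \<in> sub S \<Longrightarrow> w \<in> words X"
  by (simp add: sub_def)

lemma sub_Nil [simp]: "[] \<in> sub S"
  unfolding sub_def by (auto intro: exI[of _ "[]"])

lemma sub_append:
  assumes "v \<in> sub S" "w \<in> sub S"
  shows "v @ w \<in> sub S"
proof -
  obtain ps qs where "set ps \<subseteq> S" "v \<approx> concat ps" "set qs \<subseteq> S" "w \<approx> concat qs"
    using assms unfolding sub_def by blast
  then have "set (ps @ qs) \<subseteq> S" "v @ w \<approx> concat (ps @ qs)" by (auto intro: eqv_append)
  then show ?thesis using assms unfolding sub_def by (blast dest: eqv_words)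
qed

lemma sub_base: "w \<in> S \<Longrightarrow> w \<in> words X \<Longrightarrow> w \<in> sub S"
  unfolding sub_def by (auto intro!: exI[of _ "[w]"])

lemma sub_cong: "v \<approx> w \<Longrightarrow> w \<in> sub S \<Longrightarrow> v \<in> sub S"
  unfolding sub_def using eqv_words(1)[of v w] eqv_trans[of v w] by blast

lemma sub_concat: "set ps \<subseteq> sub S \<Longrightarrow> concat ps \<in> sub S"
  by (induction ps) (auto intro: sub_append)

lemma sub_subset:
  assumes "S \<subseteq> sub T"
  shows "sub S \<subseteq> sub T"
proof
  fix w assume "w \<in> sub S"
  then obtain ps where "set ps \<subseteq> S" "w \<approx> concat ps" unfolding sub_def by blast
  then show "w \<in> sub T" using sub_concat[of ps T] assms sub_cong by blast
qed

lemma gp_elem_mon_gen_iff: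
  assumes S: "S \<subseteq> words X" and w: "w \<in> words X"
  shows "gp_elem X (special rs) w \<in> mon_gen (Gp X (special rs)) (gp_elem X (special rs) ` S) \<longleftrightarrow> w \<in> sub S"
proof -
  let ?G = "Gp X (special rs)" and ?f = "gp_elem X (special rs)"
  have c: "carrier ?G = ?f ` words X" by (simp add: Gp_def gp_elem_def quot_simps)
  have one: "\<one>\<^bsub>?G\<^esub> = ?f []" by (simp add: Gp_def gp_elem_def quot_simps)
  have m: "?f v \<otimes>\<^bsub>?G\<^esub> ?f w = ?f (v @ w)" if "v \<in> words X" "w \<in> words X" for v w
    using quot_mult[OF mon_cong_gp_cong monoid_word_monoid] that by (simp add: Gp_def gp_elem_def)
  have sm: "submonoid (?f ` sub S) ?G"
    by (rule submonoid.intro) (use sub_words sub_append in \<open>auto simp: c one m\<close>)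
  have "?f ` S \<subseteq> ?f ` sub S" using S sub_base by blast
  with sm have "mon_gen ?G (?f ` S) \<subseteq> ?f ` sub S" unfolding mon_gen_def by blast
  moreover have "?f v \<in> mon_gen ?G (?f ` S)" if "v \<in> sub S" for v
  proof -
    have "?f v \<in> H" if H: "submonoid H ?G" "?f ` S \<subseteq> H" for H
    proof -
      obtain ps where ps: "set ps \<subseteq> S" "v \<approx> concat ps" using \<open>v \<in> sub S\<close> unfolding sub_def by blast
      have "?f (concat ps) \<in> H"
        using ps(1)
      proof (induction ps)
        case Nil
        then show ?case using submonoid.one_closed[OF H(1)] by (simp add: one)
      next
        case (Cons p ps)
        then have "?f p \<in> H" "?f (concat ps) \<in> H" using H(2) by auto
        moreover have "p \<in> words X" "set ps \<subseteq> words X" using Cons.prems S by auto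
        ultimately show ?case
          using submonoid.m_closed[OF H(1)] m[of p "concat ps"] by (fastforce simp: words_concat)
      qed
      moreover have "?f v = ?f (concat ps)" using ps(2) class_eq_iff_eqv eqv_words by simp
      ultimately show ?thesis by simp
    qed
    then show ?thesis unfolding mon_gen_def by blast
  qed
  moreover have "v \<in> sub S" if "?f w = ?f v" "w \<in> sub S" "v \<in> words X" for v w
    using that class_eq_iff_eqv[of v w] sub_words[of w S] sub_cong[of v w S] eqv_sym[of w v] by auto
  ultimately show ?thesis using w by blast
qed

lemma mon_gen_eqI:
  assumes "S \<subseteq> words X" "T \<subseteq> words X" "sub S = sub T"
  shows "mon_gen (Gp X (special rs)) (gp_elem X (special rs) ` S) =
    mon_gen (Gp X (special rs)) (gp_elem X (special rs) ` T)"
proof -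
  let ?G = "Gp X (special rs)" and ?f = "gp_elem X (special rs)"
  have M: "monoid ?G" unfolding Gp_def by (rule quot_monoid[OF mon_cong_gp_cong monoid_word_monoid])
  have c: "carrier ?G = ?f ` words X" by (simp add: Gp_def gp_elem_def quot_simps)
  have "submonoid (carrier ?G) ?G"
    by (rule submonoid.intro) (use monoid.m_closed[OF M] monoid.one_closed[OF M] in auto)
  then have "mon_gen ?G (?f ` S) \<subseteq> ?f ` words X" if "S \<subseteq> words X" for S
    unfolding mon_gen_def c using that by blast
  then show ?thesis using assms gp_elem_mon_gen_iff by blast
qed

definition prefixes_of_relators :: "'a word set" where
  "prefixes_of_relators = (\<Union>r\<in>rs. pref r)"

definition P :: "'a word set" where
  "P = sub prefixes_of_relators"

lemma prefixes_words: "prefixes_of_relators \<subseteq> words X"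
  unfolding prefixes_of_relators_def pref_def using rs_words words_prefix by blast

lemma P_iff: "w \<in> words X \<Longrightarrow> gp_elem X (special rs) w \<in> prefix_monoid X rs \<longleftrightarrow> w \<in> P"
  unfolding P_def prefix_monoid_def
  using gp_elem_mon_gen_iff[OF prefixes_words] by (simp add: prefixes_of_relators_def)

lemma P_words: "w \<in> P \<Longrightarrow> w \<in> words X"
  unfolding P_def by (rule sub_words)

lemma P_Nil [simp]: "[] \<in> P" by (simp add: P_def)

lemma P_append: "v \<in> P \<Longrightarrow> w \<in> P \<Longrightarrow> v @ w \<in> P"
  unfolding P_def by (rule sub_append)

lemma P_cong: "v \<approx> w \<Longrightarrow> w \<in> P \<Longrightarrow> v \<in> P"
  unfolding P_def by (rule sub_cong)

lemma P_prefix: "r \<in> rs \<Longrightarrow> prefix p r \<Longrightarrow> p \<in> P"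
  unfolding P_def using prefixes_words by (intro sub_base) (auto simp: prefixes_of_relators_def pref_def)

lemma P_cancel:
  assumes "a @ inv_word q @ q @ b \<in> P"
  shows "a @ b \<in> P"
  using eqv_sym[OF eqv_cancel(2)[of a q b]] assms P_words[OF assms] P_cong by auto

subsection \<open>The maximal E-unitary quotient\<close>

text \<open>A word traces a path in the Cayley graph of the group. Its class in the maximal E-unitary
  quotient is determined by its value in the group and by the subgraph obtained by attaching
  to every vertex \<open>q\<close> of the path the loops labelled by the relators, based at the vertices
  in \<open>q P\<close>. Thus \<open>cov w g l\<close> says that the edge with label \<open>l\<close> starting at \<open>g\<close>, or its inverse,
  lies in this subgraph.\<close>

definition loop_edge :: "'a word \<Rightarrow> 'a word \<Rightarrow> 'a \<times> bool \<Rightarrow> bool" where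
  "loop_edge q g l \<longleftrightarrow> (\<exists>r\<in>rs. \<exists>p. prefix (p @ [l]) r \<and> inv_word q @ g @ inv_word p \<in> P) \<or>
    (\<exists>r\<in>rs. \<exists>p. prefix (p @ [apsnd Not l]) r \<and> inv_word q @ g @ [l] @ inv_word p \<in> P)"

definition path_edge :: "'a word \<Rightarrow> 'a word \<Rightarrow> 'a \<times> bool \<Rightarrow> bool" where
  "path_edge w g l \<longleftrightarrow> (\<exists>q. prefix (q @ [l]) w \<and> g \<approx> q) \<or>
    (\<exists>q. prefix (q @ [apsnd Not l]) w \<and> g \<approx> q @ [apsnd Not l])"

definition cov :: "'a word \<Rightarrow> 'a word \<Rightarrow> 'a \<times> bool \<Rightarrow> bool" where
  "cov w g l \<longleftrightarrow> (\<exists>q. prefix q w \<and> loop_edge q g l) \<or> path_edge w g l"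

definition EU_rel :: "('a word \<times> 'a word) set" where
  "EU_rel = {(v, w). v \<approx> w \<and> (\<forall>g\<in>words X. \<forall>l. fst l \<in> X \<longrightarrow> cov v g l = cov w g l)}"

lemma EU_relD:
  assumes "(v, w) \<in> EU_rel"
  shows "v \<approx> w" "g \<in> words X \<Longrightarrow> fst l \<in> X \<Longrightarrow> cov v g l = cov w g l"
  using assms unfolding EU_rel_def by blast+

section \<open>Subgraphs of products, inverses and relators\<close>

lemma loop_edge_append: "loop_edge (v @ q) g l \<longleftrightarrow> loop_edge q (inv_word v @ g) l"
  by (simp add: loop_edge_def)

lemma loop_edge_eqv:
  assumes "g \<approx> g'" "q \<in> words X" "fst l \<in> X" "loop_edge q g l"
  shows "loop_edge q g' l"
proof -
  have P: "inv_word q @ g' @ b \<in> P" if "inv_word q @ g @ b \<in> P" for b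
  proof -
    have "b \<in> words X" using P_words[OF that] by simp
    then have "inv_word q @ g' @ b \<approx> inv_word q @ g @ b"
      using assms by (intro eqv_context) (auto intro: eqv_sym)
    then show ?thesis using that by (rule P_cong)
  qed
  then show ?thesis using assms(4) unfolding loop_edge_def by blast
qed

lemma cov_eqv:
  assumes "g \<approx> g'" "w \<in> words X" "fst l \<in> X"
  shows "cov w g l = cov w g' l"
proof -
  have "cov w h' l" if "h \<approx> h'" "cov w h l" for h h'
    using that loop_edge_eqv[OF that(1) _ assms(3)] words_prefix[OF _ assms(2)] eqv_trans[OF eqv_sym[OF that(1)]]
    unfolding cov_def path_edge_def by blast
  then show ?thesis using assms(1) eqv_sym by blast
qed

text \<open>The path of \<open>v @ w\<close> is that of \<open>v\<close> followed by the translate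
  by \<open>v\<close> of that of \<open>w\<close>.\<close>

lemma path_edge_append:
  assumes "v \<in> words X" "w \<in> words X" "g \<in> words X"
  shows "path_edge (v @ w) g l \<longleftrightarrow> path_edge v g l \<or> path_edge w (inv_word v @ g) l"
proof -
  \<comment> \<open>The instances \<open>b = []\<close> and \<open>b = [a]\<close> treat the two
    orientations of an edge.\<close>
  have *: "(\<exists>q. prefix (q @ [a]) (v @ w) \<and> g \<approx> q @ b) \<longleftrightarrow>
      (\<exists>q. prefix (q @ [a]) v \<and> g \<approx> q @ b) \<or> (\<exists>q. prefix (q @ [a]) w \<and> inv_word v @ g \<approx> q @ b)"
    (is "?l \<longleftrightarrow> ?r1 \<or> ?r2")
    if b: "b \<in> words X" for a b
  proof
    assume ?l
    then obtain q where q: "prefix (q @ [a]) (v @ w)" "g \<approx> q @ b" by blast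
    show "?r1 \<or> ?r2"
    proof (cases "prefix (q @ [a]) v")
      case True
      then show ?thesis using q by blast
    next
      case False
      then obtain us where us: "q @ [a] = v @ us" "prefix us w" using q(1) by (auto simp: prefix_append)
      then have "us \<noteq> []" using False by auto
      then obtain us' where us': "us = us' @ [a]" "q = v @ us'"
        using us(1) by (cases us rule: rev_cases) auto
      then have "inv_word v @ g \<approx> us' @ b"
        using q us assms b eqv_words(2)[OF q(2)] by (subst eqv_shift) auto
      then show ?thesis using us us' by blast
    qed
  next
    assume "?r1 \<or> ?r2"
    then show ?l
    proof
      assume ?r1
      then show ?l by (blast intro: prefix_order.trans prefixI)
    next
      assume ?r2
      then obtain q where q: "prefix (q @ [a]) w" "inv_word v @ g \<approx> q @ b" by blast
      then have "g \<approx> (v @ q) @ b" using eqv_shift[of v "q @ b" g] assms eqv_words(2)[OF q(2)] by simp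
      moreover have "prefix ((v @ q) @ [a]) (v @ w)" using q(1) by simp
      ultimately show ?l by blast
    qed
  qed
  show ?thesis
  proof (cases "fst l \<in> X")
    case True
    then show ?thesis unfolding path_edge_def using *[of "[]" l] *[of "[apsnd Not l]" "apsnd Not l"] by auto
  next
    case False
    have "\<not> prefix (q @ [a]) u" if "fst a = fst l" "u \<in> words X" for a q u
      using words_prefix[of "q @ [a]" u] that False by auto
    then have "\<not> path_edge u h l" if "u \<in> words X" for u h
      using that unfolding path_edge_def by (metis fst_apsnd)
    then show ?thesis using assms by simp
  qed
qed

lemma cov_Nil: "cov [] g l \<longleftrightarrow> loop_edge [] g l"
  by (simp add: cov_def path_edge_def)

lemma cov_append:
  assumes "v \<in> words X" "w \<in> words X" "g \<in> words X" "fst l \<in> X"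
  shows "cov (v @ w) g l \<longleftrightarrow> cov v g l \<or> cov w (inv_word v @ g) l"
proof -
  have "(\<exists>q. prefix q (v @ w) \<and> loop_edge q g l) \<longleftrightarrow>
      (\<exists>q. prefix q v \<and> loop_edge q g l) \<or> (\<exists>q. prefix q w \<and> loop_edge (v @ q) g l)"
    by (auto simp: prefix_append)
  then show ?thesis unfolding cov_def path_edge_append[OF assms(1-3)] by (auto simp: loop_edge_append)
qed

lemma cov_single_inv:
  assumes "fst a \<in> X" "g \<in> words X" "fst l \<in> X"
  shows "cov [apsnd Not a] ([apsnd Not a] @ g) l \<longleftrightarrow> cov [a] g l"
proof -
  have s: "cov [b] h l \<longleftrightarrow> loop_edge [] h l \<or> loop_edge [b] h l \<or> (l = b \<and> h \<approx> []) \<or>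
      (l = apsnd Not b \<and> h \<approx> [b])" for b h
  proof -
    have e: "apsnd Not l = b \<longleftrightarrow> l = apsnd Not b" by auto
    have "path_edge [b] h l \<longleftrightarrow> (l = b \<and> h \<approx> []) \<or> (l = apsnd Not b \<and> h \<approx> [b])"
      unfolding path_edge_def by (auto simp: prefix_Cons e)
    then show ?thesis unfolding cov_def by (auto simp: prefix_Cons)
  qed
  have 1: "loop_edge [] ([apsnd Not a] @ g) l \<longleftrightarrow> loop_edge [a] g l"
    using loop_edge_append[of "[a]" "[]" g l] by simp
  have e: "[a] @ [apsnd Not a] @ g \<approx> g" using eqv_cancel(1)[of "[]" "[a]" g] assms by simp
  have 2: "loop_edge [apsnd Not a] ([apsnd Not a] @ g) l \<longleftrightarrow> loop_edge [] g l"
    using loop_edge_append[of "[apsnd Not a]" "[]" "[apsnd Not a] @ g" l]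
      loop_edge_eqv[OF e, of "[]" l] loop_edge_eqv[OF eqv_sym[OF e], of "[]" l] assms by auto
  have 3: "[apsnd Not a] @ g \<approx> [] \<longleftrightarrow> g \<approx> [a]" using eqv_shift[of "[a]" "[]" g] assms by simp
  have 4: "[apsnd Not a] @ g \<approx> [apsnd Not a] \<longleftrightarrow> g \<approx> []"
  proof -
    have "[apsnd Not a] @ g \<approx> [apsnd Not a] \<longleftrightarrow> g \<approx> [a] @ [apsnd Not a]"
      using eqv_shift[of "[a]" "[apsnd Not a]" g] assms by simp
    moreover have "[a] @ [apsnd Not a] \<approx> []" using eqv_right_inv[of "[a]"] assms by simp
    ultimately show ?thesis using eqv_cong_right by simp
  qed
  show ?thesis unfolding s 1 2 using 3 4 by auto
qed

text \<open>The path of \<open>w^-1\<close>, translated by \<open>w\<close>, runs back along the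
  path of \<open>w\<close>: same vertices, same edges.\<close>

lemma cov_inv_word:
  assumes "w \<in> words X" "g \<in> words X" "fst l \<in> X"
  shows "cov (inv_word w) (inv_word w @ g) l \<longleftrightarrow> cov w g l"
  using assms
proof (induction w arbitrary: g)
  case (Cons a w)
  have e: "w @ inv_word w @ [apsnd Not a] @ g \<approx> [apsnd Not a] @ g"
    using eqv_cancel(1)[of "[]" w "[apsnd Not a] @ g"] Cons.prems by simp
  have "cov (inv_word (a # w)) (inv_word (a # w) @ g) l \<longleftrightarrow>
      cov (inv_word w) (inv_word w @ [apsnd Not a] @ g) l \<or>
      cov [apsnd Not a] (w @ inv_word w @ [apsnd Not a] @ g) l"
    using cov_append[of "inv_word w" "[apsnd Not a]" "inv_word w @ [apsnd Not a] @ g" l] Cons.prems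
    by (simp add: inv_word_Cons)
  also have "\<dots> \<longleftrightarrow> cov w ([apsnd Not a] @ g) l \<or> cov [apsnd Not a] ([apsnd Not a] @ g) l"
    using Cons.IH[of "[apsnd Not a] @ g"] cov_eqv[OF e, of "[apsnd Not a]" l] Cons.prems by simp
  also have "\<dots> \<longleftrightarrow> cov w ([apsnd Not a] @ g) l \<or> cov [a] g l"
    using cov_single_inv[of a g l] Cons.prems by simp
  also have "\<dots> \<longleftrightarrow> cov ([a] @ w) g l"
    using cov_append[of "[a]" w g l] Cons.prems by auto
  finally show ?case by simp
qed simp

lemma cov_mult_inv_word:
  assumes "w \<in> words X" "g \<in> words X" "fst l \<in> X"
  shows "cov (w @ inv_word w) g l \<longleftrightarrow> cov w g l"
  using cov_append[of w "inv_word w" g l] cov_inv_word[of w g l] assms by simp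

text \<open>A word equal to 1 in \<open>G\<close> traces a closed path, so the path of
  \<open>w\<close> starts again at the origin and is not translated.\<close>

lemma cov_eqv_one_append:
  assumes "e \<approx> []" "w \<in> words X" "g \<in> words X" "fst l \<in> X"
  shows "cov (e @ w) g l \<longleftrightarrow> cov e g l \<or> cov w g l"
proof -
  have "inv_word e @ g \<approx> g"
    using eqv_append[OF eqv_inv_word[OF assms(1)], of g g] assms by simp
  then show ?thesis using cov_append[of e w g l] cov_eqv[of "inv_word e @ g" g w l] assms eqv_words by simp
qed

text \<open>Reading a relator adds nothing. Its own edges belong to the loop attached at the origin,
  and its vertices \<open>q\<close> lie in \<open>P\<close>, so that \<open>q P\<close> is contained
  in \<open>P\<close>.\<close>

lemma cov_relator:
  assumes r: "r \<in> rs" and g: "g \<in> words X" and l: "fst l \<in> X"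
  shows "cov r g l \<longleftrightarrow> cov [] g l"
proof
  have loop: "loop_edge [] g l" if q: "prefix q r" "loop_edge q g l" for q
  proof -
    have qP: "q \<in> P" "q \<in> words X" using P_prefix[OF r q(1)] P_words by auto
    have b: "b \<in> P" if "inv_word q @ b \<in> P" for b
    proof -
      have "q @ inv_word q @ b \<in> P" using P_append[OF qP(1) that] by simp
      then show ?thesis using P_cancel[of "[]" "inv_word q" b] by simp
    qed
    then show ?thesis using q(2) unfolding loop_edge_def inv_word_Nil append_Nil by blast
  qed
  have path: "loop_edge [] g l" if "path_edge r g l"
    using that unfolding path_edge_def
  proof (elim disjE exE conjE)
    fix q assume q: "prefix (q @ [l]) r" "g \<approx> q"
    have "g @ inv_word q \<approx> q @ inv_word q" using q eqv_words by (intro eqv_append) auto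
    also have "\<dots> \<approx> []" using q eqv_words by (intro eqv_right_inv) auto
    finally have "g @ inv_word q \<in> P" by (rule P_cong) simp
    then show ?thesis using q r unfolding loop_edge_def by auto
  next
    fix q assume q: "prefix (q @ [apsnd Not l]) r" "g \<approx> q @ [apsnd Not l]"
    let ?q = "q @ [apsnd Not l]"
    have qw: "?q \<in> words X" using eqv_words(2)[OF q(2)] .
    have "g @ inv_word ?q \<approx> ?q @ inv_word ?q"
      by (rule eqv_append[OF q(2) eqv_refl]) (use qw in \<open>simp only: words_inv_word\<close>)
    also have "\<dots> \<approx> []" by (rule eqv_right_inv[OF qw])
    finally have "g @ inv_word ?q \<in> P" by (rule P_cong) simp
    then have "g @ [l] @ inv_word q \<in> P" by simp
    then show ?thesis using q r unfolding loop_edge_def by auto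
  qed
  assume "cov r g l"
  then show "cov [] g l" using loop path unfolding cov_Nil unfolding cov_def by blast
next
  assume "cov [] g l"
  moreover have "prefix [] r" by simp
  ultimately show "cov r g l" unfolding cov_Nil unfolding cov_def by blast
qed

section \<open>The congruence defined by values and subgraphs\<close>

lemma mon_cong_EU_rel: "mon_cong (word_monoid X) EU_rel"
proof (rule mon_congI, unfold carrier_word_monoid mult_word_monoid)
  show "a \<in> words X \<and> b \<in> words X" if "(a, b) \<in> EU_rel" for a b
    using that eqv_words by (auto simp: EU_rel_def)
  show "(a, a) \<in> EU_rel" if "a \<in> words X" for a
    using that by (auto simp: EU_rel_def)
  show "(b, a) \<in> EU_rel" if "(a, b) \<in> EU_rel" for a b
    using that eqv_sym by (auto simp: EU_rel_def)
  show "(a, c) \<in> EU_rel" if "(a, b) \<in> EU_rel" "(b, c) \<in> EU_rel" for a b c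
    using that eqv_trans[of a b c] by (auto simp: EU_rel_def)
  show "(a @ c, b @ d) \<in> EU_rel" if "(a, b) \<in> EU_rel" "(c, d) \<in> EU_rel" for a b c d
  proof -
    have ab: "a \<approx> b" "c \<approx> d" using that EU_relD(1) by auto
    note w = eqv_words[OF ab(1)] eqv_words[OF ab(2)]
    have "cov (a @ c) g l = cov (b @ d) g l" if g: "g \<in> words X" and l: "fst l \<in> X" for g l
    proof -
      have e: "inv_word a @ g \<approx> inv_word b @ g" using ab g by (intro eqv_append eqv_inv_word) auto
      have "cov a g l = cov b g l" "cov c (inv_word a @ g) l = cov d (inv_word a @ g) l"
        using EU_relD(2)[OF \<open>(a, b) \<in> EU_rel\<close>] EU_relD(2)[OF \<open>(c, d) \<in> EU_rel\<close>] g l w by simp_all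
      then show ?thesis using cov_eqv[OF e, of d l] w g l by (simp add: cov_append)
    qed
    then show ?thesis using ab by (auto simp: EU_rel_def intro: eqv_append)
  qed
qed

lemma inv_cong_subset_EU_rel: "inv_cong X (special rs) \<subseteq> EU_rel"
proof (rule inv_cong_subset[OF mon_cong_EU_rel])
  show "(r, []) \<in> EU_rel" if "r \<in> rs" for r
    using that cov_relator eqv_relator by (auto simp: EU_rel_def)
  show "(w @ inv_word w @ w, w) \<in> EU_rel" if w: "w \<in> words X" for w
  proof -
    have "cov (w @ inv_word w @ w) g l = cov w g l" if "g \<in> words X" "fst l \<in> X" for g l
      using cov_eqv_one_append[OF eqv_right_inv[OF w] w that] cov_mult_inv_word[OF w that] by simp
    moreover have "w @ inv_word w @ w \<approx> w" using eqv_cancel(1)[of "[]" w w] w by simp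
    ultimately show ?thesis by (simp add: EU_rel_def)
  qed
  show "(v @ inv_word v @ w @ inv_word w, w @ inv_word w @ v @ inv_word v) \<in> EU_rel"
    if v: "v \<in> words X" and w: "w \<in> words X" for v w
  proof -
    have 1: "cov (a @ inv_word a @ b @ inv_word b) g l \<longleftrightarrow> cov a g l \<or> cov b g l"
      if "a \<in> words X" "b \<in> words X" "g \<in> words X" "fst l \<in> X" for a b g l
      using cov_eqv_one_append[OF eqv_right_inv[OF that(1)], of "b @ inv_word b" g l] that
      by (simp add: cov_mult_inv_word)
    have 2: "a @ inv_word a @ b @ inv_word b \<approx> []" if "a \<in> words X" "b \<in> words X" for a b
      using eqv_append[OF eqv_right_inv[OF that(1)] eqv_right_inv[OF that(2)]] by simp
    show ?thesis unfolding EU_rel_def using 1 2 v w eqv_trans[OF 2 eqv_sym[OF 2]] by auto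
  qed
qed

lemma EU_rel_subset: "EU_rel \<subseteq> gp_cong X (special rs)"
  by (auto simp: EU_rel_def eqv_def)

text \<open>A closed path traversed twice spans the same subgraph as when traversed once.\<close>

lemma E_unitary_EU_rel: "E_unitary (quot_mon (word_monoid X) EU_rel)"
proof (rule E_unitary_quotI[OF mon_cong_EU_rel EU_rel_subset])
  fix e assume e: "e \<approx> []"
  have "e @ e \<approx> e" using eqv_append[OF e eqv_refl[OF eqv_words(1)[OF e]]] by simp
  then show "(e @ e, e) \<in> EU_rel"
    using cov_eqv_one_append[OF e eqv_words(1)[OF e]] by (auto simp: EU_rel_def)
qed

text \<open>The subgraph of \<open>w w'\<close> is that of the empty word, so each edge of
  \<open>w\<close> lies on a loop attached at a point of \<open>P\<close>. The end of the edge is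
  then a point of \<open>P\<close> times a prefix of a relator. Through this fact unital
  factorisations are conservative.\<close>

lemma right_unit_prefix:
  assumes "(w @ w', []) \<in> inv_cong X (special rs)" "prefix p w"
  shows "p \<in> P"
proof (cases p rule: rev_cases)
  case (snoc p0 l)
  have rel: "(w @ w', []) \<in> EU_rel" using assms(1) inv_cong_subset_EU_rel by blast
  then have "w \<in> words X" using eqv_words(1)[of "w @ w'"] by (auto simp: EU_rel_def)
  then have p0: "p0 \<in> words X" "fst l \<in> X" using words_prefix[OF assms(2)] snoc by auto
  have "prefix (p0 @ [l]) (w @ w')" using assms(2) snoc by (simp add: prefix_prefix)
  then have "path_edge (w @ w') p0 l" unfolding path_edge_def using eqv_refl[OF p0(1)] by blast
  then have "cov (w @ w') p0 l" unfolding cov_def by blast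
  then have "loop_edge [] p0 l" using EU_relD(2)[OF rel p0] by (simp add: cov_Nil)
  then show ?thesis
    unfolding loop_edge_def
  proof (elim disjE bexE exE conjE)
    fix r q assume r: "r \<in> rs" and q: "prefix (q @ [l]) r" "inv_word [] @ p0 @ inv_word q \<in> P"
    have "(p0 @ inv_word q) @ q @ [l] \<in> P" using P_append[of "p0 @ inv_word q" "q @ [l]"] q P_prefix[OF r q(1)] by simp
    then show ?thesis using P_cancel[of p0 q "[l]"] snoc by simp
  next
    fix r q assume r: "r \<in> rs"
      and q: "prefix (q @ [apsnd Not l]) r" "inv_word [] @ p0 @ [l] @ inv_word q \<in> P"
    have "prefix q r" using q(1) by (blast intro: prefix_order.trans prefixI)
    then have qP: "q \<in> P" by (rule P_prefix[OF r])
    have "(p0 @ [l] @ inv_word q) @ q \<in> P" using P_append[of "p0 @ [l] @ inv_word q" q] q qP by simp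
    then show ?thesis using P_cancel[of "p0 @ [l]" q "[]"] snoc by simp
  qed
qed simp

text \<open>A finite test: only the path of \<open>v\<close> is inspected. Its attached loops need
  no inspection, since \<open>cong_if_edges_covered\<close> derives the congruence from the path
  edges alone.\<close>

definition edges_covered :: "'a word \<Rightarrow> 'a word \<Rightarrow> bool" where
  "edges_covered v w \<longleftrightarrow> (\<forall>p l. prefix (p @ [l]) v \<longrightarrow> cov w p l)"

lemma EU_rel_imp_edges_covered:
  assumes "(v, w) \<in> EU_rel"
  shows "edges_covered v w"
  unfolding edges_covered_def
proof (intro allI impI)
  fix p l assume p: "prefix (p @ [l]) v"
  have "v \<in> words X" using assms eqv_words by (auto simp: EU_rel_def)
  then have w: "p \<in> words X" "fst l \<in> X" using words_prefix[OF p] by auto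
  have "path_edge v p l" unfolding path_edge_def using p eqv_refl[OF w(1)] by blast
  then show "cov w p l" using assms w unfolding EU_rel_def cov_def by blast
qed

end

section \<open>Leastness: an arbitrary E-unitary quotient\<close>

locale E_unitary_quotient = special_presentation X rs
  for X :: "'a set" and rs :: "'a word set" +
  fixes \<theta> :: "('a word \<times> 'a word) set"
  assumes mon_cong: "mon_cong (word_monoid X) \<theta>"
    and inv_cong_subset_cong: "inv_cong X (special rs) \<subseteq> \<theta>"
    and E_unitary: "E_unitary (quot_mon (word_monoid X) \<theta>)"
begin

definition cong_eq :: "'a word \<Rightarrow> 'a word \<Rightarrow> bool" (infix "\<sim>" 50) where
  "v \<sim> w \<longleftrightarrow> (v, w) \<in> \<theta>"

lemmas cong_sym = mon_congD(3)[OF mon_cong, folded cong_eq_def]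
  and cong_trans [trans] = mon_congD(4)[OF mon_cong, folded cong_eq_def]

lemma cong_refl [simp]: "w \<in> words X \<Longrightarrow> w \<sim> w"
  using mon_congD(2)[OF mon_cong, folded cong_eq_def] by simp

lemma cong_context: "s \<sim> t \<Longrightarrow> a \<in> words X \<Longrightarrow> b \<in> words X \<Longrightarrow> a @ s @ b \<sim> a @ t @ b"
  using mon_congD(5)[OF mon_cong, folded cong_eq_def] by simp

lemma cong_inverse: "w \<in> words X \<Longrightarrow> w @ inv_word w @ w \<sim> w"
  by (unfold cong_eq_def, rule subsetD[OF inv_cong_subset_cong], unfold inv_cong_def, rule subsetD[OF subset_gen_cong]) blast

lemma cong_commute: "v \<in> words X \<Longrightarrow> w \<in> words X \<Longrightarrow>
    v @ inv_word v @ w @ inv_word w \<sim> w @ inv_word w @ v @ inv_word v"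
  by (unfold cong_eq_def, rule subsetD[OF inv_cong_subset_cong], unfold inv_cong_def, rule subsetD[OF subset_gen_cong]) blast

lemma cong_relator: "r \<in> rs \<Longrightarrow> r \<sim> []"
  by (unfold cong_eq_def, rule subsetD[OF inv_cong_subset_cong], unfold inv_cong_def special_def,
      rule subsetD[OF subset_gen_cong]) blast

lemma cong_idem: "e \<approx> [] \<Longrightarrow> e @ e \<sim> e"
  unfolding cong_eq_def by (rule E_unitary_quotD[OF mon_cong inv_cong_subset_cong E_unitary])

text \<open>Idempotents are self-inverse: as \<open>e\<close> and \<open>e^-1\<close> are
  idempotent, both sides reduce to the two sides of the law that \<open>e e^-1\<close> and
  \<open>e^-1 e\<close> commute.\<close>

lemma cong_inv_word:
  assumes "e \<approx> []"
  shows "e \<sim> inv_word e"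
proof -
  let ?i = "inv_word e"
  have w [simp]: "e \<in> words X" using eqv_words assms by blast
  have i: "?i \<approx> []" using eqv_inv_word[OF assms] by simp
  have "e \<sim> e @ ?i @ e" using cong_sym[OF cong_inverse[of e]] by simp
  also have "\<dots> \<sim> e @ ?i @ ?i @ e" using cong_context[OF cong_sym[OF cong_idem[OF i]], of e e] by simp
  also have "\<dots> \<sim> ?i @ e @ e @ ?i" using cong_commute[of e ?i] by simp
  also have "\<dots> \<sim> ?i @ e @ ?i" using cong_context[OF cong_idem[OF assms], of ?i ?i] by simp
  also have "\<dots> \<sim> ?i" using cong_inverse[of ?i] by simp
  finally show ?thesis .
qed

lemma cong_eq_mult_inv_word:
  assumes "e \<approx> []"
  shows "e \<sim> e @ inv_word e"
proof -
  have w: "e \<in> words X" using eqv_words assms by blast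
  have "e \<sim> e @ e" by (rule cong_sym[OF cong_idem[OF assms]])
  also have "\<dots> \<sim> e @ inv_word e" using cong_context[OF cong_inv_word[OF assms], of e "[]"] w by simp
  finally show ?thesis .
qed

text \<open>If \<open>a \<approx> b\<close>, then \<open>b\<^sup>-\<^sup>1 a\<close> is idempotent because the quotient is E-unitary, so \<open>a\<close> and
  \<open>b\<close> are compatible.\<close>

lemma cong_if_eqv:
  assumes ab: "a \<approx> b" and dom: "a @ inv_word a \<sim> b @ inv_word b"
  shows "a \<sim> b"
proof -
  have w [simp]: "a \<in> words X" "b \<in> words X" using eqv_words[OF ab] by auto
  define f where "f = inv_word b @ a"
  have fw [simp]: "f \<in> words X" by (simp add: f_def)
  have "f \<approx> inv_word b @ b" unfolding f_def using ab by (intro eqv_append) auto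
  also have "\<dots> \<approx> []" by (rule eqv_left_inv) simp
  finally have f: "f \<approx> []" .
  have "a \<sim> a @ inv_word a @ a" using cong_sym[OF cong_inverse[of a]] by simp
  also have "\<dots> \<sim> b @ f" using cong_context[OF dom, of "[]" a] by (simp add: f_def)
  finally have a: "a \<sim> b @ f" .
  have "b \<sim> b @ inv_word b @ b" using cong_sym[OF cong_inverse[of b]] by simp
  also have "\<dots> \<sim> a @ inv_word f" using cong_context[OF cong_sym[OF dom], of "[]" b] by (simp add: f_def)
  also have "\<dots> \<sim> a @ f" using cong_context[OF cong_sym[OF cong_inv_word[OF f]], of a "[]"] by simp
  finally have b: "b \<sim> a @ f" .
  note a
  also have "b @ f \<sim> a @ f @ f" using cong_context[OF b, of "[]" f] by simp
  also have "\<dots> \<sim> a @ f" using cong_context[OF cong_idem[OF f], of a "[]"] by simp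
  also have "\<dots> \<sim> b" by (rule cong_sym[OF b])
  finally show ?thesis .
qed

text \<open>\<open>dom_le e g\<close> says that the idempotent \<open>e\<close> lies below the domain \<open>g g\<^sup>-\<^sup>1\<close> of \<open>g\<close>.\<close>

definition dom_le :: "'a word \<Rightarrow> 'a word \<Rightarrow> bool" where
  "dom_le e g \<longleftrightarrow> g \<in> words X \<and> e @ g @ inv_word g \<sim> e"

lemma commute_idem:
  assumes e: "e \<approx> []" and [simp]: "g \<in> words X"
  shows "e @ g @ inv_word g \<sim> g @ inv_word g @ e"
proof -
  have w [simp]: "e \<in> words X" using eqv_words e by blast
  have "e @ g @ inv_word g \<sim> e @ inv_word e @ g @ inv_word g"
    using cong_context[OF cong_eq_mult_inv_word[OF e], of "[]" "g @ inv_word g"] by simp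
  also have "\<dots> \<sim> g @ inv_word g @ e @ inv_word e" by (rule cong_commute) auto
  also have "\<dots> \<sim> g @ inv_word g @ e"
    using cong_context[OF cong_sym[OF cong_eq_mult_inv_word[OF e]], of "g @ inv_word g" "[]"] by simp
  finally show ?thesis .
qed

text \<open>Insert \<open>y y^-1\<close>, which \<open>e\<close> absorbs, move \<open>x x^-1\<close>
  to the front, replace \<open>e y\<close> by \<open>e x\<close>, and absorb \<open>x x^-1\<close>
  into \<open>x\<close>. Then \<open>x\<close> can be turned back into \<open>y\<close>.\<close>

lemma dom_le_cong:
  assumes e: "e \<approx> []" and xy: "e @ x \<sim> e @ y" and [simp]: "x \<in> words X" and y: "dom_le e y"
  shows "dom_le e x"
proof -
  have w [simp]: "e \<in> words X" "y \<in> words X" using eqv_words e y by (auto simp: dom_le_def)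
  have yy: "e @ y @ inv_word y \<sim> e" using y by (simp add: dom_le_def)
  have "e @ x @ inv_word x \<sim> e @ y @ inv_word y @ x @ inv_word x"
    using cong_context[OF cong_sym[OF yy], of "[]" "x @ inv_word x"] by simp
  also have "\<dots> \<sim> e @ x @ inv_word x @ y @ inv_word y"
    using cong_context[OF cong_commute[of y x], of e "[]"] by simp
  also have "\<dots> \<sim> x @ inv_word x @ e @ y @ inv_word y"
    using cong_context[OF commute_idem[OF e, of x], of "[]" "y @ inv_word y"] by simp
  also have "\<dots> \<sim> x @ inv_word x @ e @ x @ inv_word y"
    using cong_context[OF cong_sym[OF xy], of "x @ inv_word x" "inv_word y"] by simp
  also have "\<dots> \<sim> e @ x @ inv_word x @ x @ inv_word y"
    using cong_context[OF cong_sym[OF commute_idem[OF e, of x]], of "[]" "x @ inv_word y"] by simp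
  also have "\<dots> \<sim> e @ x @ inv_word y"
    using cong_context[OF cong_inverse[of x], of e "inv_word y"] by simp
  also have "\<dots> \<sim> e @ y @ inv_word y"
    using cong_context[OF xy, of "[]" "inv_word y"] by simp
  also note yy
  finally show ?thesis by (simp add: dom_le_def)
qed

text \<open>Here E-unitarity enters: \<open>e g\<close> and \<open>e h\<close> are equal in
  \<open>G\<close> and have the same domain, so \<open>cong_if_eqv\<close> makes them congruent.
  What can be read after \<open>h\<close> can thus be read after another word \<open>g\<close> for
  the same vertex.\<close>

lemma dom_le_step:
  assumes e: "e \<approx> []" and g: "dom_le e g" and h: "dom_le e h" and gh: "h \<approx> g"
    and hl: "dom_le e (h @ [l])"
  shows "dom_le e (g @ [l])"
proof -
  have w [simp]: "e \<in> words X" "g \<in> words X" "h \<in> words X" "fst l \<in> X"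
    using eqv_words e g h hl by (auto simp: dom_le_def)
  have ee: "(e @ x) @ inv_word (e @ x) \<sim> e @ inv_word e" if "dom_le e x" for x
    using that cong_context[of "e @ x @ inv_word x" e "[]" "inv_word e"] by (simp add: dom_le_def)
  have "e @ g \<sim> e @ h"
  proof (rule cong_if_eqv)
    show "e @ g \<approx> e @ h" using gh by (intro eqv_append) (auto intro: eqv_sym)
    show "(e @ g) @ inv_word (e @ g) \<sim> (e @ h) @ inv_word (e @ h)"
      using cong_trans[OF ee[OF g] cong_sym[OF ee[OF h]]] .
  qed
  then have "e @ g @ [l] \<sim> e @ h @ [l]" using cong_context[of "e @ g" "e @ h" "[]" "[l]"] by simp
  from dom_le_cong[OF e this _ hl] show ?thesis by simp
qed

lemma dom_le_prefix:
  assumes e: "e \<approx> []" and hs: "dom_le e (h @ s)"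
  shows "dom_le e h"
proof -
  have w [simp]: "e \<in> words X" "h \<in> words X" "s \<in> words X"
    using eqv_words e hs by (auto simp: dom_le_def)
  have a: "e @ h @ s @ inv_word s @ inv_word h \<sim> e" using hs by (simp add: dom_le_def)
  have "e @ h @ inv_word h \<sim> e @ (h @ s) @ inv_word (h @ s) @ h @ inv_word h"
    using cong_context[OF cong_sym[OF a], of "[]" "h @ inv_word h"] by simp
  also have "\<dots> \<sim> e @ h @ inv_word h @ (h @ s) @ inv_word (h @ s)"
    using cong_context[OF cong_commute[of "h @ s" h], of e "[]"] by simp
  also have "\<dots> \<sim> e @ h @ s @ inv_word s @ inv_word h"
    using cong_context[OF cong_inverse[of h], of e "s @ inv_word s @ inv_word h"] by simp
  also note a
  finally show ?thesis by (simp add: dom_le_def)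
qed

lemma dom_le_back:
  assumes e: "e \<approx> []" and h: "dom_le e (h @ [l])"
  shows "dom_le e (h @ [l] @ [apsnd Not l])"
proof -
  have w [simp]: "e \<in> words X" "h \<in> words X" "fst l \<in> X"
    using eqv_words e h by (auto simp: dom_le_def)
  have a: "e @ h @ [l, apsnd Not l] @ inv_word h \<sim> e" using h by (simp add: dom_le_def)
  have "e @ h @ [l] @ [apsnd Not l] @ [l] @ [apsnd Not l] @ inv_word h \<sim> e @ h @ [l] @ [apsnd Not l] @ inv_word h"
    using cong_context[OF cong_inverse[of "[l]"], of "e @ h" "[apsnd Not l] @ inv_word h"] by simp
  also have "\<dots> \<sim> e" using a by simp
  finally show ?thesis by (simp add: dom_le_def inv_word_Cons)
qed

section \<open>Right units and readable edges\<close>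

definition right_unit :: "'a word \<Rightarrow> bool" where
  "right_unit t \<longleftrightarrow> t \<in> words X \<and> t @ inv_word t \<sim> []"

lemma right_unit_append:
  assumes "right_unit s" "right_unit t"
  shows "right_unit (s @ t)"
proof -
  have w: "s \<in> words X" "t \<in> words X" using assms by (auto simp: right_unit_def)
  have "s @ t @ inv_word t @ inv_word s \<sim> s @ inv_word s"
    using cong_context[of "t @ inv_word t" "[]" s "inv_word s"] assms w by (simp add: right_unit_def)
  also have "\<dots> \<sim> []" using assms by (simp add: right_unit_def)
  finally show ?thesis using w by (simp add: right_unit_def)
qed

lemma right_unit_relator_prefix:
  assumes r: "r \<in> rs" and p: "prefix p r"
  shows "right_unit p"
proof -
  obtain s where s: "r = p @ s" using p by (auto simp: prefix_def)
  have w [simp]: "p \<in> words X" "s \<in> words X" using r rs_words s by auto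
  have ps: "p @ s \<sim> []" using cong_relator[OF r] s by simp
  have "p @ inv_word p \<sim> p @ inv_word p @ p @ s"
    using cong_context[OF cong_sym[OF ps], of "p @ inv_word p" "[]"] by simp
  also have "\<dots> \<sim> p @ s" using cong_context[OF cong_inverse[of p], of "[]" s] by simp
  also note ps
  finally show ?thesis by (simp add: right_unit_def)
qed

text \<open>Products of relator prefixes are right units in the quotient, but a word in
  \<open>P\<close> only equals such a product in \<open>G\<close>; so \<open>w\<close> has to be
  replaced by another word.\<close>

lemma P_right_unit:
  assumes "w \<in> P"
  obtains t where "right_unit t" "w \<approx> t"
proof -
  obtain ps where ps: "set ps \<subseteq> prefixes_of_relators" "w \<approx> concat ps"
    using assms unfolding P_def sub_def by blast
  have "right_unit (concat ps)"
    using ps(1)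
  proof (induction ps)
    case Nil
    then show ?case by (simp add: right_unit_def)
  next
    case (Cons p ps)
    then show ?case
      using right_unit_append right_unit_relator_prefix by (auto simp: prefixes_of_relators_def pref_def)
  qed
  then show ?thesis using that ps(2) by blast
qed

lemma dom_le_right_unit:
  assumes e: "e \<approx> []" and h: "dom_le e h" and t: "right_unit t"
  shows "dom_le e (h @ t)"
proof -
  have w [simp]: "e \<in> words X" "h \<in> words X" "t \<in> words X"
    using eqv_words e h t by (auto simp: dom_le_def right_unit_def)
  have "e @ h @ t @ inv_word t @ inv_word h \<sim> e @ h @ inv_word h"
    using cong_context[of "t @ inv_word t" "[]" "e @ h" "inv_word h"] t by (simp add: right_unit_def)
  also have "\<dots> \<sim> e" using h by (simp add: dom_le_def)
  finally show ?thesis by (simp add: dom_le_def)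
qed

text \<open>A loop attached at a point of \<open>q P\<close> is entered by reading
  \<open>q t\<close>, with \<open>t\<close> a right unit, and then a relator prefix; appending right
  units does not shrink the domain. This yields a word \<open>h\<close> for the vertex
  \<open>g\<close>, not \<open>g\<close> itself, as \<open>g\<close> may be spelled along another
  route.\<close>

lemma cov_dom_le:
  assumes e: "e \<approx> []" and w: "dom_le e w" and c: "cov w g l" and g: "g \<in> words X" and l: "fst l \<in> X"
  shows "\<exists>h. h \<approx> g \<and> dom_le e h \<and> dom_le e (h @ [l])"
proof -
  have pre: "dom_le e q" if "prefix q w" for q
    using that dom_le_prefix[OF e] w by (auto simp: prefix_def)
  have ww: "w \<in> words X" using w by (simp add: dom_le_def)
  note [simp] = g l
  consider (loop) q r p where "prefix q w" "r \<in> rs" "prefix (p @ [l]) r" "inv_word q @ g @ inv_word p \<in> P"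
    | (loop') q r p where "prefix q w" "r \<in> rs" "prefix (p @ [apsnd Not l]) r"
        "inv_word q @ g @ [l] @ inv_word p \<in> P"
    | (path) q where "prefix (q @ [l]) w" "g \<approx> q"
    | (path') q where "prefix (q @ [apsnd Not l]) w" "g \<approx> q @ [apsnd Not l]"
    using c unfolding cov_def loop_edge_def path_edge_def by blast
  then show ?thesis
  proof cases
    case loop
    obtain t where t: "right_unit t" "inv_word q @ g @ inv_word p \<approx> t" using P_right_unit[OF loop(4)] .
    have [simp]: "q \<in> words X" "p \<in> words X" "t \<in> words X"
      using P_words[OF loop(4)] eqv_words t(2) by auto
    have "g @ inv_word p \<approx> q @ t" using eqv_shift[of q t "g @ inv_word p"] t(2) by simp
    then have "g @ inv_word p @ p \<approx> q @ t @ p" using eqv_append[of "g @ inv_word p" "q @ t" p p] by simp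
    from eqv_trans[OF eqv_sym[OF this]] have "q @ t @ p \<approx> g" using eqv_cancel(2)[of g p "[]"] by simp
    moreover have "prefix p r" using loop(3) by (blast intro: prefix_order.trans prefixI)
    then have "dom_le e (q @ t @ p)"
      using dom_le_right_unit[OF e pre[OF loop(1)]] right_unit_append[OF t(1)]
        right_unit_relator_prefix[OF loop(2)] by blast
    moreover have "dom_le e ((q @ t @ p) @ [l])"
      using dom_le_right_unit[OF e pre[OF loop(1)] right_unit_append[OF t(1)
        right_unit_relator_prefix[OF loop(2,3)]]] by simp
    ultimately show ?thesis by blast
  next
    \<comment> \<open>The relator reads the edge in the direction opposite to \<open>l\<close>:
      \<open>h\<close> ends just after that edge, and \<open>dom_le_back\<close> reads it
      backwards.\<close>
    case loop'
    let ?l = "apsnd Not l"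
    obtain t where t: "right_unit t" "inv_word q @ g @ [l] @ inv_word p \<approx> t" using P_right_unit[OF loop'(4)] .
    have [simp]: "q \<in> words X" "p \<in> words X" "t \<in> words X"
      using P_words[OF loop'(4)] eqv_words t(2) by auto
    have "g @ [l] @ inv_word p \<approx> q @ t" using eqv_shift[of q t "g @ [l] @ inv_word p"] t(2) by simp
    then have "g @ inv_word (p @ [?l]) @ (p @ [?l]) \<approx> q @ t @ p @ [?l]"
      using eqv_append[of "g @ [l] @ inv_word p" "q @ t" "p @ [?l]" "p @ [?l]"] by simp
    from eqv_trans[OF eqv_sym[OF this]] have "q @ t @ p @ [?l] \<approx> g"
      using eqv_cancel(2)[of g "p @ [?l]" "[]"] by simp
    moreover have d: "dom_le e ((q @ t @ p) @ [?l])"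
      using dom_le_right_unit[OF e pre[OF loop'(1)] right_unit_append[OF t(1)
        right_unit_relator_prefix[OF loop'(2,3)]]] by simp
    moreover have "dom_le e ((q @ t @ p @ [?l]) @ [l])" using dom_le_back[OF e d] by simp
    ultimately show ?thesis by (intro exI[of _ "q @ t @ p @ [?l]"]) simp
  next
    case path
    then have "prefix q w" by (blast intro: prefix_order.trans prefixI)
    then show ?thesis using pre path eqv_sym by blast
  next
    case path'
    have "dom_le e (q @ [apsnd Not l])" using pre[OF path'(1)] .
    with dom_le_back[OF e this] show ?thesis using path'(2)
      by (intro exI[of _ "q @ [apsnd Not l]"]) (auto intro: eqv_sym)
  qed
qed

text \<open>Along the path of \<open>v\<close>, covering supplies at each vertex some word after
  which the next edge can be read, and \<open>dom_le_step\<close> transfers this to the prefix of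
  \<open>v\<close>.\<close>

lemma dom_le_if_edges_covered:
  assumes e: "e \<approx> []" and w: "dom_le e w" and c: "edges_covered v w" and v: "v \<in> words X"
  shows "dom_le e v"
proof -
  have "prefix p v \<Longrightarrow> dom_le e p" for p
  proof (induction p rule: rev_induct)
    case Nil
    then show ?case using eqv_words[OF e] by (simp add: dom_le_def)
  next
    case (snoc l p)
    have p: "dom_le e p" using snoc by (blast intro: prefix_order.trans prefixI)
    have pw: "p \<in> words X" "fst l \<in> X" using words_prefix[OF snoc.prems v] by auto
    have "cov w p l" using c snoc.prems unfolding edges_covered_def by blast
    then obtain h where "h \<approx> p" "dom_le e h" "dom_le e (h @ [l])" using cov_dom_le[OF e w _ pw] by blast
    then show ?case using dom_le_step[OF e p] by blast
  qed
  then show ?thesis by simp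
qed

text \<open>With \<open>e = a a^-1\<close>, covering makes each of the idempotents
  \<open>v v^-1\<close> and \<open>w w^-1\<close> lie below the other. So the domains agree, and
  words equal in \<open>G\<close> with equal domains are congruent.\<close>

lemma cong_if_edges_covered:
  assumes vw: "v \<approx> w" and c: "edges_covered v w" "edges_covered w v"
  shows "v \<sim> w"
proof (rule cong_if_eqv[OF vw])
  have w [simp]: "v \<in> words X" "w \<in> words X" using eqv_words[OF vw] by auto
  have le: "a @ inv_word a @ b @ inv_word b \<sim> a @ inv_word a"
    if "edges_covered b a" "a \<in> words X" "b \<in> words X" for a b
  proof -
    have "dom_le (a @ inv_word a) a"
      using cong_context[OF cong_inverse[OF that(2)], of "[]" "inv_word a"] that by (simp add: dom_le_def)
    then have "dom_le (a @ inv_word a) b"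
      using dom_le_if_edges_covered[OF eqv_right_inv[OF that(2)] _ that(1,3)] by simp
    then show ?thesis by (simp add: dom_le_def)
  qed
  have "v @ inv_word v \<sim> v @ inv_word v @ w @ inv_word w" using le[OF c(2)] cong_sym by simp
  also have "\<dots> \<sim> w @ inv_word w @ v @ inv_word v" by (rule cong_commute) auto
  also have "\<dots> \<sim> w @ inv_word w" using le[OF c(1)] by simp
  finally show "v @ inv_word v \<sim> w @ inv_word w" .
qed

end

context special_presentation
begin

text \<open>Forwards, \<open>EU_rel\<close> is one of the congruences in the intersection;
  backwards, covering suffices in each of them.\<close>

theorem EU_elem_eq_iff_edges_covered:
  assumes "v \<in> words X" "w \<in> words X"
  shows "EU_elem X (special rs) v = EU_elem X (special rs) w \<longleftrightarrow>
    v \<approx> w \<and> edges_covered v w \<and> edges_covered w v"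
proof
  assume "EU_elem X (special rs) v = EU_elem X (special rs) w"
  then have vw: "(v, w) \<in> EU_rel"
    unfolding EU_elem_eq_iff[OF assms] using mon_cong_EU_rel inv_cong_subset_EU_rel E_unitary_EU_rel by blast
  then have "(w, v) \<in> EU_rel" by (rule mon_congD(3)[OF mon_cong_EU_rel])
  with vw show "v \<approx> w \<and> edges_covered v w \<and> edges_covered w v"
    using EU_rel_imp_edges_covered by (auto simp: EU_rel_def)
next
  assume c: "v \<approx> w \<and> edges_covered v w \<and> edges_covered w v"
  have "(v, w) \<in> \<theta>" if "mon_cong (word_monoid X) \<theta>" "inv_cong X (special rs) \<subseteq> \<theta>"
    "E_unitary (quot_mon (word_monoid X) \<theta>)" for \<theta>
  proof -
    interpret E_unitary_quotient X rs \<theta> by unfold_locales (fact that)+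
    show ?thesis using cong_if_edges_covered c unfolding cong_eq_def by blast
  qed
  then show "EU_elem X (special rs) v = EU_elem X (special rs) w"
    unfolding EU_elem_eq_iff[OF assms] by blast
qed

subsection \<open>Unital factorisations\<close>

text \<open>If \<open>y\<close> is the inverse of the unit \<open>w\<close>, then
  \<open>w^-1 w = y w w^-1 w = y w = 1\<close>. Both signs are recorded because \<open>V\<close> may
  contain either.\<close>

lemma unit_right_inverse:
  assumes "inv_elem X (special rs) w \<in> Units (Inv X (special rs))" "w \<in> words X"
  shows "\<exists>w'. (w @ w', []) \<in> inv_cong X (special rs)" (is ?t1)
    and "\<exists>w'. (inv_word w @ w', []) \<in> inv_cong X (special rs)" (is ?t2)
proof -
  note i = mon_congD[OF mon_cong_inv_cong, simplified]
  have c: "carrier (Inv X (special rs)) = inv_elem X (special rs) ` words X"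
    by (auto simp: Inv_def inv_elem_def quot_simps)
  have m: "inv_elem X (special rs) a \<otimes>\<^bsub>Inv X (special rs)\<^esub> inv_elem X (special rs) b = inv_elem X (special rs) (a @ b)"
    if "a \<in> words X" "b \<in> words X" for a b
    using quot_mult[OF mon_cong_inv_cong monoid_word_monoid] that by (simp add: Inv_def inv_elem_def)
  have one: "\<one>\<^bsub>Inv X (special rs)\<^esub> = inv_elem X (special rs) []"
    by (simp add: Inv_def inv_elem_def quot_simps)
  have eq: "inv_elem X (special rs) a = inv_elem X (special rs) b \<longleftrightarrow> (a, b) \<in> inv_cong X (special rs)"
    if "a \<in> words X" "b \<in> words X" for a b
    unfolding inv_elem_def by (rule class_eq_iff[OF mon_cong_inv_cong]) (use that in auto)
  obtain y where y: "y \<in> words X" "(y @ w, []) \<in> inv_cong X (special rs)" "(w @ y, []) \<in> inv_cong X (special rs)"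
    using assms unfolding Units_def c by (auto simp: m one eq)
  then show ?t1 by blast
  have 1: "(w @ inv_word w @ w, w) \<in> inv_cong X (special rs)"
    unfolding inv_cong_def by (rule subsetD[OF subset_gen_cong]) (use assms(2) in blast)
  have 2: "((y @ w) @ inv_word w @ w, inv_word w @ w) \<in> inv_cong X (special rs)"
    using i(5)[OF y(2) i(2)[of "inv_word w @ w"]] assms(2) by simp
  have 3: "((y @ w) @ inv_word w @ w, y @ w) \<in> inv_cong X (special rs)"
    using i(5)[OF i(2)[OF y(1)] 1] by simp
  from i(4)[OF i(4)[OF i(3)[OF 2] 3] y(2)] show ?t2 by blast
qed

lemma prefix_concatE:
  assumes "prefix p (concat vs)"
  obtains "p = concat vs" | vs1 v vs2 p' where "vs = vs1 @ v # vs2" "p = concat vs1 @ p'" "prefix p' v"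
  using assms
proof (induction vs arbitrary: p thesis)
  case Nil
  then show ?case by simp
next
  case (Cons v vs)
  show ?case
  proof (cases "prefix p v")
    case True
    then show ?thesis using Cons.prems(2)[of "[]" v vs p] by simp
  next
    case False
    then obtain q where q: "p = v @ q" "prefix q (concat vs)" using Cons.prems(3) by (auto simp: prefix_append)
    show ?thesis
    proof (rule Cons.IH[OF _ _ q(2)])
      assume "q = concat vs"
      then show thesis using Cons.prems(1) q by simp
    next
      fix vs1 v' vs2 p' assume "vs = vs1 @ v' # vs2" "q = concat vs1 @ p'" "prefix p' v'"
      then show thesis using Cons.prems(2)[of "v # vs1" v' vs2 p'] q by simp
    qed
  qed
qed

end

section \<open>Normal forms for uniquely marked factors\<close>

text \<open>A normal form in the free product of the free group on the unmarked letters and the group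
  \<open>G\<close> of the presentation. It is stored in reverse, so that right multiplication acts at the
  head of the list. Mapping each factor \<open>u j\<close> to the syllable \<open>Gr (u j)\<close> determines the
  images of the marked letters, and yields an action of \<open>G\<close> on normal forms.\<close>

datatype 'a syllable = Lt "'a \<times> bool" | Gr "'a word set"

fun act_letter :: "'a \<times> bool \<Rightarrow> 'a syllable list \<Rightarrow> 'a syllable list" where
  "act_letter l (Lt l' # N) = (if l' = apsnd Not l then N else Lt l # Lt l' # N)"
| "act_letter l N = Lt l # N"

locale marked_presentation = special_presentation X rs
  for X :: "'a set" and rs :: "'a word set" +
  fixes J :: "nat set" and u a b :: "nat \<Rightarrow> 'a word" and x :: "nat \<Rightarrow> 'a" and s :: "nat \<Rightarrow> bool"
  assumes u_eq: "\<And>j. j \<in> J \<Longrightarrow> u j = a j @ [(x j, s j)] @ b j"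
    and x_in: "\<And>j. j \<in> J \<Longrightarrow> x j \<in> X"
    and inj_x: "inj_on x J"
    and a_words: "\<And>j. j \<in> J \<Longrightarrow> a j \<in> words (X - x ` J)"
    and b_words: "\<And>j. j \<in> J \<Longrightarrow> b j \<in> words (X - x ` J)"
    and rs_factors: "rs \<subseteq> free_star (signed (u ` J))"
begin

abbreviation "Z \<equiv> X - x ` J"
abbreviation "us \<equiv> u ` J"
abbreviation "G \<equiv> Gp X (special rs)"
abbreviation "ev \<equiv> gp_elem X (special rs)"

lemma group_G: "group G"
  unfolding Gp_def by (rule group_Gp_quot)

sublocale G: group G by (rule group_G)

lemma ev_carrier [simp]: "w \<in> words X \<Longrightarrow> ev w \<in> carrier G"
  by (auto simp: Gp_def gp_elem_def quot_simps)

lemma ev_Nil: "ev [] = \<one>\<^bsub>G\<^esub>"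
  by (simp add: Gp_def gp_elem_def quot_simps)

lemma ev_append: "v \<in> words X \<Longrightarrow> w \<in> words X \<Longrightarrow> ev (v @ w) = ev v \<otimes>\<^bsub>G\<^esub> ev w"
  using quot_mult[OF mon_cong_gp_cong monoid_word_monoid] by (simp add: Gp_def gp_elem_def)

lemma ev_one_iff: "w \<in> words X \<Longrightarrow> ev w = \<one>\<^bsub>G\<^esub> \<longleftrightarrow> w \<approx> []"
  using class_eq_iff_eqv[of w "[]"] by (simp add: ev_Nil)

lemma ev_inv_word:
  assumes "w \<in> words X"
  shows "ev (inv_word w) = inv\<^bsub>G\<^esub> ev w"
proof -
  have "ev (inv_word w) \<otimes>\<^bsub>G\<^esub> ev w = \<one>\<^bsub>G\<^esub>"
    using ev_append[of "inv_word w" w] ev_one_iff[of "inv_word w @ w"] eqv_left_inv assms by simp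
  then show ?thesis using assms G.inv_equality by simp
qed

lemma words_Z: "w \<in> words Z \<Longrightarrow> w \<in> words X"
  by (auto simp: mem_words_iff)

lemma u_words: "j \<in> J \<Longrightarrow> u j \<in> words X"
  using u_eq x_in a_words b_words words_Z by simp

lemma signed_words: "v \<in> signed us \<Longrightarrow> v \<in> words X"
  using u_words by (auto simp: signed_def)

fun act_group :: "'a word set \<Rightarrow> 'a syllable list \<Rightarrow> 'a syllable list" where
  "act_group g (Gr h # N) = (if h \<otimes>\<^bsub>G\<^esub> g = \<one>\<^bsub>G\<^esub> then N else Gr (h \<otimes>\<^bsub>G\<^esub> g) # N)"
| "act_group g N = (if g = \<one>\<^bsub>G\<^esub> then N else Gr g # N)"

fun valid :: "'a syllable list \<Rightarrow> bool" where
  "valid [] \<longleftrightarrow> True"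
| "valid (Lt l # N) \<longleftrightarrow> valid N \<and> (\<forall>N'. N \<noteq> Lt (apsnd Not l) # N')"
| "valid (Gr g # N) \<longleftrightarrow> valid N \<and> g \<in> carrier G \<and> g \<noteq> \<one>\<^bsub>G\<^esub> \<and> (\<forall>h N'. N \<noteq> Gr h # N')"

lemma valid_act_letter: "valid N \<Longrightarrow> valid (act_letter l N)"
  by (cases "(l, N)" rule: act_letter.cases) auto

lemma act_letter_inverse: "valid N \<Longrightarrow> act_letter (apsnd Not l) (act_letter l N) = N"
proof (cases "(l, N)" rule: act_letter.cases)
  case (1 l l' N')
  assume "valid N"
  with 1 show ?thesis
  proof (cases N')
    case (Cons y N'')
    then show ?thesis using 1 \<open>valid N\<close> by (cases y) auto
  qed auto
qed auto

lemma valid_act_group: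
  assumes "valid N" "g \<in> carrier G"
  shows "valid (act_group g N)"
  using assms by (cases "(g, N)" rule: act_group.cases) auto

lemma act_group_one: "valid N \<Longrightarrow> act_group \<one>\<^bsub>G\<^esub> N = N"
  by (cases "(\<one>\<^bsub>G\<^esub>, N)" rule: act_group.cases) auto

lemma act_group_mult:
  assumes N: "valid N" and g: "g \<in> carrier G" and h: "h \<in> carrier G"
  shows "act_group h (act_group g N) = act_group (g \<otimes>\<^bsub>G\<^esub> h) N"
proof (cases "\<exists>h' N'. N = Gr h' # N'")
  case True
  then obtain h' N' where [simp]: "N = Gr h' # N'" by blast
  have h': "h' \<in> carrier G" "h' \<noteq> \<one>\<^bsub>G\<^esub>" and N': "\<And>k M. N' \<noteq> Gr k # M" using N by auto
  have n: "act_group k N' = (if k = \<one>\<^bsub>G\<^esub> then N' else Gr k # N')" for k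
    using N' by (cases "(k, N')" rule: act_group.cases) auto
  have e: "h' \<otimes>\<^bsub>G\<^esub> (g \<otimes>\<^bsub>G\<^esub> h) = (h' \<otimes>\<^bsub>G\<^esub> g) \<otimes>\<^bsub>G\<^esub> h" using h' g h by (simp add: G.m_assoc)
  show ?thesis unfolding \<open>N = _\<close> act_group.simps e using h by (auto simp: n)
next
  case False
  then have n: "act_group k N = (if k = \<one>\<^bsub>G\<^esub> then N else Gr k # N)" for k
    by (cases "(k, N)" rule: act_group.cases) auto
  show ?thesis using g h by (auto simp: n)
qed

text \<open>From \<open>u = a x b\<close> the marked letter is \<open>a^-1 u b^-1\<close>, and its
  inverse is \<open>b u^-1 a\<close>; the action is on the right, so the leftmost factor is applied
  first. As \<open>a\<close> and \<open>b\<close> contain no marked letters,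
  \<open>act_letter\<close> suffices for them.\<close>

definition act1 :: "'a \<times> bool \<Rightarrow> 'a syllable list \<Rightarrow> 'a syllable list" where
  "act1 l N = (if fst l \<in> x ` J then
      let j = inv_into J x (fst l) in
        if snd l = s j then fold act_letter (inv_word (b j)) (act_group (ev (u j)) (fold act_letter (inv_word (a j)) N))
        else fold act_letter (a j) (act_group (ev (inv_word (u j))) (fold act_letter (b j) N))
    else act_letter l N)"

definition act :: "'a word \<Rightarrow> 'a syllable list \<Rightarrow> 'a syllable list" where
  "act w N = fold act1 w N"

lemma act_Nil [simp]: "act [] N = N"
  and act_append [simp]: "act (v @ w) N = act w (act v N)"
  by (simp_all add: act_def)

lemma act_Cons: "act (l # w) N = act w (act [l] N)"
  by (simp add: act_def)

lemma act_Z: "w \<in> words Z \<Longrightarrow> act w N = fold act_letter w N"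
  by (induction w arbitrary: N) (auto simp: act_def act1_def)

lemma valid_fold_act_letter: "valid N \<Longrightarrow> valid (fold act_letter w N)"
  by (induction w arbitrary: N) (auto intro: valid_act_letter)

text \<open>Brings \<open>u j\<close> and its inverse into one shape, so that later arguments need
  not distinguish the signs.\<close>

lemma factor_form:
  assumes "v \<in> signed us"
  obtains j c m d where "j \<in> J" "v = c @ [m] @ d" "fst m = x j" "c \<in> words Z" "d \<in> words Z"
    "(c = a j \<and> d = b j) \<or> (c = inv_word (b j) \<and> d = inv_word (a j))"
    "\<And>N. act [m] N = act (inv_word d) (act_group (ev v) (act (inv_word c) N))"
proof -
  obtain j where j: "j \<in> J" "v = u j \<or> v = inv_word (u j)" using assms by (auto simp: signed_def)
  have i: "inv_into J x (x j) = j" using j inj_x by simp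
  note w = a_words[OF j(1)] b_words[OF j(1)]
  show ?thesis using j(2)
  proof
    assume v: "v = u j"
    have "act [(x j, s j)] N = fold act_letter (inv_word (b j))
        (act_group (ev (u j)) (fold act_letter (inv_word (a j)) N))" for N
      by (simp add: act_def act1_def i j(1))
    then have "act [(x j, s j)] N = act (inv_word (b j)) (act_group (ev v) (act (inv_word (a j)) N))" for N
      using w v by (simp add: act_Z)
    then show ?thesis using that[of j "a j" "(x j, s j)" "b j"] j(1) v w u_eq[OF j(1)] by simp
  next
    assume v: "v = inv_word (u j)"
    have "act [(x j, \<not> s j)] N = fold act_letter (a j)
        (act_group (ev (inv_word (u j))) (fold act_letter (b j) N))" for N
      by (simp add: act_def act1_def i j(1))
    then have "act [(x j, \<not> s j)] N = act (inv_word (inv_word (a j)))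
        (act_group (ev v) (act (inv_word (inv_word (b j))) N))" for N
      using w v by (simp add: act_Z)
    moreover have "v = inv_word (b j) @ [(x j, \<not> s j)] @ inv_word (a j)"
      unfolding v u_eq[OF j(1)] by (simp add: inv_word_Cons)
    ultimately show ?thesis
      using that[of j "inv_word (b j)" "(x j, \<not> s j)" "inv_word (a j)"] j(1) w by simp
  qed
qed

lemma letter_cases:
  assumes "fst l \<in> X"
  obtains (unmarked) "fst l \<in> Z"
    | (marked) v c d where "v \<in> signed us" "v = c @ [l] @ d" "c \<in> words Z" "d \<in> words Z"
        "\<And>N. act [l] N = act (inv_word d) (act_group (ev v) (act (inv_word c) N))"
proof (cases "fst l \<in> x ` J")
  case True
  then obtain j where j: "j \<in> J" "fst l = x j" by blast
  define v where "v = (if snd l = s j then u j else inv_word (u j))"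
  have v: "v \<in> signed us" using j by (auto simp: v_def signed_def)
  obtain j' c m d where f: "j' \<in> J" "v = c @ [m] @ d" "fst m = x j'" "c \<in> words Z" "d \<in> words Z"
    "\<And>N. act [m] N = act (inv_word d) (act_group (ev v) (act (inv_word c) N))"
    using factor_form[OF v] by metis
  have Z: "l' \<in> set c \<union> set d \<Longrightarrow> fst l' \<notin> x ` J" for l' using f(4,5) by (auto simp: mem_words_iff)
  have "l \<in> set v" using j u_eq[OF j(1)] by (cases l) (auto simp: v_def inv_word_def)
  then have "l = m" using f(2) Z[of l] True by auto
  then show ?thesis using marked[OF v] f by blast
next
  case False
  then show ?thesis using unmarked assms by blast
qed

lemma valid_act:
  assumes "valid N" "w \<in> words X"
  shows "valid (act w N)"
  using assms
proof (induction w arbitrary: N)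
  case (Cons l w)
  have "fst l \<in> X" using Cons by simp
  then have "valid (act [l] N)"
  proof (cases rule: letter_cases)
    case unmarked
    then show ?thesis using Cons valid_act_letter by (auto simp: act_def act1_def)
  next
    case (marked v c d)
    then show ?thesis using Cons signed_words[OF marked(1)]
      by (auto simp: act_Z intro!: valid_fold_act_letter valid_act_group)
  qed
  then show ?case using Cons unfolding act_Cons[of l w] by simp
qed simp

lemma act_Z_inverse:
  assumes "valid N" "w \<in> words Z"
  shows "act (inv_word w) (act w N) = N" "act w (act (inv_word w) N) = N"
proof -
  have *: "fold act_letter (inv_word w) (fold act_letter w N) = N" if "valid N" for w N
    using that by (induction w arbitrary: N) (auto simp: inv_word_Cons valid_act_letter act_letter_inverse)
  show "act (inv_word w) (act w N) = N" "act w (act (inv_word w) N) = N"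
    using *[of N w] *[of N "inv_word w"] assms by (simp_all add: act_Z)
qed

text \<open>The outer words \<open>c\<close> and \<open>d\<close> cancel against the
  \<open>c^-1\<close> and \<open>d^-1\<close> in the action of the marked letter.\<close>

lemma act_factor:
  assumes v: "v \<in> signed us" and N: "valid N"
  shows "act v N = act_group (ev v) N"
proof -
  obtain j c m d where f: "v = c @ [m] @ d" "c \<in> words Z" "d \<in> words Z"
    "\<And>N. act [m] N = act (inv_word d) (act_group (ev v) (act (inv_word c) N))"
    using factor_form[OF v] by metis
  have vw: "ev v \<in> carrier G" using signed_words[OF v] by simp
  have "act v N = act d (act [m] (act c N))" unfolding f(1) by (simp only: act_append)
  also have "\<dots> = act d (act (inv_word d) (act_group (ev v) (act (inv_word c) (act c N))))"
    unfolding f(4) ..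
  also have "\<dots> = act_group (ev v) N"
    using act_Z_inverse(1)[OF N f(2)] act_Z_inverse(2)[OF valid_act_group[OF N vw] f(3)] by simp
  finally show ?thesis .
qed

lemma act_factors:
  assumes "set vs \<subseteq> signed us" "valid N"
  shows "act (concat vs) N = act_group (ev (concat vs)) N"
  using assms
proof (induction vs arbitrary: N)
  case Nil
  then show ?case by (simp add: ev_Nil act_group_one)
next
  case (Cons v vs)
  have w: "v \<in> words X" "concat vs \<in> words X" using Cons.prems signed_words by (auto simp: words_concat)
  then have "valid (act_group (ev v) N)" using Cons.prems valid_act_group by simp
  then show ?case using Cons w act_factor[of v N] by (simp add: act_group_mult ev_append)
qed

lemma act_inverse:
  assumes "valid N" "w \<in> words X"
  shows "act (inv_word w) (act w N) = N"
  using assms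
proof (induction w arbitrary: N)
  case (Cons l w)
  have l: "fst l \<in> X" using Cons by simp
  have "act [apsnd Not l] (act [l] N) = N"
    using l
  proof (cases rule: letter_cases)
    case unmarked
    then show ?thesis using act_Z_inverse(1)[of N "[l]"] Cons by simp
  next
    case (marked v c d)
    let ?v = "inv_word v"
    have v': "?v \<in> signed us" using marked(1) by (auto simp: signed_def)
    have c: "valid (act (inv_word c) N)" "valid (act c N')" "valid (act (inv_word d) N')" "valid (act d N')" if "valid N'" for N'
      using valid_act that Cons.prems marked words_Z by auto
    have vw: "v \<in> words X" using signed_words[OF marked(1)] .
    \<comment> \<open>The action of the inverse letter is found by solving
      \<open>act_factor\<close>, applied to \<open>v^-1\<close>, for its middle letter.\<close>
    have e: "act [apsnd Not l] M = act c (act_group (ev ?v) (act d M))" if M: "valid M" for M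
    proof -
      have "act ?v (act d M) = act (inv_word c) (act [apsnd Not l] (act (inv_word d) (act d M)))"
        unfolding marked(2) by (simp only: act_append inv_word_append inv_word_single append_assoc)
      then have "act_group (ev ?v) (act d M) = act (inv_word c) (act [apsnd Not l] M)"
        using act_factor[OF v' c(4)[OF M]] act_Z_inverse(1)[OF M marked(4)] by simp
      moreover have "valid (act [apsnd Not l] M)" using valid_act[OF M] l by simp
      ultimately show ?thesis using act_Z_inverse(2)[OF _ marked(3)] by simp
    qed
    have "act_group (ev ?v) (act_group (ev v) M) = M" if "valid M" for M
      using act_group_mult[OF that] vw ev_inv_word act_group_one[OF that] by simp
    moreover have "valid (act [l] N)" using valid_act Cons.prems by simp
    moreover have "valid (act_group (ev v) (act (inv_word c) N))"
      using valid_act_group c(1)[OF Cons.prems(1)] vw by simp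
    ultimately show ?thesis
      using e act_Z_inverse(2)[OF _ marked(4)] act_Z_inverse(2)[OF Cons.prems(1) marked(3)]
        c(1)[OF Cons.prems(1)] marked(5) by simp
  qed
  moreover have "valid (act [l] N)" using valid_act Cons.prems by simp
  ultimately show ?case using Cons unfolding act_Cons[of l w] inv_word_Cons by simp
qed simp

text \<open>The pairs of words with equal action form a congruence. It contains the relations: a
  relator is a product of signed factors, hence acts as multiplication by its value in
  \<open>G\<close>, which is 1.\<close>

lemma act_eqv:
  assumes "v \<approx> w" "valid N"
  shows "act v N = act w N"
proof -
  let ?T = "{(v, w). v \<in> words X \<and> w \<in> words X \<and> (\<forall>N. valid N \<longrightarrow> act v N = act w N)}"
  have T: "mon_cong (word_monoid X) ?T"
    by (rule mon_congI) (auto simp: valid_act)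
  have "gp_cong X (special rs) \<subseteq> ?T"
    unfolding gp_cong_def
  proof (rule gen_cong_least[OF T], intro Un_least subsetI)
    fix p assume "p \<in> special rs"
    then obtain r where r: "r \<in> rs" "p = (r, [])" by (auto simp: special_def)
    then have "r \<in> concat ` lists (signed us)" using rs_factors by (auto simp: free_star_def)
    then obtain vs where "vs \<in> lists (signed us)" and vs2: "r = concat vs" by blast
    then have vs: "set vs \<subseteq> signed us" "r = concat vs" by (auto simp: in_lists_conv_set)
    have "ev r = \<one>\<^bsub>G\<^esub>" using eqv_relator[OF r(1)] ev_one_iff rs_words r by auto
    then have "act r N = N" if "valid N" for N
      using act_factors[OF vs(1) that] act_group_one[OF that] vs(2) by simp
    then show "p \<in> ?T" using r rs_words by auto
  next
    fix p :: "'a word \<times> 'a word" assume "p \<in> {(w @ inv_word w, []) |w. w \<in> words X}"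
    then show "p \<in> ?T" using act_inverse by auto
  qed
  then show ?thesis using assms unfolding eqv_def by blast
qed

subsection \<open>The automaton\<close>

text \<open>Every element of the prefix monoid is a product of factors, their inverses, and elements of the
  finite prefix-closed set \<open>states\<close> of words over the unmarked letters. The automaton
  reads such a product by moving through \<open>states\<close>; the relation \<open>eps\<close> adds silent moves so
  that the language becomes closed under free reduction.\<close>

definition states :: "'a word set" where
  "states = {[]} \<union> (\<Union>j\<in>J. pref (a j) \<union> pref (inv_word (b j)))"

text \<open>The intended invariant is that \<open>t q^-1\<close> lies in the prefix monoid.
  \<open>eps_root\<close> rests on all states lying there. \<open>eps_cancel\<close> is the
  saturation step: reading \<open>z\<close>, moving silently, then reading \<open>z^-1\<close>
  becomes one silent move.\<close>

inductive eps :: "'a word \<Rightarrow> 'a word \<Rightarrow> bool" where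
  eps_refl: "t \<in> states \<Longrightarrow> eps t t"
| eps_trans: "eps t q \<Longrightarrow> eps q p \<Longrightarrow> eps t p"
| eps_root: "t \<in> states \<Longrightarrow> eps t []"
| eps_cancel: "t @ [z] \<in> states \<Longrightarrow> eps (t @ [z]) q \<Longrightarrow> q @ [apsnd Not z] \<in> states \<Longrightarrow>
    eps t (q @ [apsnd Not z])"

text \<open>The subset of states reached from the root on a normal form. The element
  \<open>h\<close> of a group syllable is not inspected, only that the root is reached before
  it.\<close>

fun reach :: "'a syllable list \<Rightarrow> 'a word set" where
  "reach [] = {q. eps [] q}"
| "reach (Lt z # N) = {q. \<exists>p\<in>reach N. p @ [z] \<in> states \<and> eps (p @ [z]) q}"
| "reach (Gr h # N) = {q. [] \<in> reach N \<and> eps [] q}"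

definition step :: "'a word set \<Rightarrow> 'a word \<Rightarrow> 'a word set" where
  "step S c = (if c \<in> signed us then {q. [] \<in> S \<and> eps [] q}
    else {q. \<exists>p\<in>S. p @ c \<in> states \<and> eps (p @ c) q})"

definition alphabet :: "'a word set" where
  "alphabet = (\<lambda>l. [l]) ` (Z \<times> UNIV) \<union> signed us"

text \<open>Weaker than being a normal form, as neighbouring factors are not merged. This is what
  minimality of the code yields, and it suffices because the automaton reads a block of factors like
  a single group syllable.\<close>

definition irreducible_word :: "'a word list \<Rightarrow> bool" where
  "irreducible_word cs \<longleftrightarrow> (\<forall>xs ys zs. cs = xs @ ys @ zs \<longrightarrow> concat ys \<approx> [] \<longrightarrow> ys = [])"

lemma states_Nil [simp]: "[] \<in> states"
  by (simp add: states_def)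

lemma states_prefix: "q \<in> states \<Longrightarrow> prefix p q \<Longrightarrow> p \<in> states"
  unfolding states_def pref_def using prefix_order.trans by auto

lemma states_words: "q \<in> states \<Longrightarrow> q \<in> words Z"
  using words_prefix[OF _ a_words] words_prefix[of _ "inv_word (b j)" for j] b_words
  by (auto simp: states_def pref_def)

lemma eps_states: "eps p q \<Longrightarrow> p \<in> states \<and> q \<in> states"
  by (induction rule: eps.induct) (auto intro: states_prefix)

section \<open>Completeness: the prefix monoid is accepted\<close>

lemma reach_eps: "p \<in> reach N \<Longrightarrow> eps p q \<Longrightarrow> q \<in> reach N"
  by (cases N rule: reach.cases) (auto intro: eps_trans)

text \<open>If \<open>z\<close> cancels the last letter of the normal form,
  \<open>eps_cancel\<close> replaces the two readings by a silent move; otherwise the letter is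
  simply read.\<close>

lemma reach_act_letter:
  assumes q: "q \<in> reach N" and qz: "q @ [z] \<in> states"
  shows "q @ [z] \<in> reach (act_letter z N)"
proof (cases "\<exists>N'. N = Lt (apsnd Not z) # N'")
  case True
  then obtain N' where N: "N = Lt (apsnd Not z) # N'" by blast
  then obtain p where p: "p \<in> reach N'" "p @ [apsnd Not z] \<in> states" "eps (p @ [apsnd Not z]) q"
    using q by auto
  have "eps p (q @ [z])" using eps_cancel[OF p(2,3)] qz by simp
  then show ?thesis using N reach_eps[OF p(1)] by simp
next
  case False
  then have "act_letter z N = Lt z # N" by (cases "(z, N)" rule: act_letter.cases) auto
  then show ?thesis using q qz eps_refl by auto
qed

text \<open>A group syllable may be created, merged or deleted: the root is reached before a
  syllable whenever it is reached after it, and conversely.\<close>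

lemma reach_act_group:
  assumes "[] \<in> reach N"
  shows "[] \<in> reach (act_group g N)"
proof -
  have "eps [] []" by (rule eps_refl) simp
  then show ?thesis using assms by (cases "(g, N)" rule: act_group.cases) auto
qed

text \<open>The automaton climbs the tree of states along \<open>q\<close> and returns by
  \<open>eps_root\<close>.\<close>

lemma reach_act_states:
  assumes N: "[] \<in> reach N" and q: "q \<in> states"
  shows "[] \<in> reach (act q N)"
proof -
  have "q \<in> reach (fold act_letter q N)"
    using q
  proof (induction q rule: rev_induct)
    case Nil
    then show ?case using N by simp
  next
    case (snoc z q)
    then show ?case using reach_act_letter[of q _ z] states_prefix[of "q @ [z]" q] by simp
  qed
  then show ?thesis using reach_eps[OF _ eps_root[OF q]] act_Z[OF states_words[OF q]] by simp
qed

text \<open>A prefix that stops before the marked letter is a state. One that passes it is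
  \<open>v\<close> times \<open>d2^-1\<close>, where \<open>d2\<close> is the missing end of
  \<open>v\<close>, and \<open>d2^-1\<close> is again a state.\<close>

lemma reach_act_prefix:
  assumes v: "v \<in> signed us" and p: "prefix p v" and N: "valid N" "[] \<in> reach N"
  shows "[] \<in> reach (act p N)"
proof -
  obtain j c m d where f: "j \<in> J" "v = c @ [m] @ d" "c \<in> words Z" "d \<in> words Z"
    "(c = a j \<and> d = b j) \<or> (c = inv_word (b j) \<and> d = inv_word (a j))"
    "\<And>N. act [m] N = act (inv_word d) (act_group (ev v) (act (inv_word c) N))"
    using factor_form[OF v] by metis
  have cd: "pref c \<subseteq> states" "pref (inv_word d) \<subseteq> states"
    using f(1,5) unfolding states_def by auto
  have vw: "ev v \<in> carrier G" using signed_words[OF v] by simp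
  show ?thesis
  proof (cases "prefix p c")
    case True
    then show ?thesis using reach_act_states[OF N(2)] cd by (auto simp: pref_def)
  next
    case False
    then obtain us where us: "p = c @ us" "prefix us (m # d)"
      using p unfolding f(2) by (auto simp: prefix_append)
    then obtain d1 where "us = m # d1" "prefix d1 d" using False by (cases us) auto
    then obtain d2 where 2: "p = c @ [m] @ d1" "d = d1 @ d2" using us(1) by (auto simp: prefix_def)
    let ?N = "act_group (ev v) N"
    have N': "valid ?N" by (rule valid_act_group[OF N(1) vw])
    have d: "d1 \<in> words Z" "d2 \<in> words Z" using f(4) 2(2) by auto
    have "act p N = act d1 (act (inv_word d) (act_group (ev v) (act (inv_word c) (act c N))))"
      unfolding 2(1) by (simp only: act_append f(6))
    also have "\<dots> = act d1 (act (inv_word d1) (act (inv_word d2) ?N))"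
      using act_Z_inverse(1)[OF N(1) f(3)] 2(2) by simp
    also have "\<dots> = act (inv_word d2) ?N"
      using act_Z_inverse(2)[OF valid_act[OF N'] d(1)] d words_Z by simp
    finally have "act p N = act (inv_word d2) ?N" .
    moreover have "inv_word d2 \<in> states" using cd(2) 2(2) by (auto simp: pref_def)
    ultimately show ?thesis using reach_act_states reach_act_group N(2) by simp
  qed
qed

lemma reach_act_sub:
  assumes w: "w \<in> sub (\<Union>v\<in>V. pref v)" and V: "V \<subseteq> signed us"
  shows "[] \<in> reach (act w [])"
proof -
  obtain ps where ps: "set ps \<subseteq> (\<Union>v\<in>V. pref v)" "w \<approx> concat ps" using w unfolding sub_def by blast
  have "[] \<in> reach (act (concat ps) N)" if "valid N" "[] \<in> reach N" for N
    using ps(1) that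
  proof (induction ps arbitrary: N)
    case (Cons p ps)
    then obtain v where v: "v \<in> signed us" "prefix p v" using V by (auto simp: pref_def)
    have "valid (act p N)" using valid_act[OF Cons.prems(2)] words_prefix[OF v(2) signed_words[OF v(1)]] .
    moreover have "[] \<in> reach (act p N)" using reach_act_prefix[OF v Cons.prems(2,3)] .
    ultimately show ?case using Cons.IH Cons.prems(1) by simp
  qed simp
  from this[of "[]"] have "[] \<in> reach (act (concat ps) [])" by (simp add: eps_refl)
  then show ?thesis using act_eqv[OF ps(2), of "[]"] by simp
qed

lemma alphabet_words: "c \<in> alphabet \<Longrightarrow> c \<in> words X"
  using signed_words by (auto simp: alphabet_def)

text \<open>The second conjunct strengthens the induction: it traces the last syllable of the normal
  form to a suffix of \<open>cs\<close>. A cancelling letter or a syllable product equal to 1 would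
  give a nonempty suffix with value 1, so on irreducible words nothing is ever deleted.\<close>

lemma run_irreducible_word:
  assumes "irreducible_word cs" "set cs \<subseteq> alphabet"
  shows "foldl step {q. eps [] q} cs = reach (act (concat cs) []) \<and>
    (case act (concat cs) [] of [] \<Rightarrow> True
      | Lt l # N \<Rightarrow> \<exists>cs'. cs = cs' @ [[l]]
      | Gr h # N \<Rightarrow> \<exists>cs' ys. cs = cs' @ ys \<and> set ys \<subseteq> signed us \<and> h = ev (concat ys))"
  using assms
proof (induction cs rule: rev_induct)
  case (snoc c cs)
  let ?N = "act (concat cs) []"
  have "irreducible_word cs"
    unfolding irreducible_word_def
  proof (intro allI impI)
    fix xs ys zs assume "cs = xs @ ys @ zs" "concat ys \<approx> []"
    then show "ys = []" using snoc.prems(1)[unfolded irreducible_word_def, rule_format, of xs ys "zs @ [c]"] by simp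
  qed
  then have IH: "foldl step {q. eps [] q} cs = reach ?N"
    "case ?N of [] \<Rightarrow> True | Lt l # N \<Rightarrow> \<exists>cs'. cs = cs' @ [[l]]
      | Gr h # N \<Rightarrow> \<exists>cs' ys. cs = cs' @ ys \<and> set ys \<subseteq> signed us \<and> h = ev (concat ys)"
    using snoc by auto
  have cs: "concat cs \<in> words X" "c \<in> words X" using snoc.prems alphabet_words by (auto simp: words_concat)
  have N: "valid ?N" using valid_act cs by simp
  have suffix: "\<not> concat ys \<approx> []" if "cs @ [c] = xs @ ys" "ys \<noteq> []" for xs ys
    using snoc.prems(1)[unfolded irreducible_word_def, rule_format, of xs ys "[]"] that by auto
  have run: "foldl step {q. eps [] q} (cs @ [c]) = step (reach ?N) c" using IH(1) by simp
  have act: "act (concat (cs @ [c])) [] = act c ?N" by simp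
  show ?case
  proof (cases "c \<in> signed us")
    case False
    then obtain l where l: "c = [l]" "fst l \<in> Z" using snoc.prems(2) by (auto simp: alphabet_def)
    have "?N \<noteq> Lt (apsnd Not l) # N'" for N'
    proof
      assume "?N = Lt (apsnd Not l) # N'"
      then obtain cs' where "cs = cs' @ [[apsnd Not l]]" using IH(2) by auto
      then have "\<not> [apsnd Not l] @ [l] \<approx> []" using suffix[of cs' "[[apsnd Not l], [l]]"] l by simp
      then show False using eqv_left_inv[of "[l]"] l by simp
    qed
    then have "act_letter l ?N = Lt l # ?N" by (cases "(l, ?N)" rule: act_letter.cases) auto
    then have "act c ?N = Lt l # ?N" using act_Z[of "[l]"] l by simp
    then show ?thesis unfolding run act using False l by (simp add: step_def)
  next
    case True
    have ac: "act c ?N = act_group (ev c) ?N" by (rule act_factor[OF True N])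
    have e: "eps [] []" by (rule eps_refl) simp
    show ?thesis
    proof (cases "\<exists>h N'. ?N = Gr h # N'")
      case Gr: True
      then obtain h N' where h: "?N = Gr h # N'" by blast
      then obtain cs' ys where ys: "cs = cs' @ ys" "set ys \<subseteq> signed us" "h = ev (concat ys)" using IH(2) by auto
      have w: "concat ys \<in> words X" using ys(2) signed_words by (auto simp: words_concat)
      have hc: "h \<otimes>\<^bsub>G\<^esub> ev c = ev (concat (ys @ [c]))" using ys(3) w cs(2) by (simp add: ev_append)
      have "\<not> concat (ys @ [c]) \<approx> []" using suffix[of cs' "ys @ [c]"] ys(1) by simp
      then have "h \<otimes>\<^bsub>G\<^esub> ev c \<noteq> \<one>\<^bsub>G\<^esub>" unfolding hc using ev_one_iff w cs(2) by simp
      then have "act c ?N = Gr (ev (concat (ys @ [c]))) # N'" using ac h hc by simp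
      \<comment> \<open>The syllable grows but the set of states does not change, since
        \<open>eps [] []\<close> keeps the root reachable between consecutive factors.\<close>
      moreover have "step (reach ?N) c = reach (Gr k # N')" for k using True e by (simp add: step_def h)
      moreover have "\<exists>cs'' ys'. cs @ [c] = cs'' @ ys' \<and> set ys' \<subseteq> signed us \<and> ev (concat (ys @ [c])) = ev (concat ys')"
        by (rule exI[of _ cs'], rule exI[of _ "ys @ [c]"]) (use ys True in simp)
      ultimately show ?thesis unfolding run act by (simp only: list.case syllable.case simp_thms)
    next
      case False
      have "\<not> c \<approx> []" using suffix[of cs "[c]"] by simp
      then have "ev c \<noteq> \<one>\<^bsub>G\<^esub>" using ev_one_iff cs(2) by simp
      then have "act c ?N = Gr (ev c) # ?N"
        unfolding ac using False by (cases "(ev c, ?N)" rule: act_group.cases) auto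
      moreover have "step (reach ?N) c = reach (Gr k # ?N)" for k using True by (simp add: step_def)
      moreover have "\<exists>cs'' ys'. cs @ [c] = cs'' @ ys' \<and> set ys' \<subseteq> signed us \<and> ev c = ev (concat ys')"
        by (rule exI[of _ cs], rule exI[of _ "[c]"]) (use True in simp)
      ultimately show ?thesis unfolding run act by (simp only: list.case syllable.case simp_thms)
    qed
  qed
qed simp

text \<open>A marked letter \<open>l\<close> with \<open>v = c l d\<close> is rewritten as
  \<open>c^-1 v d^-1\<close>.\<close>

lemma ex_alphabet_word:
  assumes "w \<in> words X"
  shows "\<exists>cs. set cs \<subseteq> alphabet \<and> concat cs \<approx> w"
  using assms
proof (induction w)
  case Nil
  then show ?case by (intro exI[of _ "[]"]) simp
next
  case (Cons l w)
  then obtain cs where cs: "set cs \<subseteq> alphabet" "concat cs \<approx> w" by auto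
  have Zl: "set (map (\<lambda>l. [l]) v) \<subseteq> alphabet" if "v \<in> words Z" for v
    using that by (auto simp: alphabet_def mem_words_iff image_iff)
  have "\<exists>ds. set ds \<subseteq> alphabet \<and> concat ds \<approx> [l]"
  proof -
    have "fst l \<in> X" using Cons.prems by simp
    then show ?thesis
    proof (cases rule: letter_cases)
      case unmarked
      then show ?thesis using Zl[of "[l]"] by (intro exI[of _ "[[l]]"]) auto
    next
      case (marked v c d)
      let ?ds = "map (\<lambda>l. [l]) (inv_word c) @ [v] @ map (\<lambda>l. [l]) (inv_word d)"
      have w: "c \<in> words X" "d \<in> words X" "fst l \<in> X" using marked words_Z Cons.prems by auto
      have "set ?ds \<subseteq> alphabet" using marked Zl[of "inv_word c"] Zl[of "inv_word d"] by (auto simp: alphabet_def)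
      moreover have "concat ?ds = inv_word c @ c @ ([l] @ d @ inv_word d)" using marked(2) by simp
      moreover have "inv_word c @ c @ ([l] @ d @ inv_word d) \<approx> [l] @ d @ inv_word d"
        using eqv_cancel_left(2)[of c "[l] @ d @ inv_word d"] w by simp
      moreover have "[l] @ d @ inv_word d \<approx> [l]" using eqv_cancel(1)[of "[l]" d "[]"] w by simp
      ultimately show ?thesis using eqv_trans by metis
    qed
  qed
  then obtain ds where ds: "set ds \<subseteq> alphabet" "concat ds \<approx> [l]" by blast
  then show ?case using cs eqv_append[OF ds(2) cs(2)] by (intro exI[of _ "ds @ cs"]) simp
qed

end

section \<open>Soundness: accepted words lie in the prefix monoid\<close>

locale conservative_presentation = marked_presentation X rs J u a b x s
  for X :: "'a set" and rs J u a b x s +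
  fixes V :: "'a word set"
  assumes V: "V \<subseteq> signed us"
    and P_eq: "P = sub (\<Union>v\<in>V. pref v)"
    and u_V: "\<And>j. j \<in> J \<Longrightarrow> u j \<in> V \<or> inv_word (u j) \<in> V"
    and inv_V: "\<And>v. v \<in> V \<Longrightarrow> inv_word v \<in> P"
begin

lemma V_P:
  assumes "v \<in> V" "prefix p v"
  shows "p \<in> P"
proof -
  have "p \<in> words X" using words_prefix[OF assms(2)] signed_words V assms(1) by blast
  then show ?thesis unfolding P_eq using assms by (intro sub_base) (auto simp: pref_def)
qed

lemma signed_P: "v \<in> signed us \<Longrightarrow> v \<in> P"
  using u_V inv_V V_P by (fastforce simp: signed_def)

text \<open>Let \<open>v = c m d\<close> be in \<open>V\<close>. A prefix of \<open>c\<close> is a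
  prefix of \<open>v\<close>. If \<open>d^-1 = p' e\<close>, then \<open>p'\<close> equals
  \<open>v^-1\<close> times the prefix \<open>c m e^-1\<close> of \<open>v\<close>, and both lie in
  \<open>P\<close>.\<close>

lemma states_P:
  assumes "q \<in> states"
  shows "q \<in> P"
proof -
  have key: "p \<in> P" "p' \<in> P"
    if v: "v \<in> V" "v = c @ [m] @ d" and p: "prefix p c" and p': "prefix p' (inv_word d)" for v c m d p p'
  proof -
    show "p \<in> P" using V_P[OF v(1)] p v(2) by (simp add: prefix_prefix)
    obtain e where e: "inv_word d = p' @ e" using p' by (auto simp: prefix_def)
    then have d: "d = inv_word e @ inv_word p'" by (metis inv_word_append inv_word_inv_word)
    have vw: "v \<in> words X" using v V signed_words by blast
    have "c @ [m] @ inv_word e \<in> P" by (rule V_P[OF v(1)]) (use v(2) d in simp)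
    with inv_V[OF v(1)] have "inv_word v @ (c @ [m] @ inv_word e) \<in> P" by (rule P_append)
    moreover have "inv_word v @ (c @ [m] @ inv_word e) = p' @ inv_word (c @ [m] @ inv_word e) @ (c @ [m] @ inv_word e) @ []"
      using v(2) d by (simp add: inv_word_Cons)
    ultimately show "p' \<in> P" using P_cancel[of p' "c @ [m] @ inv_word e" "[]"] by simp
  qed
  show ?thesis
  proof (cases "q = []")
    case False
    then obtain j where j: "j \<in> J" "prefix q (a j) \<or> prefix q (inv_word (b j))"
      using assms by (auto simp: states_def pref_def)
    from u_V[OF j(1)] show ?thesis
    proof
      assume "u j \<in> V"
      from key[OF this u_eq[OF j(1)]] j(2) show ?thesis by blast
    next
      assume v: "inv_word (u j) \<in> V"
      have "inv_word (u j) = inv_word (b j) @ [(x j, \<not> s j)] @ inv_word (a j)"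
        using u_eq[OF j(1)] by (simp add: inv_word_Cons)
      from key[OF v this] j(2) show ?thesis by (auto intro: Nil_prefix)
    qed
  qed simp
qed

lemma eps_P: "eps t q \<Longrightarrow> t @ inv_word q \<in> P"
proof (induction rule: eps.induct)
  case (eps_refl t)
  then show ?case using P_cong[OF eqv_right_inv] states_words words_Z by auto
next
  case (eps_trans t q p)
  then have "t @ inv_word q @ q @ inv_word p \<in> P" using P_append by fastforce
  then show ?case by (rule P_cancel)
next
  case (eps_root t)
  then show ?case using states_P by simp
next
  case (eps_cancel t z q)
  then show ?case by (simp add: inv_word_Cons)
qed

text \<open>Being in state \<open>q\<close> certifies that the part read so far, divided by
  \<open>q\<close> on the right, lies in \<open>P\<close>; at the root this is membership.
  Irreducibility plays a part only in the converse.\<close>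

lemma run_P:
  assumes "set cs \<subseteq> alphabet" "q \<in> foldl step {q. eps [] q} cs"
  shows "concat cs @ inv_word q \<in> P"
  using assms
proof (induction cs arbitrary: q rule: rev_induct)
  case Nil
  then show ?case using eps_P[of "[]" q] by simp
next
  case (snoc c cs)
  have step: "q \<in> step (foldl step {q. eps [] q} cs) c" using snoc.prems(2) by simp
  show ?case
  proof (cases "c \<in> signed us")
    case True
    then have q: "[] \<in> foldl step {q. eps [] q} cs" "eps [] q"
      using step unfolding step_def[of _ c] by auto
    have "concat cs \<in> P" using snoc.IH[OF _ q(1)] snoc.prems(1) by simp
    then show ?thesis using P_append[OF _ P_append[OF signed_P[OF True] eps_P[OF q(2)]]] by simp
  next
    case False
    then obtain p where p: "p \<in> foldl step {q. eps [] q} cs" "eps (p @ c) q"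
      using step unfolding step_def[of _ c] by auto
    have "concat cs @ inv_word p \<in> P" using snoc.IH[OF _ p(1)] snoc.prems(1) by simp
    from P_append[OF this eps_P[OF p(2)]]
    have "concat cs @ inv_word p @ p @ (c @ inv_word q) \<in> P" by simp
    then show ?thesis using P_cancel[of "concat cs" p "c @ inv_word q"] by simp
  qed
qed

theorem P_iff_run:
  assumes "irreducible_word cs" "set cs \<subseteq> alphabet" "concat cs \<approx> w"
  shows "w \<in> P \<longleftrightarrow> [] \<in> foldl step {q. eps [] q} cs"
proof
  assume "w \<in> P"
  then have "concat cs \<in> sub (\<Union>v\<in>V. pref v)" using P_cong[OF assms(3)] P_eq by simp
  then show "[] \<in> foldl step {q. eps [] q} cs"
    using reach_act_sub[OF _ V] run_irreducible_word[OF assms(1,2)] by simp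
next
  assume "[] \<in> foldl step {q. eps [] q} cs"
  then show "w \<in> P" using run_P[OF assms(2)] P_cong[OF eqv_sym[OF assms(3)]] by fastforce
qed

end

section \<open>Codes of words\<close>

lemma eq_prod_encode_iff: "n = prod_encode (x, y) \<longleftrightarrow> pfst n = x \<and> psnd n = y"
  using prod_encode_pfst_psnd[of n] by auto

text \<open>The code of a nonempty list exceeds that of its tail, and the pairing is strictly
  monotone in its second component, which carries the tail.\<close>

lemma list_encode_remove:
  "list_encode (xs @ zs) \<le> list_encode (xs @ ys @ zs)"
  "ys \<noteq> [] \<Longrightarrow> list_encode (xs @ zs) < list_encode (xs @ ys @ zs)"
proof -
  have mono: "prod_encode (c, m) \<le> prod_encode (c, n)" if "m \<le> n" for c m n
    using triangle_mono[of "c + m" "c + n"] that by (simp add: prod_encode_def)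
  have inj: "prod_encode (c, m) = prod_encode (c, n) \<longleftrightarrow> m = n" for c m n
    using prod_encode_eq by simp
  have strict: "prod_encode (c, m) < prod_encode (c, n)" if "m < n" for c m n
    using mono[of m n c] inj[of c m n] that by linarith
  have 1: "list_encode zs < list_encode (ys @ zs)" if "ys \<noteq> []" for ys
    using that
  proof (induction ys)
    case (Cons y ys)
    have "list_encode (ys @ zs) < list_encode (y # ys @ zs)" using le_prod_encode_2 by (simp add: le_imp_less_Suc)
    then show ?case using Cons by (cases "ys = []") auto
  qed simp
  show 2: "list_encode (xs @ zs) < list_encode (xs @ ys @ zs)" if "ys \<noteq> []" for ys
    using 1[OF that] by (induction xs) (auto intro: strict)
  show "list_encode (xs @ zs) \<le> list_encode (xs @ ys @ zs)"
    using 2[of ys] by (cases "ys = []") (auto intro: less_imp_le)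
qed

definition letter_code :: "'a set \<Rightarrow> 'a \<times> bool \<Rightarrow> nat" where
  "letter_code X l = 2 * to_nat_on X (fst l) + of_bool (snd l)"

lemma word_code_eq: "word_code X w = list_encode (map (letter_code X) w)"
proof -
  have "(\<lambda>(x, b). 2 * to_nat_on X x + of_bool b) = letter_code X"
    by (auto simp: letter_code_def)
  then show ?thesis by (simp add: word_code_def)
qed

lemma word_code_Nil [simp]: "word_code X [] = 0"
  by (simp add: word_code_eq)

lemma word_code_append: "word_code X (v @ w) = app_code (word_code X v) (word_code X w)"
  by (simp add: word_code_eq app_code_def)

lemma word_code_concat: "word_code X (concat ws) = concat_code (list_encode (map (word_code X) ws))"
  by (simp add: word_code_eq concat_code_def map_concat comp_def)

lemma flip_letter_code: "flip_code (letter_code X l) = letter_code X (apsnd Not l)"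
  by (cases "snd l") (auto simp: flip_code_def letter_code_def)

lemma word_code_inv_word: "word_code X (inv_word w) = inv_code (word_code X w)"
  by (simp add: word_code_eq inv_code_def inv_word_def rev_map comp_def flip_letter_code)

lemma word_code_single: "list_encode [letter_code X l] = word_code X [l]"
  by (simp add: word_code_eq)

lemma hd_code_word_code [simp]: "hd_code (word_code X (l # w)) = letter_code X l"
  unfolding word_code_eq list.map by (rule hd_code_list_encode)

lemma word_code_eq_0 [simp]: "word_code X w = 0 \<longleftrightarrow> w = []"
  by (cases w) (simp_all add: word_code_eq)

lemma letter_code_image:
  assumes "finite X"
  shows "letter_code X ` (X \<times> UNIV) = {..<2 * card X}"
proof -
  have b: "to_nat_on X ` X = {..<card X}" using to_nat_on_finite[OF assms] by (simp add: bij_betw_def)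
  have "n \<in> letter_code X ` (X \<times> UNIV)" if "n < 2 * card X" for n
  proof -
    have "n div 2 \<in> to_nat_on X ` X" using that b by auto
    then obtain x where "x \<in> X" "to_nat_on X x = n div 2" by auto
    then show ?thesis by (intro image_eqI[of _ _ "(x, odd n)"]) (auto simp: letter_code_def)
  qed
  moreover have "letter_code X l < 2 * card X" if "fst l \<in> X" for l
  proof -
    have "to_nat_on X (fst l) < card X" using b that by auto
    then show ?thesis by (cases "snd l") (auto simp: letter_code_def)
  qed
  ultimately show ?thesis by (auto simp: lessThan_def)
qed

lemma inj_letter_code:
  assumes "finite X" "fst l \<in> X" "fst l' \<in> X" "letter_code X l = letter_code X l'"
  shows "l = l'"
proof -
  have "letter_code X l div 2 = to_nat_on X (fst l)" "odd (letter_code X l) = snd l" for l :: "'a \<times> bool"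
    by (auto simp: letter_code_def)
  then have "to_nat_on X (fst l) = to_nat_on X (fst l')" "snd l = snd l'" using assms(4) by metis+
  moreover have "inj_on (to_nat_on X) X" using to_nat_on_finite[OF assms(1)] by (simp add: bij_betw_def)
  ultimately show ?thesis using assms(2,3) by (auto simp: inj_on_def intro: prod_eqI)
qed

lemma inj_word_code:
  assumes "finite X"
  shows "inj_on (word_code X) (words X)"
proof (rule inj_onI)
  fix v w assume vw: "v \<in> words X" "w \<in> words X" "word_code X v = word_code X w"
  then have "map (letter_code X) v = map (letter_code X) w" by (simp add: word_code_eq list_encode_eq)
  moreover have "inj_on (letter_code X) (set v \<union> set w)"
  proof (rule inj_onI)
    fix l l' assume l: "l \<in> set v \<union> set w" "l' \<in> set v \<union> set w" "letter_code X l = letter_code X l'"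
    have "fst ` (set v \<union> set w) \<subseteq> X" using vw by (auto simp: mem_words_iff)
    then show "l = l'" using inj_letter_code[OF assms _ _ l(3)] l(1,2) by blast
  qed
  ultimately show "v = w" by (simp add: inj_on_map_eq_map)
qed

lemma word_code_image_iff:
  assumes "finite X"
  shows "n \<in> word_code X ` words X \<longleftrightarrow> (\<forall>m\<in>set (list_decode n). m < 2 * card X)"
proof
  assume "n \<in> word_code X ` words X"
  then show "\<forall>m\<in>set (list_decode n). m < 2 * card X"
    using letter_code_image[OF assms] by (fastforce simp: word_code_eq mem_words_iff)
next
  assume n: "\<forall>m\<in>set (list_decode n). m < 2 * card X"
  have "\<exists>w\<in>words X. ms = map (letter_code X) w" if "set ms \<subseteq> {..<2 * card X}" for ms
    using that unfolding letter_code_image[OF assms, symmetric]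
  proof (induction ms)
    case Nil
    then show ?case by (intro bexI[of _ "[]"]) simp_all
  next
    case (Cons m ms)
    then obtain l w where "fst l \<in> X" "m = letter_code X l" "w \<in> words X" "ms = map (letter_code X) w" by auto
    then show ?case by (intro bexI[of _ "l # w"]) simp_all
  qed
  from this[of "list_decode n"] n obtain w where "w \<in> words X" "list_decode n = map (letter_code X) w" by auto
  then show "n \<in> word_code X ` words X"
    by (metis image_eqI list_decode_inverse word_code_eq)
qed

lemma app_code_eq_word_code_iff:
  assumes w: "w \<in> words X"
  shows "app_code m n = word_code X w \<longleftrightarrow> (\<exists>v v'. w = v @ v' \<and> m = word_code X v \<and> n = word_code X v')"
proof
  assume "app_code m n = word_code X w"
  then have "list_decode m @ list_decode n = map (letter_code X) w"
    by (simp add: app_code_def word_code_eq list_encode_eq)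
  then obtain v v' where "w = v @ v'" "map (letter_code X) v = list_decode m" "map (letter_code X) v' = list_decode n"
    by (metis append_eq_map_conv)
  then show "\<exists>v v'. w = v @ v' \<and> m = word_code X v \<and> n = word_code X v'"
    by (metis list_decode_inverse word_code_eq)
qed (auto simp: word_code_append)

lemma word_code_append_le:
  "word_code X v \<le> word_code X (v @ w)" "word_code X w \<le> word_code X (v @ w)"
  using list_encode_remove(1)[of "map (letter_code X) v" "[]" "map (letter_code X) w"]
    list_encode_remove(1)[of "[]" "map (letter_code X) w" "map (letter_code X) v"]
  by (simp_all add: word_code_eq)

text \<open>Both halves of a word have codes bounded by that of the word, so splittings can be found
  by bounded search.\<close>

lemma ex_split_code_iff:
  assumes "w \<in> words X"
  shows "(\<exists>m\<le>word_code X w. \<exists>n\<le>word_code X w. app_code m n = word_code X w \<and> Q m n) \<longleftrightarrow>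
    (\<exists>v v'. w = v @ v' \<and> Q (word_code X v) (word_code X v'))"
  using word_code_append_le[of X] unfolding app_code_eq_word_code_iff[OF assms] by blast

lemma computable_single: "computable a \<Longrightarrow> computable (\<lambda>e. list_encode [a e])"
  using computable_Suc[OF computable_pair[of a "\<lambda>_. 0"]] by (simp add: computable_const)

lemma decidable_pred_words:
  assumes "finite X" "computable a"
  shows "decidable_pred (\<lambda>e. a e \<in> word_code X ` words X)"
proof -
  have "decidable_pred (\<lambda>e. \<forall>m\<in>set (list_decode (a e)). Suc m \<le> 2 * card X)"
    by (intro decidable_pred_list_all assms decidable_pred_le computable_Suc computable_id computable_const)
  then show ?thesis unfolding word_code_image_iff[OF assms(1)] by (simp add: Suc_le_eq)
qed

section \<open>Decidability\<close>

context special_presentation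
begin

text \<open>Phrased with the very set from \<open>decidable_word_problem\<close>, so that its
  decidability is the hypothesis and it is defined on all numbers.\<close>

definition eqv_code :: "nat \<Rightarrow> nat \<Rightarrow> bool" where
  "eqv_code m n \<longleftrightarrow> prod_encode (m, n) \<in> {prod_encode (word_code X v, word_code X w) | v w.
     v \<in> words X \<and> w \<in> words X \<and> gp_elem X (special rs) v = gp_elem X (special rs) w}"

lemma eqv_code_iff:
  assumes "finite X" "v \<in> words X" "w \<in> words X"
  shows "eqv_code (word_code X v) (word_code X w) \<longleftrightarrow> v \<approx> w"
proof -
  have "eqv_code (word_code X v) (word_code X w) \<longleftrightarrow> (\<exists>v'\<in>words X. \<exists>w'\<in>words X.
      word_code X v = word_code X v' \<and> word_code X w = word_code X w' \<and> v' \<approx> w')"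
    unfolding eqv_code_def mem_Collect_eq prod_encode_eq prod.inject using class_eq_iff_eqv by blast
  also have "\<dots> \<longleftrightarrow> v \<approx> w"
    using assms(2,3) by (auto simp: inj_on_eq_iff[OF inj_word_code[OF assms(1)]])
  finally show ?thesis .
qed

lemma decidable_pred_eqv_code:
  assumes "decidable_word_problem X (gp_elem X (special rs))" "computable a" "computable b"
  shows "decidable_pred (\<lambda>e. eqv_code (a e) (b e))"
  using decidable_pred_subst[OF assms(1)[unfolded decidable_word_problem_def decidable_iff]
      computable_pair[OF assms(2,3)]]
  unfolding eqv_code_def .

text \<open>A finite index set, which turns the quantifiers in \<open>loop_edge\<close> into finite
  disjunctions.\<close>

definition relator_edges :: "('a word \<times> ('a \<times> bool)) set" where
  "relator_edges = {(p, l). \<exists>r\<in>rs. prefix (p @ [l]) r}"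

lemma finite_relator_edges:
  assumes "finite rs"
  shows "finite relator_edges"
proof -
  have "relator_edges \<subseteq> (\<lambda>q. (butlast q, last q)) ` (\<Union>r\<in>rs. set (prefixes r))"
    by (force simp: relator_edges_def image_iff)
  then show ?thesis using finite_subset assms by blast
qed

definition loop_code :: "nat \<Rightarrow> nat \<Rightarrow> nat \<Rightarrow> bool" where
  "loop_code q g l \<longleftrightarrow>
    (\<exists>e\<in>relator_edges. letter_code X (snd e) = l \<and>
      app_code (inv_code q) (app_code g (word_code X (inv_word (fst e)))) \<in> word_code X ` P) \<or>
    (\<exists>e\<in>relator_edges. letter_code X (snd e) = flip_code l \<and>
      app_code (inv_code q) (app_code g (app_code (list_encode [l]) (word_code X (inv_word (fst e))))) \<in> word_code X ` P)"

text \<open>One splitting \<open>w = q t\<close> serves for the vertices and for the edges of the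
  path. \<open>t \<noteq> 0\<close> says that there is a next letter, so the value of
  \<open>hd_code\<close> at the empty word does not count.\<close>

definition cov_code :: "nat \<Rightarrow> nat \<Rightarrow> nat \<Rightarrow> bool" where
  "cov_code w g l \<longleftrightarrow> (\<exists>q\<le>w. \<exists>t\<le>w. app_code q t = w \<and> (loop_code q g l \<or>
    t \<noteq> 0 \<and> (hd_code t = l \<and> eqv_code g q \<or>
      hd_code t = flip_code l \<and> eqv_code g (app_code q (list_encode [hd_code t])))))"

definition edges_covered_code :: "nat \<Rightarrow> nat \<Rightarrow> bool" where
  "edges_covered_code v w \<longleftrightarrow>
    \<not> (\<exists>p\<le>v. \<exists>t\<le>v. app_code p t = v \<and> (t \<noteq> 0 \<and> \<not> cov_code w p (hd_code t)))"

context
  assumes fin: "finite X" "finite rs"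
begin

lemma word_code_P_iff: "w \<in> words X \<Longrightarrow> word_code X w \<in> word_code X ` P \<longleftrightarrow> w \<in> P"
  using inj_on_image_mem_iff[OF inj_word_code[OF fin(1)], of w P] P_words by blast

lemma loop_code_iff:
  assumes w: "q \<in> words X" "g \<in> words X" and l: "fst l \<in> X"
  shows "loop_code (word_code X q) (word_code X g) (letter_code X l) \<longleftrightarrow> loop_edge q g l"
proof -
  have e: "fst e \<in> words X" "fst (snd e) \<in> X" if "e \<in> relator_edges" for e
    using that rs_words words_prefix[of "fst e @ [snd e]"] by (auto simp: relator_edges_def)
  have lc: "letter_code X m = letter_code X l' \<longleftrightarrow> m = l'" if "fst m \<in> X" "fst l' \<in> X" for m l'
    using inj_letter_code[OF fin(1) that] by blast
  have "loop_code (word_code X q) (word_code X g) (letter_code X l) \<longleftrightarrow>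
      (\<exists>(p, m)\<in>relator_edges. m = l \<and> inv_word q @ g @ inv_word p \<in> P) \<or>
      (\<exists>(p, m)\<in>relator_edges. m = apsnd Not l \<and> inv_word q @ g @ [l] @ inv_word p \<in> P)"
    unfolding loop_code_def flip_letter_code word_code_single word_code_inv_word[symmetric]
      word_code_append[symmetric] split_def
    by (intro arg_cong2[where f = "(\<or>)"] bex_cong refl) (simp_all add: e lc w l word_code_P_iff)
  also have "\<dots> \<longleftrightarrow> loop_edge q g l"
    unfolding loop_edge_def relator_edges_def by blast
  finally show ?thesis .
qed

lemma cov_code_iff:
  assumes w: "w \<in> words X" "g \<in> words X" and l: "fst l \<in> X"
  shows "cov_code (word_code X w) (word_code X g) (letter_code X l) \<longleftrightarrow> cov w g l"
proof -
  have lc: "letter_code X m = letter_code X l' \<longleftrightarrow> m = l'" if "fst m \<in> X" "fst l' \<in> X" for m l'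
    using inj_letter_code[OF fin(1) that] by blast
  let ?Q = "\<lambda>q t. loop_edge q g l \<or> (\<exists>m t'. t = m # t' \<and> (m = l \<and> g \<approx> q \<or> m = apsnd Not l \<and> g \<approx> q @ [m]))"
  have "cov_code (word_code X w) (word_code X g) (letter_code X l) \<longleftrightarrow> (\<exists>q t. w = q @ t \<and> ?Q q t)"
    unfolding cov_code_def ex_split_code_iff[OF w(1)]
  proof (intro ex_cong1 conj_cong refl)
    fix q t assume "w = q @ t"
    then have qt: "q \<in> words X" "t \<in> words X" using w(1) by auto
    show "(loop_code (word_code X q) (word_code X g) (letter_code X l) \<or>
        word_code X t \<noteq> 0 \<and> (hd_code (word_code X t) = letter_code X l \<and> eqv_code (word_code X g) (word_code X q) \<or>
        hd_code (word_code X t) = flip_code (letter_code X l) \<and>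
          eqv_code (word_code X g) (app_code (word_code X q) (list_encode [hd_code (word_code X t)])))) \<longleftrightarrow> ?Q q t"
    proof (cases t)
      case Nil
      then show ?thesis using loop_code_iff qt w l by simp
    next
      case (Cons m t')
      then have m: "fst m \<in> X" using qt by simp
      have "eqv_code (word_code X g) (word_code X (q @ [m])) \<longleftrightarrow> g \<approx> q @ [m]"
        using eqv_code_iff[OF fin(1)] w qt m by simp
      then show ?thesis using Cons loop_code_iff[OF qt(1) w(2) l] eqv_code_iff[OF fin(1) w(2) qt(1)] lc[OF m l]
          lc[of m "apsnd Not l"] m l
        by (simp add: flip_letter_code word_code_single word_code_append del: list_encode.simps)
    qed
  qed
  also have "\<dots> \<longleftrightarrow> (\<exists>q t. w = q @ t \<and> loop_edge q g l) \<or> (\<exists>q t. w = q @ l # t \<and> g \<approx> q) \<or>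
      (\<exists>q t. w = q @ apsnd Not l # t \<and> g \<approx> q @ [apsnd Not l])"
    by blast
  also have "\<dots> \<longleftrightarrow> cov w g l"
    unfolding cov_def path_edge_def prefix_def append_assoc append_Cons append_Nil by blast
  finally show ?thesis .
qed

lemma edges_covered_code_iff:
  assumes vw: "v \<in> words X" "w \<in> words X"
  shows "edges_covered_code (word_code X v) (word_code X w) \<longleftrightarrow> edges_covered v w"
proof -
  have "edges_covered_code (word_code X v) (word_code X w) \<longleftrightarrow>
      (\<forall>p t. v = p @ t \<longrightarrow> t \<noteq> [] \<longrightarrow> cov_code (word_code X w) (word_code X p) (hd_code (word_code X t)))"
    unfolding edges_covered_code_def ex_split_code_iff[OF vw(1)] by auto
  also have "\<dots> \<longleftrightarrow> (\<forall>p l t. v = p @ l # t \<longrightarrow> cov w p l)" (is "?L \<longleftrightarrow> ?R")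
  proof -
    have *: "cov_code (word_code X w) (word_code X p) (hd_code (word_code X (l # t))) \<longleftrightarrow> cov w p l"
      if "v = p @ l # t" for p l t
      using cov_code_iff[OF vw(2), of p l] that vw(1) by simp
    show ?thesis
    proof
      assume ?L
      then show ?R using * by blast
    next
      assume R: ?R
      show ?L
      proof (intro allI impI)
        fix p t assume t: "v = p @ t" "t \<noteq> []"
        then obtain l t' where "t = l # t'" by (cases t) auto
        then show "cov_code (word_code X w) (word_code X p) (hd_code (word_code X t))"
          using * R t(1) by blast
      qed
    qed
  qed
  also have "\<dots> \<longleftrightarrow> edges_covered v w"
    unfolding edges_covered_def prefix_def by auto
  finally show ?thesis .
qed

context
  assumes wp: "decidable_word_problem X (gp_elem X (special rs))"
    and pm: "decidable_prefix_membership X rs"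
begin

lemma decidable_pred_P:
  assumes "computable a"
  shows "decidable_pred (\<lambda>e. a e \<in> word_code X ` P)"
proof -
  have "{word_code X w |w. w \<in> words X \<and> gp_elem X (special rs) w \<in> prefix_monoid X rs} = word_code X ` P"
    using P_iff P_words by blast
  then show ?thesis
    using pm decidable_pred_subst[OF _ assms] unfolding decidable_prefix_membership_def decidable_iff by simp
qed

lemma decidable_pred_loop_code:
  assumes "computable q" "computable g" "computable l"
  shows "decidable_pred (\<lambda>e. loop_code (q e) (g e) (l e))"
  unfolding loop_code_def
  by (intro decidable_pred_disj decidable_pred_bex_finite finite_relator_edges fin decidable_pred_conj
      decidable_pred_eq decidable_pred_P computable_app_code computable_inv_code computable_const
      computable_flip_code computable_single assms)

lemma decidable_pred_cov_code:
  assumes "computable w" "computable g" "computable l"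
  shows "decidable_pred (\<lambda>e. cov_code (w e) (g e) (l e))"
proof -
  have "decidable_pred (\<lambda>e. cov_code (pfst e) (pfst (psnd e)) (psnd (psnd e)))"
    unfolding cov_code_def
    by (intro decidable_pred_bex decidable_pred_conj decidable_pred_disj decidable_pred_not decidable_pred_eq
        decidable_pred_loop_code decidable_pred_eqv_code[OF wp] computable_app_code computable_single
        computable_hd_code computable_flip_code computable_pfst computable_psnd computable_id computable_const)
  from decidable_pred_subst[OF this computable_pair[OF assms(1) computable_pair[OF assms(2,3)]]]
  show ?thesis by simp
qed

lemma decidable_pred_edges_covered_code:
  assumes "computable v" "computable w"
  shows "decidable_pred (\<lambda>e. edges_covered_code (v e) (w e))"
proof -
  have "decidable_pred (\<lambda>e. edges_covered_code (pfst e) (psnd e))"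
    unfolding edges_covered_code_def
    by (intro decidable_pred_bex decidable_pred_conj decidable_pred_not decidable_pred_eq
        decidable_pred_cov_code computable_app_code
        computable_hd_code computable_pfst computable_psnd computable_id computable_const)
  from decidable_pred_subst[OF this computable_pair[OF assms]] show ?thesis by simp
qed

theorem decidable_EU_word_problem: "decidable_word_problem X (EU_elem X (special rs))"
proof -
  let ?D = "{prod_encode (word_code X v, word_code X w) | v w.
       v \<in> words X \<and> w \<in> words X \<and> EU_elem X (special rs) v = EU_elem X (special rs) w}"
  let ?W = "word_code X ` words X"
  have "decidable_pred (\<lambda>n. pfst n \<in> ?W \<and> psnd n \<in> ?W \<and> eqv_code (pfst n) (psnd n) \<and>
      edges_covered_code (pfst n) (psnd n) \<and> edges_covered_code (psnd n) (pfst n))"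
    by (intro decidable_pred_conj decidable_pred_words[OF fin(1)] decidable_pred_eqv_code[OF wp]
        decidable_pred_edges_covered_code computable_pfst computable_psnd computable_id)
  moreover have "(pfst n \<in> ?W \<and> psnd n \<in> ?W \<and> eqv_code (pfst n) (psnd n) \<and>
      edges_covered_code (pfst n) (psnd n) \<and> edges_covered_code (psnd n) (pfst n)) \<longleftrightarrow> n \<in> ?D" for n
  proof -
    have *: "EU_elem X (special rs) v = EU_elem X (special rs) w \<longleftrightarrow>
        eqv_code (word_code X v) (word_code X w) \<and> edges_covered_code (word_code X v) (word_code X w) \<and>
        edges_covered_code (word_code X w) (word_code X v)" if "v \<in> words X" "w \<in> words X" for v w
      using EU_elem_eq_iff_edges_covered eqv_code_iff[OF fin(1)] edges_covered_code_iff that by simp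
    have "n \<in> ?D \<longleftrightarrow> (\<exists>v\<in>words X. \<exists>w\<in>words X. pfst n = word_code X v \<and> psnd n = word_code X w \<and>
        EU_elem X (special rs) v = EU_elem X (special rs) w)"
      by (auto simp: eq_prod_encode_iff)
    also have "\<dots> \<longleftrightarrow> (\<exists>v\<in>words X. \<exists>w\<in>words X. pfst n = word_code X v \<and> psnd n = word_code X w \<and>
        eqv_code (pfst n) (psnd n) \<and> edges_covered_code (pfst n) (psnd n) \<and>
        edges_covered_code (psnd n) (pfst n))"
      by (intro bex_cong refl conj_cong) (simp add: *)
    finally show ?thesis by blast
  qed
  ultimately show ?thesis unfolding decidable_word_problem_def decidable_iff by simp
qed

end

end

end

section \<open>Deciding prefix membership\<close>

context conservative_presentation
begin

lemma finite_states:
  assumes "finite J"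
  shows "finite states"
  using assms by (auto simp: states_def pref_def simp flip: set_prefixes_eq)

lemma step_states: "S \<subseteq> states \<Longrightarrow> step S c \<subseteq> states"
  using eps_states by (auto simp: step_def)

lemma Least_irreducible_word:
  assumes fin: "finite X" and w: "w \<in> words X"
    and m: "m = (LEAST m. (\<exists>cs. set cs \<subseteq> alphabet \<and> list_decode m = map (word_code X) cs) \<and>
      eqv_code (concat_code m) (word_code X w))"
  obtains cs where "irreducible_word cs" "set cs \<subseteq> alphabet" "concat cs \<approx> w" "list_decode m = map (word_code X) cs"
proof -
  let ?Q = "\<lambda>m. (\<exists>cs. set cs \<subseteq> alphabet \<and> list_decode m = map (word_code X) cs) \<and>
      eqv_code (concat_code m) (word_code X w)"
  have eq: "eqv_code (concat_code (list_encode (map (word_code X) cs))) (word_code X w) \<longleftrightarrow> concat cs \<approx> w"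
    if "set cs \<subseteq> alphabet" for cs
  proof -
    have "concat cs \<in> words X" using that alphabet_words by (auto simp: words_concat)
    then show ?thesis unfolding word_code_concat[symmetric] using eqv_code_iff[OF fin] w by simp
  qed
  have Q: "?Q (list_encode (map (word_code X) cs))" if "set cs \<subseteq> alphabet" "concat cs \<approx> w" for cs
    using eq that by auto
  obtain cs0 where "set cs0 \<subseteq> alphabet" "concat cs0 \<approx> w" using ex_alphabet_word[OF w] by blast
  then have "?Q m" unfolding m using Q by (intro LeastI)
  then obtain cs where cs: "set cs \<subseteq> alphabet" "list_decode m = map (word_code X) cs"
    and c: "eqv_code (concat_code m) (word_code X w)" by blast
  have mc: "m = list_encode (map (word_code X) cs)" using cs(2) by (metis list_decode_inverse)
  have csw: "concat cs \<approx> w" using eq[OF cs(1)] c mc by simp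
  have "irreducible_word cs"
    unfolding irreducible_word_def
  proof (intro allI impI, rule ccontr)
    fix xs ys zs assume d: "cs = xs @ ys @ zs" "concat ys \<approx> []" "ys \<noteq> []"
    have "concat xs \<in> words X" "concat zs \<in> words X" using cs(1) d(1) alphabet_words by (auto simp: words_concat)
    then have "concat (xs @ zs) \<approx> concat cs"
      using eqv_context[OF eqv_sym[OF d(2)], of "concat xs" "concat zs"] d(1) by simp
    then have "concat (xs @ zs) \<approx> w" using csw by (rule eqv_trans)
    moreover have "set (xs @ zs) \<subseteq> alphabet" using cs(1) d(1) by auto
    ultimately have "m \<le> list_encode (map (word_code X) (xs @ zs))" unfolding m using Q by (intro Least_le)
    moreover have "list_encode (map (word_code X) (xs @ zs)) < list_encode (map (word_code X) cs)"
      using list_encode_remove(2)[of "map (word_code X) ys"] d by simp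
    ultimately show False using mc by simp
  qed
  then show ?thesis using that cs csw by blast
qed

theorem decidable_prefix_membership:
  assumes fin: "finite X" "finite J" and wp: "decidable_word_problem X (gp_elem X (special rs))"
  shows "decidable_prefix_membership X rs"
proof -
  let ?W = "word_code X ` words X"
  let ?A = "\<lambda>m. \<exists>cs. set cs \<subseteq> alphabet \<and> list_decode m = map (word_code X) cs"
  \<comment> \<open>The guard makes the unbounded search total: for a number that codes no word it
    stops at \<open>0\<close>, and that result is discarded by the conjunct
    \<open>n \<in> ?W\<close> later.\<close>
  let ?L = "\<lambda>n. LEAST m. n \<in> ?W \<longrightarrow> ?A m \<and> eqv_code (concat_code m) n"
  let ?R = "\<lambda>m. \<exists>cs. set cs \<subseteq> alphabet \<and> list_decode m = map (word_code X) cs \<and>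
    foldl step {q. eps [] q} cs \<in> {S. [] \<in> S}"
  have "finite alphabet" using fin by (simp add: alphabet_def signed_def)
  moreover have "inj_on (word_code X) alphabet"
    using alphabet_words by (intro inj_on_subset[OF inj_word_code[OF fin(1)]]) blast
  ultimately have alph: "finite alphabet" "inj_on (word_code X) alphabet" .
  \<comment> \<open>An automaton with one state, always accepting, checks only that the letters come
    from the alphabet.\<close>
  have A: "decidable_pred ?A"
    using decidable_pred_automaton[of "{()}" "()" alphabet "\<lambda>_ _. ()" "word_code X" UNIV] alph by simp
  \<comment> \<open>Subset construction: the states of the deterministic automaton are sets of
    states.\<close>
  have R: "decidable_pred ?R"
    by (rule decidable_pred_automaton[of "Pow states"])
      (use alph finite_states[OF fin(2)] step_states eps_states in auto)
  have "computable ?L"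
  proof (rule computable_Least)
    show "decidable_pred (\<lambda>p. psnd p \<in> ?W \<longrightarrow> ?A (pfst p) \<and> eqv_code (concat_code (pfst p)) (psnd p))"
      by (intro decidable_pred_imp decidable_pred_conj decidable_pred_words[OF fin(1)]
          decidable_pred_subst[OF A] decidable_pred_eqv_code[OF wp] computable_concat_code
          computable_pfst computable_psnd computable_id)
    show "\<exists>m. n \<in> ?W \<longrightarrow> ?A m \<and> eqv_code (concat_code m) n" for n
    proof (cases "n \<in> ?W")
      case True
      then obtain w where w: "w \<in> words X" "n = word_code X w" by blast
      obtain cs where cs: "set cs \<subseteq> alphabet" "concat cs \<approx> w" using ex_alphabet_word[OF w(1)] by blast
      then have "concat cs \<in> words X" using eqv_words by blast
      then have "eqv_code (concat_code (list_encode (map (word_code X) cs))) n"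
        unfolding word_code_concat[symmetric] w(2) using eqv_code_iff[OF fin(1) _ w(1)] cs(2) by simp
      then show ?thesis using cs(1) by (intro exI[of _ "list_encode (map (word_code X) cs)"]) auto
    qed simp
  qed
  define accepted where "accepted n \<longleftrightarrow> ?R (?L n)" for n
  have "decidable_pred (\<lambda>n. n \<in> ?W \<and> accepted n)"
    unfolding accepted_def using \<open>computable ?L\<close> decidable_pred_conj[OF decidable_pred_words[OF fin(1) computable_id]] decidable_pred_subst[OF R] by simp
  moreover have "n \<in> ?W \<and> accepted n \<longleftrightarrow>
      n \<in> {word_code X w |w. w \<in> words X \<and> gp_elem X (special rs) w \<in> prefix_monoid X rs}" for n
  proof -
    have "accepted (word_code X w) \<longleftrightarrow> w \<in> P" if w: "w \<in> words X" for w
    proof -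
      obtain cs where cs: "irreducible_word cs" "set cs \<subseteq> alphabet" "concat cs \<approx> w"
        "list_decode (?L (word_code X w)) = map (word_code X) cs"
        using Least_irreducible_word[OF fin(1) w, of "?L (word_code X w)"] w by auto
      have "ds = cs" if "set ds \<subseteq> alphabet" "map (word_code X) cs = map (word_code X) ds" for ds
        using that cs(2) inj_on_subset[OF alph(2), of "set ds \<union> set cs"] inj_on_map_eq_map[of "word_code X" ds cs] by simp
      then have "accepted (word_code X w) \<longleftrightarrow> [] \<in> foldl step {q. eps [] q} cs"
        unfolding accepted_def cs(4) using cs(2) by blast
      then show ?thesis using P_iff_run[OF cs(1-3)] by simp
    qed
    then show ?thesis using P_iff by auto
  qed
  ultimately show ?thesis unfolding decidable_prefix_membership_def decidable_iff by simp
qed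

end

section \<open>Factorisations\<close>

lemma free_star_words: "V \<subseteq> words X \<Longrightarrow> free_star V \<subseteq> words X"
  by (auto simp: free_star_def words_concat in_lists_conv_set subset_iff)

lemma signed_subset_words: "us \<subseteq> words X \<Longrightarrow> signed us \<subseteq> words X"
  by (auto simp: signed_def)

text \<open>A prefix of a product of factors is a product of factors times a prefix of one more
  factor. Conversely, a unit and its inverse are right invertible, and prefixes of right invertible
  words lie in \<open>P\<close> by \<open>right_unit_prefix\<close>.\<close>

lemma (in special_presentation) unital_imp_conservative:
  assumes us: "us \<subseteq> words X" and unital: "unital X rs us"
  shows "conservative X rs us"
  unfolding conservative_def
proof (intro allI impI)
  fix V assume "minimal_factors rs us V"
  then have V: "V \<subseteq> signed us" "rs \<subseteq> free_star V" by (auto simp: minimal_factors_def)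
  let ?T = "\<Union>v\<in>V. pref v"
  have Vw: "v \<in> words X" if "v \<in> V" for v using signed_subset_words[OF us] V that by blast
  have T: "?T \<subseteq> words X" using words_prefix Vw by (auto simp: pref_def)
  have "prefixes_of_relators \<subseteq> sub ?T"
  proof
    fix p assume "p \<in> prefixes_of_relators"
    then obtain r where r: "r \<in> rs" "prefix p r" by (auto simp: prefixes_of_relators_def pref_def)
    then have "r \<in> concat ` lists V" using V by (auto simp: free_star_def)
    then obtain vs where vs: "set vs \<subseteq> V" "r = concat vs" by (auto simp: in_lists_conv_set)
    have V_sub: "q \<in> sub ?T" if "v \<in> V" "prefix q v" for q v
      using that T by (intro sub_base) (auto simp: pref_def)
    have c: "concat ws \<in> sub ?T" if "set ws \<subseteq> V" for ws
      using that V_sub by (intro sub_concat) auto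
    from r(2) show "p \<in> sub ?T" unfolding vs(2)
    proof (cases rule: prefix_concatE)
      case 1
      then show ?thesis using c[OF vs(1)] by simp
    next
      case (2 vs1 v vs2 p')
      then show ?thesis using c[of vs1] V_sub[of v p'] vs(1) sub_append by auto
    qed
  qed
  moreover have "?T \<subseteq> P"
  proof
    fix p assume "p \<in> ?T"
    then obtain v where v: "v \<in> V" "prefix p v" by (auto simp: pref_def)
    then obtain w where w: "w \<in> us" "v = w \<or> v = inv_word w" using V by (auto simp: signed_def)
    have "inv_elem X (special rs) w \<in> Units (Inv X (special rs))" using unital w by (simp add: unital_def)
    then obtain w' where "(v @ w', []) \<in> inv_cong X (special rs)"
      using unit_right_inverse[of w] w us by blast
    then show "p \<in> P" using right_unit_prefix v by blast
  qed
  ultimately have "sub prefixes_of_relators = sub ?T"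
    using sub_subset unfolding P_def by blast
  from mon_gen_eqI[OF prefixes_words T this]
  show "prefix_monoid X rs = mon_gen (Gp X (special rs)) (gp_elem X (special rs) ` ?T)"
    unfolding prefix_monoid_def prefixes_of_relators_def .
qed

text \<open>Rotating the relator \<open>c v d\<close> gives \<open>v^-1 = d c\<close> in
  \<open>G\<close>.\<close>

lemma (in special_presentation) inv_factor_in_P:
  assumes r: "c @ v @ d \<in> rs" and P: "d @ c \<in> P"
  shows "inv_word v \<in> P"
proof -
  have w: "c \<in> words X" "v \<in> words X" "d \<in> words X" using r rs_words by auto
  have "[] \<approx> c @ v @ d" by (rule eqv_sym[OF eqv_relator[OF r]])
  then have "inv_word c \<approx> v @ d" using eqv_shift[of c "v @ d" "[]"] w by simp
  then have "inv_word v @ inv_word c \<approx> d" using eqv_shift[of v d "inv_word c"] w by simp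
  from eqv_append[OF this eqv_refl[OF w(1)]] have "inv_word v @ inv_word c @ c @ [] \<approx> d @ c" by simp
  then show ?thesis using P_cancel[of "inv_word v" c "[]"] P_cong[OF _ P] by simp
qed

lemma uniquely_markedE:
  assumes um: "uniquely_marked X k u" and u: "\<forall>j\<in>{1..k}. u j \<in> words X"
  obtains a x s b where "\<And>j. j \<in> {1..k} \<Longrightarrow> u j = a j @ [(x j, s j)] @ b j"
    "\<And>j. j \<in> {1..k} \<Longrightarrow> x j \<in> X" "inj_on x {1..k}"
    "\<And>j. j \<in> {1..k} \<Longrightarrow> a j \<in> words (X - x ` {1..k})"
    "\<And>j. j \<in> {1..k} \<Longrightarrow> b j \<in> words (X - x ` {1..k})"
proof -
  obtain x where x: "\<And>j. j \<in> {1..k} \<Longrightarrow> x j \<in> X"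
    "\<And>j. j \<in> {1..k} \<Longrightarrow> count_list (map fst (u j)) (x j) = 1"
    "\<And>j j'. j \<in> {1..k} \<Longrightarrow> j' \<in> {1..k} - {j} \<Longrightarrow> x j \<notin> fst ` set (u j')"
    using um unfolding uniquely_marked_def by metis
  have "\<exists>a b s. u j = a @ [(x j, s)] @ b \<and> x j \<notin> fst ` set a \<and> x j \<notin> fst ` set b" if j: "j \<in> {1..k}" for j
  proof -
    have "x j \<in> set (map fst (u j))" using x(2)[OF j] count_list_0_iff[of "map fst (u j)" "x j"] by auto
    then obtain s where "(x j, s) \<in> set (u j)" by auto
    then obtain a b where ab: "u j = a @ (x j, s) # b" by (meson split_list)
    then have "count_list (map fst a) (x j) = 0" "count_list (map fst b) (x j) = 0"
      using x(2)[OF j] by (simp_all add: count_list_append)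
    then show ?thesis using ab by (intro exI[of _ a] exI[of _ b] exI[of _ s]) (auto simp: count_list_0_iff)
  qed
  then obtain a b s where abs: "\<And>j. j \<in> {1..k} \<Longrightarrow> u j = a j @ [(x j, s j)] @ b j"
    "\<And>j. j \<in> {1..k} \<Longrightarrow> x j \<notin> fst ` set (a j)" "\<And>j. j \<in> {1..k} \<Longrightarrow> x j \<notin> fst ` set (b j)" by metis
  have sub: "set (a j) \<union> set (b j) \<subseteq> set (u j)" "x j \<in> fst ` set (u j)" if "j \<in> {1..k}" for j
    using abs(1)[OF that] by auto
  have inj: "inj_on x {1..k}"
  proof (rule inj_onI, rule ccontr)
    fix i j assume "i \<in> {1..k}" "j \<in> {1..k}" "x i = x j" "i \<noteq> j"
    then show False using x(3)[of i j] sub(2)[of j] by auto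
  qed
  have mark: "x i \<notin> fst ` (set (a j) \<union> set (b j))" if "i \<in> {1..k}" "j \<in> {1..k}" for i j
    using x(3)[of i j] abs(2,3)[of j] sub(1)[of j] that by (cases "i = j") auto
  have "a j \<in> words (X - x ` {1..k}) \<and> b j \<in> words (X - x ` {1..k})" if j: "j \<in> {1..k}" for j
  proof -
    have "fst ` set (u j) \<subseteq> X" using u j by (simp add: mem_words_iff)
    then have "fst ` (set (a j) \<union> set (b j)) \<subseteq> X - x ` {1..k}" using sub(1)[OF j] mark[OF _ j] by blast
    then show ?thesis by (simp add: mem_words_iff image_Un)
  qed
  then show ?thesis using that[OF abs(1) x(1) inj] by blast
qed

text \<open>\<open>conservative\<close> quantifies over all minimal \<open>V\<close>, so it yields
  information only once some \<open>V\<close> is known to exist.\<close>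

lemma ex_minimal_factors:
  assumes "finite us" "rs \<subseteq> free_star (signed us)"
  shows "\<exists>V. minimal_factors rs us V"
proof -
  let ?A = "{V. V \<subseteq> signed us \<and> rs \<subseteq> free_star V}"
  have "finite ?A" using assms(1) by (simp add: signed_def)
  moreover have "?A \<noteq> {}" using assms(2) by blast
  ultimately obtain V where "V \<in> ?A" "\<forall>V'\<in>?A. V' \<subseteq> V \<longrightarrow> V = V'" using finite_has_minimal[of ?A] by blast
  then show ?thesis unfolding minimal_factors_def by (intro exI[of _ V]) blast
qed

theorem theorem5p3:
  fixes X :: "'a set" and I :: "'i set" and r :: "'i \<Rightarrow> 'a word"
    and u :: "nat \<Rightarrow> 'a word" and k :: nat
  assumes "finite X" and "finite I"
    and "\<forall>j\<in>{1..k}. u j \<in> words X"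
    and "factorisation (r ` I) (u ` {1..k})"
  shows "(unital X (r ` I) (u ` {1..k}) \<longrightarrow> conservative X (r ` I) (u ` {1..k})) \<and>
    (uniquely_marked X k u \<and> conservative X (r ` I) (u ` {1..k}) \<and>
      decidable_word_problem X (gp_elem X (special (r ` I))) \<longrightarrow>
        decidable_prefix_membership X (r ` I) \<and>
        decidable_word_problem X (EU_elem X (special (r ` I))) \<and>
        (E_unitary (Inv X (special (r ` I))) \<longrightarrow>
          decidable_word_problem X (inv_elem X (special (r ` I)))))"
proof -
  let ?rs = "r ` I" and ?J = "{1..k}"
  let ?us = "u ` ?J"
  have us: "?us \<subseteq> words X" using assms(3) by blast
  have rs: "?rs \<subseteq> free_star (signed ?us)" using assms(4) by (simp add: factorisation_def)
  interpret special_presentation X ?rs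
    using rs free_star_words[OF signed_subset_words[OF us]] by unfold_locales blast
  have "decidable_prefix_membership X ?rs"
    if um: "uniquely_marked X k u" and cons: "conservative X ?rs ?us"
      and wp: "decidable_word_problem X (gp_elem X (special ?rs))"
  proof -
    obtain a x s b where m: "\<And>j. j \<in> ?J \<Longrightarrow> u j = a j @ [(x j, s j)] @ b j"
      "\<And>j. j \<in> ?J \<Longrightarrow> x j \<in> X" "inj_on x ?J"
      "\<And>j. j \<in> ?J \<Longrightarrow> a j \<in> words (X - x ` ?J)" "\<And>j. j \<in> ?J \<Longrightarrow> b j \<in> words (X - x ` ?J)"
      by (rule uniquely_markedE[OF um assms(3)], rule that) blast+
    obtain V where "minimal_factors ?rs ?us V" using ex_minimal_factors[OF _ rs] by blast
    then have V: "V \<subseteq> signed ?us" "?rs \<subseteq> free_star V" "\<And>V'. V' \<subset> V \<Longrightarrow> \<not> ?rs \<subseteq> free_star V'"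
      and c: "prefix_monoid X ?rs = mon_gen (Gp X (special ?rs)) (gp_elem X (special ?rs) ` (\<Union>v\<in>V. pref v))"
      using cons by (auto simp: minimal_factors_def conservative_def)
    have Vw: "v \<in> words X" if "v \<in> V" for v using signed_subset_words[OF us] V(1) that by blast
    have T: "(\<Union>v\<in>V. pref v) \<subseteq> words X" using words_prefix Vw by (auto simp: pref_def)
    have "w \<in> P \<longleftrightarrow> w \<in> sub (\<Union>v\<in>V. pref v)" if "w \<in> words X" for w
      using P_iff[OF that] gp_elem_mon_gen_iff[OF T that] c by simp
    then have P: "P = sub (\<Union>v\<in>V. pref v)" using P_words sub_words by blast
    have V_P: "concat vs \<in> P" if "set vs \<subseteq> V" for vs
      unfolding P using that T by (intro sub_concat subsetI sub_base) (auto simp: pref_def)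
    interpret conservative_presentation X ?rs ?J u a b x s V
    proof unfold_locales
      \<comment> \<open>The factors that occur in \<open>V\<close> with some sign already write all
        relators. As no proper subset of the factors does, these are all of them.\<close>
      let ?us' = "{w \<in> ?us. w \<in> V \<or> inv_word w \<in> V}"
      have "v \<in> signed ?us'" if "v \<in> V" for v
        using V(1) that by (force simp: signed_def)
      then have "free_star V \<subseteq> free_star (signed ?us')"
        unfolding free_star_def by (intro image_mono lists_mono) blast
      with V(2) have "?rs \<subseteq> free_star (signed ?us')" by (rule subset_trans)
      moreover have "\<forall>us'. us' \<subset> ?us \<longrightarrow> \<not> ?rs \<subseteq> free_star (signed us')"
        using assms(4) by (simp add: factorisation_def)
      ultimately have "\<not> ?us' \<subset> ?us" by meson
      moreover have "?us' \<subseteq> ?us" by blast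
      ultimately have us': "?us' = ?us" by (simp add: psubset_eq)
      show "u j \<in> V \<or> inv_word (u j) \<in> V" if "j \<in> ?J" for j
      proof -
        have "u j \<in> ?us'" unfolding us' using that by (rule imageI)
        then show ?thesis by simp
      qed
    next
      fix v assume v: "v \<in> V"
      \<comment> \<open>By minimality of \<open>V\<close>, leaving out \<open>v\<close> loses some
        relator \<open>r'\<close>, so every way of writing \<open>r'\<close> over \<open>V\<close>
        uses \<open>v\<close>.\<close>
      then obtain r' where r': "r' \<in> ?rs" "r' \<notin> free_star (V - {v})" using V(3)[of "V - {v}"] by blast
      then have "r' \<in> concat ` lists V" using V(2) by (auto simp: free_star_def)
      then obtain vs where vs: "set vs \<subseteq> V" "r' = concat vs" by (auto simp: in_lists_conv_set)
      have "v \<in> set vs"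
      proof (rule ccontr)
        assume "v \<notin> set vs"
        then have "vs \<in> lists (V - {v})" using vs(1) by (auto simp: in_lists_conv_set)
        then show False using r'(2) vs(2) by (auto simp: free_star_def)
      qed
      then obtain vs1 vs2 where d: "vs = vs1 @ v # vs2" by (meson split_list)
      have "concat vs2 @ concat vs1 \<in> P" using V_P[of "vs2 @ vs1"] vs(1) d by simp
      then show "inv_word v \<in> P" using inv_factor_in_P[of "concat vs1" v "concat vs2"] r'(1) vs(2) d by simp
    qed (use m rs V P in auto)
    show ?thesis using decidable_prefix_membership assms(1) wp by simp
  qed
  moreover have "decidable_word_problem X (inv_elem X (special ?rs))"
    if "E_unitary (Inv X (special ?rs))" "decidable_word_problem X (EU_elem X (special ?rs))"
  proof -
    have "{prod_encode (word_code X v, word_code X w) | v w. v \<in> words X \<and> w \<in> words X \<and>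
          inv_elem X (special ?rs) v = inv_elem X (special ?rs) w} =
        {prod_encode (word_code X v, word_code X w) | v w. v \<in> words X \<and> w \<in> words X \<and>
          EU_elem X (special ?rs) v = EU_elem X (special ?rs) w}"
      using E_unitary_imp_EU_elem_eq_iff[OF that(1)] by blast
    then show ?thesis using that(2) unfolding decidable_word_problem_def by simp
  qed
  ultimately show ?thesis
    using unital_imp_conservative[OF us] decidable_EU_word_problem assms(1,2) by blast
qed

end
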